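(* Let $X$ be a smooth Hausdorff paracompact manifold. Then the sheaf $\Omega\to\mathcal{G}(\Omega)$ ($\Omega$ open in $X$) of algebras of generalized functions is a supple sheaf. That is: for every open set $U\subseteq X$, every $f\in\mathcal{G}(U)$, and all closed sets $Z_1,Z_2$ of $X$ with $\operatorname{supp} f=Z_1\cup Z_2$, there exist $f_1,f_2\in\mathcal{G}(U)$ such that $\operatorname{supp} f_1\subseteq Z_1$, $\operatorname{supp} f_2\subseteq Z_2$ and $f=f_1+f_2$.
   Context: Functions are scalar valued (real or complex, fixed throughout). $K\subset\subset\Omega$ means that $K$ is a compact subset of $\Omega$. All $O$-estimates are for $\varepsilon\to 0$. Let $\Omega$ be an open subset of $X$, regarded as a manifold. Let $\mathcal{E}(\Omega)=(C^\infty(\Omega))^{(0,1)}$ be the set of all nets $(u_\varepsilon)_{\varepsilon\in(0,1)}$ of smooth functions on $\Omega$, and let $\mathcal{P}(\Omega)$ be the space of linear differential operators (with smooth coefficients) acting on smooth functions on $\Omega$. Moderate nets: $\mathcal{E}_M(\Omega)$ is the set of $(u_\varepsilon)_\varepsilon\in\mathcal{E}(\Omega)$ such that for every $K\subset\subset\Omega$ and every $P\in\mathcal{P}(\Omega)$ there is $N\in\mathbb{N}$ with $\sup_{p\in K}|Pu_\varepsilon(p)|=O(\varepsilon^{-N})$. Negligible nets: $\mathcal{N}(\Omega)$ is the set of $(u_\varepsilon)_\varepsilon\in\mathcal{E}_M(\Omega)$ such that for every $K\subset\subset\Omega$ and every $m\in\mathbb{N}$, $\sup_{p\in K}|u_\varepsilon(p)|=O(\varepsilon^{m})$.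 $\mathcal{E}_M(\Omega)$ is an algebra under the $\varepsilon$-wise operations and $\mathcal{N}(\Omega)$ is an ideal in it. The algebra of generalized functions is $\mathcal{G}(\Omega)=\mathcal{E}_M(\Omega)/\mathcal{N}(\Omega)$, and the class of $(u_\varepsilon)_\varepsilon$ is written $[(u_\varepsilon)_\varepsilon]$. For open $\Omega'\subseteq\Omega$ the restriction is $[(u_\varepsilon)_\varepsilon]|_{\Omega'}=[(u_\varepsilon|_{\Omega'})_\varepsilon]\in\mathcal{G}(\Omega')$. With these restrictions $\Omega\to\mathcal{G}(\Omega)$ is a sheaf of algebras on $X$, and its sections over $U$ are the elements of $\mathcal{G}(U)$. The support $\operatorname{supp} u$ of $u\in\mathcal{G}(U)$ is the complement in $U$ of the union of all open sets $U'\subseteq U$ with $u|_{U'}=0$ in $\mathcal{G}(U')$. A sheaf $\mathcal{F}$ on a topological space $X$ is called supple if for every open $U\subseteq X$ and every section $f\in\Gamma(U,\mathcal{F})$ the following holds: if $\operatorname{supp} f=Z_1\cup Z_2$ with $Z_1,Z_2$ arbitrary closed sets of $X$, then there exist $f_1,f_2\in\Gamma(U,\mathcal{F})$ with $\operatorname{supp} f_1\subseteq Z_1$, $\operatorname{supp} f_2\subseteq Z_2$ and $f=f_1+f_2$. *)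

theory Defs
  imports
    "HOL-Analysis.Analysis"
    "HOL-Library.Landau_Symbols"
    "HOL-Algebra.QuotRing"
begin

section \<open>Smooth maps between open subsets of vector spaces\<close>

text \<open>For open \<open>S\<close> in a finite-dimensional space, \<open>Ck_on k S f\<close> is the usual notion of \<open>f\<close> being
  \<open>k\<close> times continuously differentiable: all iterated directional derivatives of order at most \<open>k\<close>
  exist and are continuous.\<close>

primrec Ck_on :: "nat \<Rightarrow> 'e::real_normed_vector set \<Rightarrow> ('e \<Rightarrow> 'b::real_normed_vector) \<Rightarrow> bool" where
  "Ck_on 0 S f \<longleftrightarrow> continuous_on S f"
| "Ck_on (Suc k) S f \<longleftrightarrow>
     (\<forall>x\<in>S. f differentiable (at x)) \<and> (\<forall>v. Ck_on k S (\<lambda>x. frechet_derivative f (at x) v))"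

definition smooth_on :: "'e::real_normed_vector set \<Rightarrow> ('e \<Rightarrow> 'b::real_normed_vector) \<Rightarrow> bool" where
  "smooth_on S f \<longleftrightarrow> (\<forall>k. Ck_on k S f)"

primrec iter_deriv ::
  "'e::real_normed_vector list \<Rightarrow> ('e \<Rightarrow> 'b::real_normed_vector) \<Rightarrow> 'e \<Rightarrow> 'b" where
  "iter_deriv [] f = f"
| "iter_deriv (v # vs) f = (\<lambda>x. frechet_derivative (iter_deriv vs f) (at x) v)"


section \<open>Smooth manifolds\<close>

text \<open>A manifold is a topology together with a (not necessarily maximal) atlas. A chart is a pair
  \<open>(V, \<phi>)\<close> of a domain and a coordinate map; values of \<open>\<phi>\<close> outside \<open>V\<close> are irrelevant. The model
  space has sort \<open>{real_inner, heine_borel}\<close>: the inner product spaces with the Heine-Borel property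
  are exactly the finite-dimensional ones. The class \<open>euclidean_space\<close> is not used because it
  excludes dimension 0.\<close>

type_synonym ('a, 'e) chart = "'a set \<times> ('a \<Rightarrow> 'e)"

definition smooth_manifold ::
  "'a topology \<Rightarrow> ('a, 'e::{real_inner, heine_borel}) chart set \<Rightarrow> bool" where
  "smooth_manifold X A \<longleftrightarrow>
     (\<Union>(V, \<phi>)\<in>A. V) = topspace X \<and>
     (\<forall>(V, \<phi>)\<in>A. openin X V \<and> open (\<phi> ` V) \<and>
        homeomorphic_map (subtopology X V) (top_of_set (\<phi> ` V)) \<phi>) \<and>
     (\<forall>(V, \<phi>)\<in>A. \<forall>(W, \<psi>)\<in>A. smooth_on (\<phi> ` (V \<inter> W)) (\<psi> \<circ> inv_into V \<phi>))"

definition paracompact_space :: "'a topology \<Rightarrow> bool" where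
  "paracompact_space X \<longleftrightarrow>
     (\<forall>\<U>. (\<forall>U\<in>\<U>. openin X U) \<and> \<Union>\<U> = topspace X \<longrightarrow>
        (\<exists>\<V>. (\<forall>V\<in>\<V>. openin X V) \<and> \<Union>\<V> = topspace X \<and>
             (\<forall>V\<in>\<V>. \<exists>U\<in>\<U>. V \<subseteq> U) \<and> locally_finite_in X \<V>))"

text \<open>Functions on an open set \<open>\<Omega>\<close> are represented by total functions whose values outside \<open>\<Omega>\<close> are
  irrelevant; restriction to a smaller open set is then the identity on representatives.\<close>

definition smooth_functions ::
  "('a, 'e::{real_inner, heine_borel}) chart set \<Rightarrow> 'a set \<Rightarrow> ('a \<Rightarrow> 'k::real_normed_field) set" where
  "smooth_functions A \<Omega> =
     {u. \<forall>(V, \<phi>)\<in>A. smooth_on (\<phi> ` (V \<inter> \<Omega>)) (u \<circ> inv_into V \<phi>)}"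

text \<open>The operators that are given in every chart by a linear combination, with smooth
  coefficients, of partial derivatives of order at most \<open>m\<close>. Finitely many iterated derivatives along
  constant vectors take the place of the partial derivatives with respect to a chosen basis.\<close>

definition diff_operators ::
  "('a, 'e::{real_inner, heine_borel}) chart set \<Rightarrow> 'a set
     \<Rightarrow> (('a \<Rightarrow> 'k::real_normed_field) \<Rightarrow> ('a \<Rightarrow> 'k)) set" where
  "diff_operators A \<Omega> =
     {P. \<exists>m. \<forall>(V, \<phi>)\<in>A. \<exists>L a.
        finite L \<and>
        (\<forall>vs\<in>L. length vs \<le> m \<and> smooth_on (\<phi> ` (V \<inter> \<Omega>)) (a vs)) \<and>
        (\<forall>u\<in>smooth_functions A \<Omega>. \<forall>p\<in>V \<inter> \<Omega>.
           P u p = (\<Sum>vs\<in>L. a vs (\<phi> p) * iter_deriv vs (u \<circ> inv_into V \<phi>) (\<phi> p)))}"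


section \<open>The algebra of generalized functions\<close>

text \<open>The supremum of the empty set of reals is unspecified, so the case \<open>K = {}\<close> is separate.\<close>

definition sup_norm :: "'a set \<Rightarrow> ('a \<Rightarrow> 'k::real_normed_vector) \<Rightarrow> real" where
  "sup_norm K g = (if K = {} then 0 else (SUP p\<in>K. norm (g p)))"

text \<open>Nets indexed by \<open>\<epsilon> \<in> (0,1)\<close>; as for functions, values at other \<open>\<epsilon>\<close> are irrelevant.\<close>

type_synonym ('a, 'k) net = "real \<Rightarrow> 'a \<Rightarrow> 'k"

definition smooth_nets ::
  "('a, 'e::{real_inner, heine_borel}) chart set \<Rightarrow> 'a set \<Rightarrow> ('a, 'k::real_normed_field) net set" where
  "smooth_nets A \<Omega> = {u. \<forall>\<epsilon>\<in>{0<..<1}. u \<epsilon> \<in> smooth_functions A \<Omega>}"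

definition moderate_nets ::
  "'a topology \<Rightarrow> ('a, 'e::{real_inner, heine_borel}) chart set \<Rightarrow> 'a set
     \<Rightarrow> ('a, 'k::real_normed_field) net set" where
  "moderate_nets X A \<Omega> =
     {u \<in> smooth_nets A \<Omega>.
        \<forall>K P. compactin X K \<and> K \<subseteq> \<Omega> \<and> P \<in> diff_operators A \<Omega> \<longrightarrow>
          (\<exists>N::nat. (\<lambda>\<epsilon>. sup_norm K (P (u \<epsilon>))) \<in> O[at_right 0](\<lambda>\<epsilon>. \<epsilon> powr (- real N)))}"

definition negligible_nets ::
  "'a topology \<Rightarrow> ('a, 'e::{real_inner, heine_borel}) chart set \<Rightarrow> 'a set
     \<Rightarrow> ('a, 'k::real_normed_field) net set" where
  "negligible_nets X A \<Omega> =
     {u \<in> moderate_nets X A \<Omega>.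
        \<forall>K. compactin X K \<and> K \<subseteq> \<Omega> \<longrightarrow>
          (\<forall>m::nat. (\<lambda>\<epsilon>. sup_norm K (u \<epsilon>)) \<in> O[at_right 0](\<lambda>\<epsilon>. \<epsilon> ^ m))}"

definition moderate_ring ::
  "'a topology \<Rightarrow> ('a, 'e::{real_inner, heine_borel}) chart set \<Rightarrow> 'a set
     \<Rightarrow> ('a, 'k::real_normed_field) net ring" where
  "moderate_ring X A \<Omega> =
     \<lparr>carrier = moderate_nets X A \<Omega>,
      monoid.mult = (\<lambda>u v \<epsilon> p. u \<epsilon> p * v \<epsilon> p), one = (\<lambda>\<epsilon> p. 1),
      zero = (\<lambda>\<epsilon> p. 0), add = (\<lambda>u v \<epsilon> p. u \<epsilon> p + v \<epsilon> p)\<rparr>"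

text \<open>Nets that agree on \<open>\<Omega>\<close> for all \<open>\<epsilon> \<in> (0,1)\<close> differ by a negligible net, so the quotient does
  not see the irrelevant values of the representatives.\<close>

definition gen_fun ::
  "'a topology \<Rightarrow> ('a, 'e::{real_inner, heine_borel}) chart set \<Rightarrow> 'a set
     \<Rightarrow> ('a, 'k::real_normed_field) net set ring" where
  "gen_fun X A \<Omega> = moderate_ring X A \<Omega> Quot negligible_nets X A \<Omega>"

definition gen_class ::
  "'a topology \<Rightarrow> ('a, 'e::{real_inner, heine_borel}) chart set \<Rightarrow> 'a set
     \<Rightarrow> ('a, 'k::real_normed_field) net \<Rightarrow> ('a, 'k) net set" where
  "gen_class X A \<Omega> u = negligible_nets X A \<Omega> +>\<^bsub>moderate_ring X A \<Omega>\<^esub> u"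

text \<open>All members of the class \<open>f\<close> over the larger set give the same class over \<open>\<Omega>'\<close>; the union
  picks out this common value.\<close>

definition gen_restrict ::
  "'a topology \<Rightarrow> ('a, 'e::{real_inner, heine_borel}) chart set \<Rightarrow> 'a set
     \<Rightarrow> ('a, 'k::real_normed_field) net set \<Rightarrow> ('a, 'k) net set" where
  "gen_restrict X A \<Omega>' f = (\<Union>u\<in>f. gen_class X A \<Omega>' u)"


section \<open>Supple sheaves\<close>

text \<open>A sheaf of rings is given by its rings of sections \<open>\<Gamma> U\<close> for open \<open>U\<close> and its restriction maps,
  \<open>\<rho> V s\<close> being the restriction of the section \<open>s\<close> to \<open>V\<close>.\<close>

definition sheaf_supp ::
  "'a topology \<Rightarrow> ('a set \<Rightarrow> 's ring) \<Rightarrow> ('a set \<Rightarrow> 's \<Rightarrow> 's) \<Rightarrow> 'a set \<Rightarrow> 's \<Rightarrow> 'a set" where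
  "sheaf_supp X \<Gamma> \<rho> U f = U - \<Union>{V. openin X V \<and> V \<subseteq> U \<and> \<rho> V f = \<zero>\<^bsub>\<Gamma> V\<^esub>}"

definition supple ::
  "'a topology \<Rightarrow> ('a set \<Rightarrow> 's ring) \<Rightarrow> ('a set \<Rightarrow> 's \<Rightarrow> 's) \<Rightarrow> bool" where
  "supple X \<Gamma> \<rho> \<longleftrightarrow>
     (\<forall>U f Z\<^sub>1 Z\<^sub>2.
        openin X U \<and> f \<in> carrier (\<Gamma> U) \<and> closedin X Z\<^sub>1 \<and> closedin X Z\<^sub>2 \<and>
        sheaf_supp X \<Gamma> \<rho> U f = Z\<^sub>1 \<union> Z\<^sub>2 \<longrightarrow>
        (\<exists>f\<^sub>1\<in>carrier (\<Gamma> U). \<exists>f\<^sub>2\<in>carrier (\<Gamma> U).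
           sheaf_supp X \<Gamma> \<rho> U f\<^sub>1 \<subseteq> Z\<^sub>1 \<and> sheaf_supp X \<Gamma> \<rho> U f\<^sub>2 \<subseteq> Z\<^sub>2 \<and>
           f = f\<^sub>1 \<oplus>\<^bsub>\<Gamma> U\<^esub> f\<^sub>2))"

end

theory Submission
  imports Defs
begin

text \<open>Write \<open>f = [u]\<close> and look for a moderate net \<open>\<kappa>\<close> with values of norm at most 1 such that
  \<open>f = [(1 - \<kappa>) u] + [\<kappa> u]\<close> is the required splitting. It has to equal 1 near each point outside
  \<open>Z\<^sub>1\<close> for small \<open>\<epsilon>\<close>, and \<open>\<kappa> u\<close> has to be negligible near each point of \<open>Z\<^sub>1 - Z\<^sub>2\<close>. Locally,
  take \<open>\<kappa> \<epsilon>\<close> to vanish near \<open>Z\<^sub>1\<close> and to be 1 outside the \<open>r\<^sub>n\<close>-neighbourhood of \<open>Z\<^sub>1\<close>, where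
  \<open>r\<^sub>n\<close> tends to 0 and \<open>n = \<nu> \<epsilon>\<close> tends to infinity. For fixed \<open>n\<close> the net \<open>u\<close> is negligible on the
  compact set of points that are neither near \<open>Z\<^sub>1\<close> nor within \<open>r\<^sub>n\<close> of \<open>Z\<^sub>2\<close>; if \<open>\<nu>\<close> grows slowly enough, \<open>norm (u \<epsilon>) \<le> \<epsilon> ^ n\<close>
  holds there for \<open>n = \<nu> \<epsilon>\<close>, and the derivatives of \<open>\<kappa> \<epsilon>\<close> stay below \<open>1 / \<epsilon>\<close>. A locally finite product of
  such cutoffs, which exists by paracompactness, is the global \<open>\<kappa>\<close>; since \<open>Z\<^sub>1\<close> is closed in \<open>X\<close>
  and not only in \<open>U\<close>, no paracompactness of \<open>U\<close> is needed. That a product of moderate nets is moderate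
  is seen in charts, so moderateness is first characterised by chartwise bounds on all derivatives.\<close>

section \<open>Finite-dimensional inner product spaces\<close>

text \<open>When the two closed sets are disjoint, a fixed smooth cutoff suffices. Where
  \<open>Z\<^sub>1\<close> and \<open>Z\<^sub>2\<close> meet, it would in general have to jump, so
  the transition must become steeper as \<epsilon> tends to 0. Generalized functions tolerate this,
  since moderateness lets derivatives grow like powers of 1/\<epsilon>. But u is negligible off the
  support only locally uniformly, with thresholds in \<epsilon> that may deteriorate arbitrarily
  fast towards the support. The scale therefore has to be adapted to the given net by a diagonal
  choice; a fixed power of \<epsilon> would not do. Negligibility of a moderate net is a condition
  on values alone, so only the size of \<open>\<kappa> u\<close> has to be estimated, not that of
  its derivatives. Products of cutoffs serve better than a partition of unity: one factor that makes
  u small is enough, the remaining factors have norm at most 1, and no normalisation arises. No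
  smallness is demanded at common points of the two closed sets.\<close>

lemma finite_orthonormal_expansion:
  "\<exists>B :: 'e::{real_inner, heine_borel} set. finite B \<and> (\<forall>x. (\<Sum>b\<in>B. (x \<bullet> b) *\<^sub>R b) = x)"
proof -
  \<comment> \<open>The Heine-Borel property enters through compactness of the unit ball: finitely
    many unit balls cover it, and their centres turn out to span the space.\<close>
  obtain S where S: "finite S" "cball (0::'e) 1 \<subseteq> (\<Union>s\<in>S. ball s 1)"
  proof (rule compactE_image)
    show "compact (cball (0::'e) 1)" by (rule compact_cball)
    show "cball (0::'e) 1 \<subseteq> (\<Union>s\<in>UNIV. ball s 1)"
      by (meson UN_I UNIV_I centre_in_ball subsetI zero_less_one)
  qed auto
  obtain C where C: "finite C" "span C = span S" "pairwise orthogonal C"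
    using basis_orthogonal[OF S(1)] by blast
  define B where "B = (\<lambda>b. b /\<^sub>R norm b) ` (C - {0})"
  have fB: "finite B" using C(1) by (simp add: B_def)
  have B1: "b \<bullet> b = 1" if "b \<in> B" for b
  proof -
    from that obtain c where "c \<noteq> 0" "b = c /\<^sub>R norm c" by (auto simp: B_def)
    then have "norm b = 1" by simp
    then show ?thesis by (simp add: dot_square_norm)
  qed
  have B2: "b \<bullet> b' = 0" if "b \<in> B" "b' \<in> B" "b \<noteq> b'" for b b'
  proof -
    from that obtain c c' where c: "c \<in> C" "c' \<in> C" "b = c /\<^sub>R norm c" "b' = c' /\<^sub>R norm c'"
      unfolding B_def by blast
    have "c \<noteq> c'"
    proof
      assume "c = c'"
      with c(3,4) that(3) show False by blast
    qed
    then have "c \<bullet> c' = 0" using pairwiseD[OF C(3) c(1,2)] by (simp add: orthogonal_def)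
    with c show ?thesis by simp
  qed
  have "C \<subseteq> span B"
  proof
    fix c assume c: "c \<in> C"
    show "c \<in> span B"
    proof (cases "c = 0")
      case False
      then have "c /\<^sub>R norm c \<in> span B" using c by (auto simp: B_def intro!: span_base)
      then have "norm c *\<^sub>R (c /\<^sub>R norm c) \<in> span B" by (rule span_scale)
      then show ?thesis using False by simp
    qed (simp add: span_zero)
  qed
  then have SB: "S \<subseteq> span B"
    by (metis C(2) span_minimal span_superset subset_trans subspace_span)
  have "(\<Sum>b\<in>B. (x \<bullet> b) *\<^sub>R b) = x" for x
  proof (rule ccontr)
    define e where "e = x - (\<Sum>b\<in>B. (x \<bullet> b) *\<^sub>R b)"
    assume "(\<Sum>b\<in>B. (x \<bullet> b) *\<^sub>R b) \<noteq> x"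
    then have e: "e \<noteq> 0" by (auto simp: e_def)
    have "e \<bullet> b = 0" if b: "b \<in> B" for b
    proof -
      have "(\<Sum>b'\<in>B. (x \<bullet> b') *\<^sub>R b') \<bullet> b = (\<Sum>b'\<in>B. if b' = b then x \<bullet> b else 0)"
        unfolding inner_sum_left using B1 B2 b by (intro sum.cong) auto
      then show ?thesis using b fB by (simp add: e_def inner_diff_left)
    qed
    then have orth: "orthogonal e s" if "s \<in> S" for s
      using orthogonal_to_span[of s B e] SB that by (auto simp: orthogonal_def)
    \<comment> \<open>By Pythagoras a unit vector orthogonal to all centres has distance at least 1
      from each of them, so no ball of the cover contains it.\<close>
    define f where "f = e /\<^sub>R norm e"
    have "f \<in> cball 0 1" using e by (simp add: f_def)
    then obtain s where s: "s \<in> S" "dist s f < 1" using S(2) by auto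
    have "f \<bullet> s = 0" "f \<bullet> f = 1"
      using orth[OF s(1)] e by (simp_all add: f_def orthogonal_def dot_square_norm power2_eq_square)
    then have "(norm (s - f))\<^sup>2 = (norm s)\<^sup>2 + 1"
      by (simp add: power2_norm_eq_inner inner_diff inner_commute)
    moreover have "(norm (s - f))\<^sup>2 < 1"
      using s(2) by (simp add: dist_norm abs_square_less_1)
    ultimately show False using zero_le_power2[of "norm s"] by linarith
  qed
  with fB show ?thesis by blast
qed

text \<open>Fixed once and for all, so that derivatives in all directions reduce to one finite
  family of directions. Finiteness and the expansion are all that is recorded of an orthonormal
  basis; dimension 0 is included.\<close>

definition onb :: "'e::{real_inner, heine_borel} set" where
  "onb = (SOME B. finite B \<and> (\<forall>x. (\<Sum>b\<in>B. (x \<bullet> b) *\<^sub>R b) = x))"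

lemma finite_onb: "finite (onb :: 'e::{real_inner, heine_borel} set)"
  and onb_expansion: "(\<Sum>b\<in>onb. (x \<bullet> b) *\<^sub>R b) = (x :: 'e)"
  using someI_ex[OF finite_orthonormal_expansion, folded onb_def] by auto

lemma linear_onb_expansion:
  fixes f :: "'e::{real_inner, heine_borel} \<Rightarrow> 'b::real_vector"
  assumes "linear f"
  shows "f v = (\<Sum>b\<in>onb. (v \<bullet> b) *\<^sub>R f b)"
  by (subst onb_expansion[of v, symmetric]) (simp add: linear_sum[OF assms] linear_cmul[OF assms])

lemma frechet_derivative_onb:
  fixes f :: "'e::{real_inner, heine_borel} \<Rightarrow> 'b::real_normed_vector"
  assumes "f differentiable (at x)"
  shows "frechet_derivative f (at x) v = (\<Sum>b\<in>onb. (v \<bullet> b) *\<^sub>R frechet_derivative f (at x) b)"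
  by (rule linear_onb_expansion) (use assms linear_frechet_derivative in blast)

lemma differentiable_cong_open:
  assumes "f differentiable (at x)" "open S" "x \<in> S" "\<And>y. y \<in> S \<Longrightarrow> f y = g y"
  shows "g differentiable (at x)"
proof -
  obtain D where "(f has_derivative D) (at x)" using assms(1) by (auto simp: differentiable_def)
  then have "(g has_derivative D) (at x)"
    by (rule has_derivative_transform_within_open) (use assms in auto)
  then show ?thesis by (auto simp: differentiable_def)
qed

text \<open>Valid even at points of non-differentiability: both functions have the same set of
  derivatives there, and \<open>frechet_derivative\<close> chooses from that set.\<close>

lemma frechet_derivative_cong_open:
  assumes "open S" "x \<in> S" "\<And>y. y \<in> S \<Longrightarrow> f y = g y"
  shows "frechet_derivative f (at x) = frechet_derivative g (at x)"
proof -
  have "(f has_derivative D) (at x) \<longleftrightarrow> (g has_derivative D) (at x)" for D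
    using has_derivative_transform_within_open[of f D x UNIV S g]
      has_derivative_transform_within_open[of g D x UNIV S f] assms by auto
  then show ?thesis by (simp add: frechet_derivative_def)
qed

section \<open>Moderate nets on open subsets of the model space\<close>

text \<open>The local form of a moderate estimate: one neighbourhood serves all small \<epsilon>,
  while the power of 1/\<epsilon> may vary from point to point. Compactness later turns it into a
  bound on compact sets.\<close>

definition loc_bdd :: "(real \<Rightarrow> 'e::topological_space \<Rightarrow> 'b::real_normed_vector) \<Rightarrow> 'e \<Rightarrow> bool" where
  "loc_bdd u x \<longleftrightarrow> (\<exists>T C N. open T \<and> x \<in> T \<and>
     (\<forall>\<^sub>F \<epsilon> in at_right 0. \<forall>y\<in>T. norm (u \<epsilon> y) \<le> C * (1 / \<epsilon>) ^ N))"

lemma eventually_at_right_unit: "\<forall>\<^sub>F \<epsilon>::real in at_right 0. \<epsilon> \<in> {0<..<1}"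
  by (rule eventually_at_rightI[of 0 1]) auto

lemma eventually_at_right_mono_unit:
  assumes "\<forall>\<^sub>F \<epsilon>::real in at_right 0. P \<epsilon>" "\<And>\<epsilon>. 0 < \<epsilon> \<Longrightarrow> \<epsilon> < 1 \<Longrightarrow> P \<epsilon> \<Longrightarrow> Q \<epsilon>"
  shows "\<forall>\<^sub>F \<epsilon> in at_right 0. Q \<epsilon>"
  using assms(1) eventually_at_right_unit by eventually_elim (use assms(2) in auto)

lemma loc_bddE:
  assumes "loc_bdd u x"
  obtains T C N where "open T" "x \<in> T" "0 \<le> C"
    "\<forall>\<^sub>F \<epsilon> in at_right 0. \<forall>y\<in>T. norm (u \<epsilon> y) \<le> C * (1 / \<epsilon>) ^ N"
proof -
  obtain T C N where T: "open T" "x \<in> T"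
    and ev: "\<forall>\<^sub>F \<epsilon> in at_right 0. \<forall>y\<in>T. norm (u \<epsilon> y) \<le> C * (1 / \<epsilon>) ^ N"
    using assms unfolding loc_bdd_def by blast
  from ev have "\<forall>\<^sub>F \<epsilon> in at_right 0. \<forall>y\<in>T. norm (u \<epsilon> y) \<le> \<bar>C\<bar> * (1 / \<epsilon>) ^ N"
  proof (rule eventually_at_right_mono_unit, intro ballI)
    fix \<epsilon> :: real and y assume "0 < \<epsilon>" and a: "\<forall>y\<in>T. norm (u \<epsilon> y) \<le> C * (1 / \<epsilon>) ^ N" and "y \<in> T"
    then have "norm (u \<epsilon> y) \<le> C * (1 / \<epsilon>) ^ N" by blast
    also have "\<dots> \<le> \<bar>C\<bar> * (1 / \<epsilon>) ^ N" using \<open>0 < \<epsilon>\<close> by (intro mult_right_mono) auto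
    finally show "norm (u \<epsilon> y) \<le> \<bar>C\<bar> * (1 / \<epsilon>) ^ N" .
  qed
  with T show ?thesis using that[of T "\<bar>C\<bar>" N] by simp
qed

lemma loc_bdd_cong:
  assumes "loc_bdd u x" "open S" "x \<in> S"
    "\<And>\<epsilon> y. \<epsilon> \<in> {0<..<1} \<Longrightarrow> y \<in> S \<Longrightarrow> u \<epsilon> y = w \<epsilon> y"
  shows "loc_bdd w x"
proof -
  obtain T C N where T: "open T" "x \<in> T"
    and ev: "\<forall>\<^sub>F \<epsilon> in at_right 0. \<forall>y\<in>T. norm (u \<epsilon> y) \<le> C * (1 / \<epsilon>) ^ N"
    using assms(1) unfolding loc_bdd_def by blast
  have "\<forall>\<^sub>F \<epsilon> in at_right 0. \<forall>y\<in>T \<inter> S. norm (w \<epsilon> y) \<le> C * (1 / \<epsilon>) ^ N"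
    by (rule eventually_at_right_mono_unit[OF ev]) (use assms(4) in auto)
  with T assms(2,3) show ?thesis unfolding loc_bdd_def by (intro exI[of _ "T \<inter> S"]) blast
qed

lemma loc_bdd_const:
  assumes "isCont f x"
  shows "loc_bdd (\<lambda>_. f) x"
proof -
  have "\<forall>\<^sub>F y in nhds x. norm (f y) < norm (f x) + 1"
    using assms by (intro order_tendstoD(2)[of _ "norm (f x)"] tendsto_norm) (auto simp: isCont_def tendsto_at_iff_tendsto_nhds)
  then obtain T where "open T" "x \<in> T" "\<And>y. y \<in> T \<Longrightarrow> norm (f y) < norm (f x) + 1"
    unfolding eventually_nhds by blast
  then show ?thesis unfolding loc_bdd_def
    by (intro exI[of _ T] exI[of _ "norm (f x) + 1"] exI[of _ 0]) (auto intro: less_imp_le)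
qed

lemma loc_bdd_add:
  assumes "loc_bdd u x" "loc_bdd w x"
  shows "loc_bdd (\<lambda>\<epsilon> y. u \<epsilon> y + w \<epsilon> y) x"
proof -
  obtain T C N where T: "open T" "x \<in> T" "0 \<le> C"
    and 1: "\<forall>\<^sub>F \<epsilon> in at_right 0. \<forall>y\<in>T. norm (u \<epsilon> y) \<le> C * (1 / \<epsilon>) ^ N"
    using loc_bddE[OF assms(1)] .
  obtain T' C' N' where T': "open T'" "x \<in> T'" "0 \<le> C'"
    and 2: "\<forall>\<^sub>F \<epsilon> in at_right 0. \<forall>y\<in>T'. norm (w \<epsilon> y) \<le> C' * (1 / \<epsilon>) ^ N'"
    using loc_bddE[OF assms(2)] .
  have "\<forall>\<^sub>F \<epsilon> in at_right 0. \<forall>y\<in>T \<inter> T'. norm (u \<epsilon> y + w \<epsilon> y) \<le> (C + C') * (1 / \<epsilon>) ^ (N + N')"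
  proof (rule eventually_at_right_mono_unit[OF eventually_conj[OF 1 2]], intro ballI)
    fix \<epsilon> :: real and y
    assume \<epsilon>: "0 < \<epsilon>" "\<epsilon> < 1" and y: "y \<in> T \<inter> T'" and
      a: "(\<forall>y\<in>T. norm (u \<epsilon> y) \<le> C * (1 / \<epsilon>) ^ N) \<and> (\<forall>y\<in>T'. norm (w \<epsilon> y) \<le> C' * (1 / \<epsilon>) ^ N')"
    have p: "(1 / \<epsilon>) ^ N \<le> (1 / \<epsilon>) ^ (N + N')" "(1 / \<epsilon>) ^ N' \<le> (1 / \<epsilon>) ^ (N + N')"
      using \<epsilon> by (intro power_increasing; simp)+
    have "norm (u \<epsilon> y + w \<epsilon> y) \<le> C * (1 / \<epsilon>) ^ N + C' * (1 / \<epsilon>) ^ N'"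
      using a y by (intro norm_triangle_le add_mono) auto
    also have "\<dots> \<le> C * (1 / \<epsilon>) ^ (N + N') + C' * (1 / \<epsilon>) ^ (N + N')"
      by (intro add_mono mult_left_mono p T T')
    finally show "norm (u \<epsilon> y + w \<epsilon> y) \<le> (C + C') * (1 / \<epsilon>) ^ (N + N')" by (simp add: distrib_right)
  qed
  with T T' show ?thesis unfolding loc_bdd_def by (intro exI[of _ "T \<inter> T'"]) blast
qed

lemma loc_bdd_bilinear:
  assumes h: "bounded_bilinear h" and "loc_bdd u x" "loc_bdd w x"
  shows "loc_bdd (\<lambda>\<epsilon> y. h (u \<epsilon> y) (w \<epsilon> y)) x"
proof -
  obtain T C N where T: "open T" "x \<in> T" "0 \<le> C"
    and 1: "\<forall>\<^sub>F \<epsilon> in at_right 0. \<forall>y\<in>T. norm (u \<epsilon> y) \<le> C * (1 / \<epsilon>) ^ N"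
    using loc_bddE[OF assms(2)] .
  obtain T' C' N' where T': "open T'" "x \<in> T'" "0 \<le> C'"
    and 2: "\<forall>\<^sub>F \<epsilon> in at_right 0. \<forall>y\<in>T'. norm (w \<epsilon> y) \<le> C' * (1 / \<epsilon>) ^ N'"
    using loc_bddE[OF assms(3)] .
  obtain K where K: "0 \<le> K" "\<And>a b. norm (h a b) \<le> norm a * norm b * K"
    using bounded_bilinear.nonneg_bounded[OF h] by blast
  have "\<forall>\<^sub>F \<epsilon> in at_right 0. \<forall>y\<in>T \<inter> T'. norm (h (u \<epsilon> y) (w \<epsilon> y)) \<le> (C * C' * K) * (1 / \<epsilon>) ^ (N + N')"
  proof (rule eventually_at_right_mono_unit[OF eventually_conj[OF 1 2]], intro ballI)
    fix \<epsilon> :: real and y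
    assume \<epsilon>: "0 < \<epsilon>" "\<epsilon> < 1" and y: "y \<in> T \<inter> T'" and
      a: "(\<forall>y\<in>T. norm (u \<epsilon> y) \<le> C * (1 / \<epsilon>) ^ N) \<and> (\<forall>y\<in>T'. norm (w \<epsilon> y) \<le> C' * (1 / \<epsilon>) ^ N')"
    have "norm (h (u \<epsilon> y) (w \<epsilon> y)) \<le> norm (u \<epsilon> y) * norm (w \<epsilon> y) * K" by (rule K)
    also have "\<dots> \<le> (C * (1 / \<epsilon>) ^ N) * (C' * (1 / \<epsilon>) ^ N') * K"
      using a y T T' K(1) \<epsilon> by (intro mult_right_mono mult_mono) auto
    finally show "norm (h (u \<epsilon> y) (w \<epsilon> y)) \<le> (C * C' * K) * (1 / \<epsilon>) ^ (N + N')"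
      by (simp add: power_add mult_ac)
  qed
  with T T' show ?thesis unfolding loc_bdd_def by (intro exI[of _ "T \<inter> T'"]) blast
qed

lemma loc_bdd_compose:
  assumes "loc_bdd u (f x)" "open S" "x \<in> S" "continuous_on S f"
  shows "loc_bdd (\<lambda>\<epsilon> y. u \<epsilon> (f y)) x"
proof -
  obtain T C N where T: "open T" "f x \<in> T"
    and ev: "\<forall>\<^sub>F \<epsilon> in at_right 0. \<forall>y\<in>T. norm (u \<epsilon> y) \<le> C * (1 / \<epsilon>) ^ N"
    using assms(1) unfolding loc_bdd_def by blast
  have "open (f -` T \<inter> S)" using continuous_on_open_vimage[OF assms(2)] assms(4) T(1) by blast
  moreover have "\<forall>\<^sub>F \<epsilon> in at_right 0. \<forall>y\<in>f -` T \<inter> S. norm (u \<epsilon> (f y)) \<le> C * (1 / \<epsilon>) ^ N"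
    using ev by eventually_elim auto
  ultimately show ?thesis using T assms(3) unfolding loc_bdd_def
    by (intro exI[of _ "f -` T \<inter> S"]) auto
qed

definition dirderiv ::
  "'e::real_normed_vector \<Rightarrow> (real \<Rightarrow> 'e \<Rightarrow> 'b::real_normed_vector) \<Rightarrow> real \<Rightarrow> 'e \<Rightarrow> 'b" where
  "dirderiv v u = (\<lambda>\<epsilon> x. frechet_derivative (u \<epsilon>) (at x) v)"

text \<open>\<open>Ck_on\<close> for nets, with moderate bounds on all derivatives up to order k. A
  constant net is tame of every order exactly if the function is smooth, so stability under sums,
  products and composition is proved once and serves both moderate nets and smooth
  functions.\<close>

primrec tame :: "nat \<Rightarrow> 'e::real_normed_vector set \<Rightarrow> (real \<Rightarrow> 'e \<Rightarrow> 'b::real_normed_vector) \<Rightarrow> bool" where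
  "tame 0 S u \<longleftrightarrow> (\<forall>\<epsilon>\<in>{0<..<1}. continuous_on S (u \<epsilon>)) \<and> (\<forall>x\<in>S. loc_bdd u x)"
| "tame (Suc k) S u \<longleftrightarrow> (\<forall>\<epsilon>\<in>{0<..<1}. \<forall>x\<in>S. u \<epsilon> differentiable (at x)) \<and> (\<forall>x\<in>S. loc_bdd u x) \<and>
     (\<forall>v. tame k S (dirderiv v u))"

lemma tame_cong:
  assumes "tame k S u" "open S" "\<And>\<epsilon> x. \<epsilon> \<in> {0<..<1} \<Longrightarrow> x \<in> S \<Longrightarrow> u \<epsilon> x = w \<epsilon> x"
  shows "tame k S w"
  using assms(1,3)
proof (induction k arbitrary: u w)
  case 0
  have "continuous_on S (w \<epsilon>)" if "\<epsilon> \<in> {0<..<1}" for \<epsilon>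
    using 0 that continuous_on_cong[of S S "u \<epsilon>" "w \<epsilon>"] by simp
  moreover have "loc_bdd w x" if "x \<in> S" for x
    by (rule loc_bdd_cong[of u x S]) (use 0 that assms(2) in auto)
  ultimately show ?case by simp
next
  case (Suc k)
  have "tame k S (dirderiv v w)" for v
  proof (rule Suc.IH[of "dirderiv v u"])
    show "dirderiv v u \<epsilon> x = dirderiv v w \<epsilon> x" if "\<epsilon> \<in> {0<..<1}" "x \<in> S" for \<epsilon> x
      unfolding dirderiv_def using that Suc.prems(2) assms(2)
      by (intro fun_cong[OF frechet_derivative_cong_open[of S]]) auto
  qed (use Suc.prems in auto)
  moreover have "w \<epsilon> differentiable (at x)" if "\<epsilon> \<in> {0<..<1}" "x \<in> S" for \<epsilon> x
    using differentiable_cong_open[of "u \<epsilon>" x S "w \<epsilon>"] that Suc.prems assms(2) by auto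
  moreover have "loc_bdd w x" if "x \<in> S" for x
    by (rule loc_bdd_cong[of u x S]) (use Suc.prems that assms(2) in auto)
  ultimately show ?case by simp
qed

lemma tame_subset:
  assumes "tame k S u" "T \<subseteq> S"
  shows "tame k T u"
  using assms(1) by (induction k arbitrary: u) (use assms(2) in \<open>auto intro: continuous_on_subset\<close>)

text \<open>Every clause of \<open>tame\<close> at x is decided in an arbitrarily small open
  neighbourhood of x. As k is fixed, that neighbourhood may depend on the order.\<close>

lemma tame_local:
  assumes "\<And>x. x \<in> S \<Longrightarrow> \<exists>T. open T \<and> x \<in> T \<and> tame k T u"
  shows "tame k S u"
  using assms
proof (induction k arbitrary: u)
  case 0
  have "isCont (u \<epsilon>) x" if "x \<in> S" "\<epsilon> \<in> {0<..<1}" for x \<epsilon>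
  proof -
    from 0[OF that(1)] obtain T where "open T" "x \<in> T" "tame 0 T u" by blast
    with that(2) show ?thesis using continuous_on_eq_continuous_at[of T "u \<epsilon>"] by auto
  qed
  then have "continuous_on S (u \<epsilon>)" if "\<epsilon> \<in> {0<..<1}" for \<epsilon>
    using that by (simp add: continuous_at_imp_continuous_on)
  moreover have "loc_bdd u x" if "x \<in> S" for x using 0[OF that] by auto
  ultimately show ?case by simp
next
  case (Suc k)
  have "tame k S (dirderiv v u)" for v
  proof (rule Suc.IH)
    fix x assume "x \<in> S"
    from Suc.prems[OF this] show "\<exists>T. open T \<and> x \<in> T \<and> tame k T (dirderiv v u)" by auto
  qed
  moreover have "u \<epsilon> differentiable (at x) \<and> loc_bdd u x" if "\<epsilon> \<in> {0<..<1}" "x \<in> S" for \<epsilon> x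
    using Suc.prems[OF that(2)] that(1) by auto
  moreover have "loc_bdd u x" if "x \<in> S" for x using Suc.prems[OF that] by auto
  ultimately show ?case by simp
qed

lemma continuous_on_if_differentiable_at:
  "(\<And>x. x \<in> S \<Longrightarrow> f differentiable (at x)) \<Longrightarrow> continuous_on S f"
  by (simp add: differentiable_at_imp_differentiable_on differentiable_imp_continuous_on)

lemma tame_Suc_imp: "tame (Suc k) S u \<Longrightarrow> tame k S u"
proof (induction k arbitrary: u)
  case 0
  then show ?case by (simp add: continuous_on_if_differentiable_at)
next
  case (Suc k)
  from Suc.prems have "tame (Suc k) S (dirderiv v u)" for v
    using tame.simps(2)[of "Suc k" S u] by blast
  then have "tame k S (dirderiv v u)" for v by (rule Suc.IH)
  with Suc.prems tame.simps(2)[of "Suc k" S u] show ?case by simp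
qed

lemma tame_loc_bdd: "tame k S u \<Longrightarrow> x \<in> S \<Longrightarrow> loc_bdd u x"
  by (cases k) auto

lemma Ck_on_if_tame: "tame k S u \<Longrightarrow> \<epsilon> \<in> {0<..<1} \<Longrightarrow> Ck_on k S (u \<epsilon>)"
proof (induction k arbitrary: u)
  case (Suc k)
  have "Ck_on k S (dirderiv v u \<epsilon>)" for v
    using Suc.prems by (intro Suc.IH) auto
  then show ?case using Suc.prems by (simp add: dirderiv_def)
qed simp

lemma smooth_on_deriv: "smooth_on S f \<Longrightarrow> smooth_on S (\<lambda>x. frechet_derivative f (at x) v)"
  unfolding smooth_on_def by (metis Ck_on.simps(2))

lemma smooth_on_differentiable: "smooth_on S f \<Longrightarrow> x \<in> S \<Longrightarrow> f differentiable (at x)"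
  unfolding smooth_on_def by (metis Ck_on.simps(2))

lemma smooth_on_continuous: "smooth_on S f \<Longrightarrow> continuous_on S f"
  unfolding smooth_on_def by (metis Ck_on.simps(1))

lemma tame_if_smooth_on: "open S \<Longrightarrow> smooth_on S f \<Longrightarrow> tame k S (\<lambda>_. f)"
proof (induction k arbitrary: f)
  case 0
  then have "continuous_on S f" by (simp add: smooth_on_continuous)
  then show ?case using 0(1) by (simp add: continuous_on_eq_continuous_at loc_bdd_const)
next
  case (Suc k)
  have "continuous_on S f" using Suc.prems(2) by (rule smooth_on_continuous)
  moreover have "tame k S (dirderiv v (\<lambda>_. f))" for v
    unfolding dirderiv_def using Suc.prems by (intro Suc.IH smooth_on_deriv)
  ultimately show ?case using Suc.prems smooth_on_differentiable[OF Suc.prems(2)]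
    by (simp add: continuous_on_eq_continuous_at loc_bdd_const)
qed

text \<open>The index 1/2 is just some element of (0,1) at which the constant net is read
  off.\<close>

lemma smooth_on_iff_tame: "open S \<Longrightarrow> smooth_on S f \<longleftrightarrow> (\<forall>k. tame k S (\<lambda>_. f))"
  using tame_if_smooth_on Ck_on_if_tame[of _ S "\<lambda>_. f" "1/2"] unfolding smooth_on_def by auto

lemma smooth_on_const: "smooth_on S (\<lambda>_. c)"
proof -
  have "Ck_on k S (\<lambda>_. c)" for k
    by (induction k arbitrary: c) auto
  then show ?thesis by (simp add: smooth_on_def)
qed

lemma tame_const: "tame k S (\<lambda>_ _. c)"
  by (rule tame_subset[OF tame_if_smooth_on[of UNIV]]) (auto intro: smooth_on_const)

lemma tame_add:
  assumes "open S" "tame k S u" "tame k S w"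
  shows "tame k S (\<lambda>\<epsilon> x. u \<epsilon> x + w \<epsilon> x)"
  using assms(2,3)
proof (induction k arbitrary: u w)
  case 0
  then show ?case by (auto intro: continuous_on_add loc_bdd_add)
next
  case (Suc k)
  have "tame k S (dirderiv v (\<lambda>\<epsilon> x. u \<epsilon> x + w \<epsilon> x))" for v
  proof (rule tame_cong[OF Suc.IH assms(1)])
    show "tame k S (dirderiv v u)" "tame k S (dirderiv v w)" using Suc.prems by auto
    show "dirderiv v u \<epsilon> x + dirderiv v w \<epsilon> x = dirderiv v (\<lambda>\<epsilon> x. u \<epsilon> x + w \<epsilon> x) \<epsilon> x"
      if "\<epsilon> \<in> {0<..<1}" "x \<in> S" for \<epsilon> x
      unfolding dirderiv_def using Suc.prems that
      by (subst frechet_derivative_at[OF has_derivative_add, symmetric])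
        (auto simp: frechet_derivative_works)
  qed
  then show ?case using Suc.prems by (auto intro: loc_bdd_add)
qed

lemma tame_sum:
  assumes "open S" "finite F" "\<And>i. i \<in> F \<Longrightarrow> tame k S (u i)"
  shows "tame k S (\<lambda>\<epsilon> x. \<Sum>i\<in>F. u i \<epsilon> x)"
  using assms(2,3) by (induction F rule: finite_induct) (auto intro: tame_add assms(1) tame_const)

text \<open>Induction by the Leibniz rule: each of its two terms pairs a derivative, tame of order
  k, with an undifferentiated factor, whose order is lowered to k by \<open>tame_Suc_imp\<close>.
  The abstract bilinear map covers multiplication, scaling and inner products.\<close>

lemma tame_bilinear:
  assumes h: "bounded_bilinear h" and S: "open S" and "tame k S u" "tame k S w"
  shows "tame k S (\<lambda>\<epsilon> x. h (u \<epsilon> x) (w \<epsilon> x))"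
  using assms(3,4)
proof (induction k arbitrary: u w)
  case 0
  then show ?case
    by (auto intro: bounded_bilinear.continuous_on[OF h] loc_bdd_bilinear[OF h])
next
  case (Suc k)
  have "tame k S (dirderiv v (\<lambda>\<epsilon> x. h (u \<epsilon> x) (w \<epsilon> x)))" for v
  proof (rule tame_cong[OF tame_add[OF S Suc.IH Suc.IH] S])
    show "tame k S u" "tame k S (dirderiv v w)" "tame k S (dirderiv v u)" "tame k S w"
      using Suc.prems tame_Suc_imp by (blast, simp, simp, blast)
    show "h (u \<epsilon> x) (dirderiv v w \<epsilon> x) + h (dirderiv v u \<epsilon> x) (w \<epsilon> x) =
        dirderiv v (\<lambda>\<epsilon> x. h (u \<epsilon> x) (w \<epsilon> x)) \<epsilon> x" if "\<epsilon> \<in> {0<..<1}" "x \<in> S" for \<epsilon> x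
      unfolding dirderiv_def using Suc.prems that
      by (subst frechet_derivative_at[OF bounded_bilinear.FDERIV[OF h], symmetric])
        (auto simp: frechet_derivative_works)
  qed
  moreover have "(\<lambda>x. h (u \<epsilon> x) (w \<epsilon> x)) differentiable (at x)" if "\<epsilon> \<in> {0<..<1}" "x \<in> S" for \<epsilon> x
  proof -
    have d: "u \<epsilon> differentiable (at x)" "w \<epsilon> differentiable (at x)" using Suc.prems that by auto
    show ?thesis
      using bounded_bilinear.FDERIV[OF h d[unfolded frechet_derivative_works]] by (rule differentiableI)
  qed
  moreover have "loc_bdd (\<lambda>\<epsilon> x. h (u \<epsilon> x) (w \<epsilon> x)) x" if "x \<in> S" for x
    using Suc.prems that by (auto intro: loc_bdd_bilinear[OF h])
  ultimately show ?case by simp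
qed

lemmas tame_mult = tame_bilinear[OF bounded_bilinear_mult]

lemma tame_prod:
  fixes u :: "'i \<Rightarrow> real \<Rightarrow> 'e::real_normed_vector \<Rightarrow> 'k::real_normed_field"
  assumes "open S" "finite F" "\<And>i. i \<in> F \<Longrightarrow> tame k S (u i)"
  shows "tame k S (\<lambda>\<epsilon> x. \<Prod>i\<in>F. u i \<epsilon> x)"
  using assms(2,3) by (induction F rule: finite_induct) (auto intro: tame_mult assms(1) tame_const)

text \<open>The chain rule differentiates u in a direction that varies with x, whereas
  \<open>tame\<close> speaks of constant directions. Expanding the direction in \<open>onb\<close>
  yields finitely many constant directions with smooth coefficients, to which the induction
  hypothesis applies; this is why the target of f is finite-dimensional.\<close>

lemma tame_compose:
  fixes f :: "'d::real_normed_vector \<Rightarrow> 'e::{real_inner, heine_borel}"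
  assumes S: "open S" and f: "smooth_on S f" "f ` S \<subseteq> T" and "tame k T u"
  shows "tame k S (\<lambda>\<epsilon> x. u \<epsilon> (f x))"
  using assms(4)
proof (induction k arbitrary: u)
  case 0
  have "continuous_on S f" using f(1) by (rule smooth_on_continuous)
  then show ?case using 0 f S
    by (auto intro!: loc_bdd_compose[of u f _ S] intro: continuous_on_compose2)
next
  case (Suc k)
  have "tame k S (dirderiv v (\<lambda>\<epsilon> x. u \<epsilon> (f x)))" for v
  proof (rule tame_cong[OF _ S])
    show "tame k S (\<lambda>\<epsilon> x. \<Sum>b\<in>onb. (frechet_derivative f (at x) v \<bullet> b) *\<^sub>R dirderiv b u \<epsilon> (f x))"
      using Suc.prems
      by (intro tame_sum tame_bilinear[OF bounded_bilinear_scaleR] tame_bilinear[OF bounded_bilinear_inner]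
          S finite_onb tame_const Suc.IH tame_if_smooth_on smooth_on_deriv f) auto
    show "(\<Sum>b\<in>onb. (frechet_derivative f (at x) v \<bullet> b) *\<^sub>R dirderiv b u \<epsilon> (f x)) =
        dirderiv v (\<lambda>\<epsilon> x. u \<epsilon> (f x)) \<epsilon> x" if "\<epsilon> \<in> {0<..<1}" "x \<in> S" for \<epsilon> x
    proof -
      have d: "u \<epsilon> differentiable (at (f x))" "f differentiable (at x)"
        using Suc.prems that f smooth_on_differentiable by auto
      have "frechet_derivative (u \<epsilon> \<circ> f) (at x) v = frechet_derivative (u \<epsilon>) (at (f x)) (frechet_derivative f (at x) v)"
        by (simp only: frechet_derivative_compose[OF d(2,1)] o_apply)
      then show ?thesis
        unfolding dirderiv_def o_def
        by (simp only: frechet_derivative_onb[OF d(1), of "frechet_derivative f (at x) v"])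
    qed
  qed
  moreover have "(\<lambda>x. u \<epsilon> (f x)) differentiable (at x)" if "\<epsilon> \<in> {0<..<1}" "x \<in> S" for \<epsilon> x
  proof (rule differentiable_compose[of "u \<epsilon>" f x])
    show "u \<epsilon> differentiable (at (f x))" using Suc.prems that f(2) by auto
    show "f differentiable (at x)" using smooth_on_differentiable[OF f(1)] that by blast
  qed
  moreover have "loc_bdd (\<lambda>\<epsilon> x. u \<epsilon> (f x)) x" if "x \<in> S" for x
    using Suc.prems that f S smooth_on_continuous[OF f(1)] by (intro loc_bdd_compose[of u f x S]) auto
  ultimately show ?case by simp
qed

section \<open>Closure properties of smooth functions, read off from constant nets\<close>

lemma smooth_on_compose:
  fixes f :: "'d::real_normed_vector \<Rightarrow> 'e::{real_inner, heine_borel}"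
  assumes "open S" "smooth_on S f" "f ` S \<subseteq> T" "open T" "smooth_on T g"
  shows "smooth_on S (\<lambda>x. g (f x))"
  using assms tame_compose[OF assms(1-3), of _ "\<lambda>_. g"] by (simp add: smooth_on_iff_tame)

lemma smooth_on_bilinear:
  "bounded_bilinear h \<Longrightarrow> open S \<Longrightarrow> smooth_on S f \<Longrightarrow> smooth_on S g \<Longrightarrow> smooth_on S (\<lambda>x. h (f x) (g x))"
  using tame_bilinear[of h S _ "\<lambda>_. f" "\<lambda>_. g"] by (simp add: smooth_on_iff_tame)

lemmas smooth_on_mult = smooth_on_bilinear[OF bounded_bilinear_mult]

lemma smooth_on_add:
  "open S \<Longrightarrow> smooth_on S f \<Longrightarrow> smooth_on S g \<Longrightarrow> smooth_on S (\<lambda>x. f x + g x)"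
  using tame_add[of S _ "\<lambda>_. f" "\<lambda>_. g"] by (simp add: smooth_on_iff_tame)

lemma smooth_on_sum:
  "open S \<Longrightarrow> finite F \<Longrightarrow> (\<And>i. i \<in> F \<Longrightarrow> smooth_on S (f i)) \<Longrightarrow> smooth_on S (\<lambda>x. \<Sum>i\<in>F. f i x)"
  using tame_sum[of S F _ "\<lambda>i _. f i"] by (simp add: smooth_on_iff_tame)

lemma smooth_on_cong:
  "smooth_on S f \<Longrightarrow> open S \<Longrightarrow> (\<And>x. x \<in> S \<Longrightarrow> f x = g x) \<Longrightarrow> smooth_on S g"
  using tame_cong[of _ S "\<lambda>_. f" "\<lambda>_. g"] by (simp add: smooth_on_iff_tame)

lemma smooth_on_subset: "open S \<Longrightarrow> open T \<Longrightarrow> smooth_on S f \<Longrightarrow> T \<subseteq> S \<Longrightarrow> smooth_on T f"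
  using tame_subset[of _ S "\<lambda>_. f" T] by (simp add: smooth_on_iff_tame)

lemma smooth_on_local:
  assumes "\<And>x. x \<in> S \<Longrightarrow> \<exists>T. open T \<and> x \<in> T \<and> smooth_on T f" "open S"
  shows "smooth_on S f"
proof -
  have "\<exists>T. open T \<and> x \<in> T \<and> tame k T (\<lambda>_. f)" if "x \<in> S" for x k
    using assms(1)[OF that] tame_if_smooth_on by blast
  then have "tame k S (\<lambda>_. f)" for k by (intro tame_local)
  then show ?thesis by (simp add: smooth_on_iff_tame assms(2))
qed

lemma smooth_on_if_tame: "(\<And>k. tame k S u) \<Longrightarrow> \<epsilon> \<in> {0<..<1} \<Longrightarrow> smooth_on S (u \<epsilon>)"
  by (auto simp: smooth_on_def intro: Ck_on_if_tame)

section \<open>Iterated derivatives\<close>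

lemma iter_deriv_snoc:
  "iter_deriv (vs @ [v]) f = iter_deriv vs (\<lambda>x. frechet_derivative f (at x) v)"
  by (induction vs) auto

lemma iter_deriv_cong:
  assumes "open S" "\<And>x. x \<in> S \<Longrightarrow> f x = g x" "x \<in> S"
  shows "iter_deriv vs f x = iter_deriv vs g x"
  using assms(3)
proof (induction vs arbitrary: x)
  case (Cons v vs)
  then show ?case
    using frechet_derivative_cong_open[of S x "iter_deriv vs f" "iter_deriv vs g"] assms(1) by simp
qed (use assms(2) in simp)

lemma smooth_on_iter_deriv: "smooth_on S f \<Longrightarrow> smooth_on S (iter_deriv vs f)"
  by (induction vs) (auto intro: smooth_on_deriv)

lemma tame_iter_deriv:
  "tame (length vs + k) S u \<Longrightarrow> tame k S (\<lambda>\<epsilon>. iter_deriv vs (u \<epsilon>))"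
proof (induction vs arbitrary: u rule: rev_induct)
  case (snoc v vs)
  then show ?case using snoc.IH[of "dirderiv v u"] by (simp add: iter_deriv_snoc dirderiv_def)
qed simp

text \<open>By linearity of the derivative, directions from \<open>onb\<close> control all others.
  For each order only finitely many words remain, which matters for the cutoffs: their bounds can be
  arranged for finitely many words at a time.\<close>

lemma tame_if_iter_deriv_onb:
  fixes u :: "real \<Rightarrow> 'e::{real_inner, heine_borel} \<Rightarrow> 'b::real_normed_vector"
  assumes S: "open S" and "\<And>\<epsilon>. \<epsilon> \<in> {0<..<1} \<Longrightarrow> smooth_on S (u \<epsilon>)"
    and "\<And>vs x. set vs \<subseteq> onb \<Longrightarrow> x \<in> S \<Longrightarrow> loc_bdd (\<lambda>\<epsilon>. iter_deriv vs (u \<epsilon>)) x"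
  shows "tame k S u"
  using assms(2,3)
proof (induction k arbitrary: u)
  case 0
  then show ?case using 0(2)[of "[]"] by (auto intro: smooth_on_continuous)
next
  case (Suc k)
  have b: "tame k S (dirderiv b u)" if "b \<in> onb" for b
  proof (rule Suc.IH)
    show "smooth_on S (dirderiv b u \<epsilon>)" if "\<epsilon> \<in> {0<..<1}" for \<epsilon>
      unfolding dirderiv_def using Suc.prems(1)[OF that] by (rule smooth_on_deriv)
    show "loc_bdd (\<lambda>\<epsilon>. iter_deriv vs (dirderiv b u \<epsilon>)) x" if "set vs \<subseteq> onb" "x \<in> S" for vs x
      using Suc.prems(2)[of "vs @ [b]" x] that \<open>b \<in> onb\<close> by (simp add: iter_deriv_snoc dirderiv_def)
  qed
  have "tame k S (dirderiv v u)" for v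
  proof (rule tame_cong[OF _ S])
    show "tame k S (\<lambda>\<epsilon> x. \<Sum>b\<in>onb. (v \<bullet> b) *\<^sub>R dirderiv b u \<epsilon> x)"
      by (intro tame_sum tame_bilinear[OF bounded_bilinear_scaleR] S finite_onb tame_const b)
    show "(\<Sum>b\<in>onb. (v \<bullet> b) *\<^sub>R dirderiv b u \<epsilon> x) = dirderiv v u \<epsilon> x" if "\<epsilon> \<in> {0<..<1}" "x \<in> S" for \<epsilon> x
      unfolding dirderiv_def
      by (rule frechet_derivative_onb[symmetric]) (use smooth_on_differentiable Suc.prems(1) that in blast)
  qed
  then show ?case using Suc.prems(2)[of "[]"] smooth_on_differentiable[OF Suc.prems(1)] by auto
qed

section \<open>Smooth cutoff functions\<close>

text \<open>The functions t^(-k) exp(-1/t), extended by 0 to t \<le> 0. The parameter k makes the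
  family closed under differentiation up to linear combinations, so smoothness is an induction on
  the order for all k at once.\<close>

definition flat :: "nat \<Rightarrow> real \<Rightarrow> real" where
  "flat k t = (if 0 < t then inverse t ^ k * exp (- inverse t) else 0)"

lemma flat_tendsto_0: "(flat k \<longlongrightarrow> 0) (at 0)"
proof -
  have "((\<lambda>t. inverse t ^ k / exp (inverse t)) \<longlongrightarrow> (0::real)) (at_right 0)"
    by (rule filterlim_compose[OF tendsto_power_div_exp_0 filterlim_inverse_at_top_right])
  then have "(flat k \<longlongrightarrow> 0) (at_right 0)"
    by (rule filterlim_cong[THEN iffD1, rotated -1, OF _ refl refl])
      (auto simp: eventually_at_filter flat_def exp_minus divide_inverse)
  moreover have "(flat k \<longlongrightarrow> 0) (at_left 0)"
    by (rule tendsto_eventually) (auto simp: eventually_at_filter flat_def)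
  ultimately show ?thesis by (simp add: filterlim_split_at)
qed

lemma flat_deriv: "(flat k has_real_derivative flat (k + 2) t - real k * flat (k + 1) t) (at t)"
proof -
  consider "t < 0" | "t = 0" | "0 < t" by linarith
  then show ?thesis
  proof cases
    case 1
    have "((\<lambda>_. 0) has_real_derivative 0) (at t)" by (rule DERIV_const)
    then have "(flat k has_real_derivative 0) (at t)"
      by (rule has_field_derivative_transform_within_open[of _ _ _ "{..<0}"])
        (use 1 in \<open>auto simp: flat_def\<close>)
    then show ?thesis using 1 by (simp add: flat_def)
  next
    case 2
    \<comment> \<open>At the origin the difference quotient of \<open>flat k\<close> is
      \<open>flat (Suc k)\<close>, which tends to 0.\<close>
    have "((\<lambda>h. (flat k (0 + h) - flat k 0) / h) \<longlongrightarrow> 0) (at 0)"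
    proof (rule Lim_transform_eventually[OF flat_tendsto_0[of "Suc k"]])
      show "\<forall>\<^sub>F h in at 0. flat (Suc k) h = (flat k (0 + h) - flat k 0) / h"
        by (auto simp: eventually_at_filter flat_def field_simps)
    qed
    then show ?thesis using 2 by (simp add: DERIV_def flat_def)
  next
    case 3
    \<comment> \<open>For k = 0 the exponent k - 1 is truncated to 0; the factor
      \<open>real k\<close> makes this harmless.\<close>
    have 1: "((\<lambda>t. inverse t ^ k) has_real_derivative real k * (- (inverse t)\<^sup>2 * inverse t ^ (k - 1))) (at t)"
      using DERIV_power[OF DERIV_inverse[of t UNIV], of k] 3 by (simp add: power2_eq_square)
    have 2: "((\<lambda>t. exp (- inverse t)) has_real_derivative exp (- inverse t) * (inverse t)\<^sup>2) (at t)"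
      using 3 by (auto intro!: derivative_eq_intros simp: power2_eq_square)
    have "((\<lambda>t. inverse t ^ k * exp (- inverse t)) has_real_derivative
        flat (k + 2) t - real k * flat (k + 1) t) (at t)"
      by (rule DERIV_cong[OF DERIV_mult[OF 1 2]])
        (use 3 in \<open>cases k; simp add: flat_def power2_eq_square algebra_simps\<close>)
    then show ?thesis
      by (rule has_field_derivative_transform_within_open[of _ _ _ "{0<..}"])
        (use 3 in \<open>auto simp: flat_def\<close>)
  qed
qed

lemma smooth_on_flat: "smooth_on UNIV (flat k)"
proof -
  have "tame m UNIV (\<lambda>_. flat k)" for m
  proof (induction m arbitrary: k)
    case 0
    have "isCont (flat k) t" for t using flat_deriv by (rule DERIV_isCont)
    then show ?case by (simp add: loc_bdd_const continuous_at_imp_continuous_on)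
  next
    case (Suc m)
    have D: "(flat k has_derivative (*) (flat (k + 2) t - real k * flat (k + 1) t)) (at t)" for t
      using flat_deriv by (simp add: has_field_derivative_def)
    have "tame m UNIV (dirderiv v (\<lambda>_. flat k))" for v
    proof (rule tame_cong)
      show "tame m UNIV (\<lambda>_::real. \<lambda>t. v * flat (k + 2) t + (- v * real k) * flat (k + 1) t)"
        by (intro tame_add tame_mult tame_const Suc open_UNIV)
      show "v * flat (k + 2) t + - v * real k * flat (k + 1) t = dirderiv v (\<lambda>_. flat k) \<epsilon> t" for \<epsilon> t
        unfolding dirderiv_def frechet_derivative_at[OF D, symmetric] by (simp add: algebra_simps)
    qed auto
    moreover have "flat k differentiable (at t)" for t using D by (auto simp: differentiable_def)
    moreover have "isCont (flat k) t" for t using flat_deriv by (rule DERIV_isCont)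
    ultimately show ?case by (simp add: loc_bdd_const)
  qed
  then show ?thesis by (simp add: smooth_on_iff_tame)
qed

lemma flat_0_nonneg: "0 \<le> flat 0 t" and flat_0_pos: "0 < t \<Longrightarrow> 0 < flat 0 t"
  and flat_0_nonpos: "t \<le> 0 \<Longrightarrow> flat 0 t = 0"
  by (simp_all add: flat_def)

lemma flat_0_mono: "s \<le> t \<Longrightarrow> flat 0 s \<le> flat 0 t"
  by (auto simp: flat_def)

lemma smooth_on_ident: "smooth_on S (\<lambda>x. x)"
proof -
  have "Ck_on k S (\<lambda>x. x)" for k
    by (cases k) (auto simp: frechet_derivative_ident intro: smooth_on_const[unfolded smooth_on_def, rule_format])
  then show ?thesis by (simp add: smooth_on_def)
qed

text \<open>Nesting replaces the usual quotient or integral. At distance below r the inner value is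
  at least \<open>\<delta>\<close>, since 4r^2 - r^2 = 3r^2, and the outer argument is nonpositive;
  from distance 2r on the inner value is 0 and the outer argument is \<open>\<delta>\<close>.
  Division by \<open>flat 0 \<delta>\<close> normalises the latter value to 1.\<close>

lemma smooth_bump:
  fixes a :: "'e::{real_inner, heine_borel}"
  assumes r: "0 < r"
  obtains B :: "'e \<Rightarrow> real" where "smooth_on UNIV B" "\<And>x. 0 \<le> B x" "\<And>x. B x \<le> 1"
    "\<And>x. dist a x < r \<Longrightarrow> B x = 0" "\<And>x. 2 * r \<le> dist a x \<Longrightarrow> B x = 1"
proof
  define \<delta> where "\<delta> = flat 0 (3 * r\<^sup>2)"
  define q where "q x = (x + - a) \<bullet> (x + - a)" for x
  have q: "q x = (dist a x)\<^sup>2" for x by (simp add: q_def dist_norm power2_norm_eq_inner norm_minus_commute[of a])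
  \<comment> \<open>Differences are written as sums with a factor -1, to fit the introduction rules
    for sums and products.\<close>
  let ?B = "\<lambda>x. inverse (flat 0 \<delta>) * flat 0 (\<delta> + (- 1) * flat 0 (4 * r\<^sup>2 + (- 1) * q x))"
  have \<delta>: "0 < \<delta>" using r by (simp add: \<delta>_def flat_0_pos)
  have pos: "0 < flat 0 \<delta>" using \<delta> by (rule flat_0_pos)
  have 1: "smooth_on UNIV q" unfolding q_def
    by (intro smooth_on_bilinear[OF bounded_bilinear_inner] smooth_on_add smooth_on_ident smooth_on_const open_UNIV)
  have 2: "smooth_on UNIV (\<lambda>x. flat 0 (4 * r\<^sup>2 + (- 1) * q x))"
    by (rule smooth_on_compose[OF open_UNIV _ subset_UNIV open_UNIV smooth_on_flat])
      (intro smooth_on_add smooth_on_mult smooth_on_const open_UNIV 1)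
  have 3: "smooth_on UNIV (\<lambda>x. flat 0 (\<delta> + (- 1) * flat 0 (4 * r\<^sup>2 + (- 1) * q x)))"
    by (rule smooth_on_compose[OF open_UNIV _ subset_UNIV open_UNIV smooth_on_flat])
      (intro smooth_on_add smooth_on_mult smooth_on_const open_UNIV 2)
  show "smooth_on UNIV ?B"
    by (intro smooth_on_mult smooth_on_const open_UNIV 3)
  show "0 \<le> ?B x" for x using pos flat_0_nonneg by simp
  have "flat 0 (\<delta> + (- 1) * flat 0 (4 * r\<^sup>2 + (- 1) * q x)) \<le> flat 0 \<delta>" for x
    by (rule flat_0_mono) (simp add: flat_0_nonneg)
  then show "?B x \<le> 1" for x using pos by (simp add: field_simps)
  show "?B x = 0" if "dist a x < r" for x
  proof -
    have "q x \<le> r\<^sup>2" unfolding q using that by (intro power_mono) auto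
    then have "\<delta> \<le> flat 0 (4 * r\<^sup>2 + (- 1) * q x)" unfolding \<delta>_def by (intro flat_0_mono) simp
    then show ?thesis by (simp add: flat_0_nonpos)
  qed
  show "?B x = 1" if "2 * r \<le> dist a x" for x
  proof -
    have "(2 * r)\<^sup>2 \<le> q x" unfolding q using that r by (intro power_mono) auto
    then have "flat 0 (4 * r\<^sup>2 + (- 1) * q x) = 0" by (intro flat_0_nonpos) (simp add: power2_eq_square)
    then show ?thesis using pos by simp
  qed
qed

lemma smooth_on_of_real:
  assumes "open S" "smooth_on S f"
  shows "smooth_on S (\<lambda>x. of_real (f x) :: 'k::real_normed_field)"
  unfolding of_real_def using assms
  by (intro smooth_on_bilinear[OF bounded_bilinear_scaleR] smooth_on_const)

lemma smooth_on_prod: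
  fixes f :: "'i \<Rightarrow> 'e::real_normed_vector \<Rightarrow> 'k::real_normed_field"
  assumes "open S" "finite F" "\<And>i. i \<in> F \<Longrightarrow> smooth_on S (f i)"
  shows "smooth_on S (\<lambda>x. \<Prod>i\<in>F. f i x)"
  using assms tame_prod[of S F _ "\<lambda>i _. f i"] by (simp add: smooth_on_iff_tame)

text \<open>Finitely many balls of radius r/2 with centres in C cover C. The product of the
  corresponding bumps vanishes where one of them does and is 1 where all of them are; as the centres
  belong to C, distance r from C suffices for the latter.\<close>

lemma smooth_cutoff:
  fixes C :: "'e::{real_inner, heine_borel} set"
  assumes C: "compact C" and r: "0 < r"
  obtains b :: "'e \<Rightarrow> 'k::real_normed_field" and N
  where "smooth_on UNIV b" "\<And>x. norm (b x) \<le> 1" "open N" "C \<subseteq> N" "\<And>x. x \<in> N \<Longrightarrow> b x = 0"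
    "\<And>x. \<forall>c\<in>C. r \<le> dist c x \<Longrightarrow> b x = 1"
proof -
  have "\<exists>B :: 'e \<Rightarrow> real. smooth_on UNIV B \<and> (\<forall>x. 0 \<le> B x \<and> B x \<le> 1) \<and>
      (\<forall>x. dist a x < r / 2 \<longrightarrow> B x = 0) \<and> (\<forall>x. r \<le> dist a x \<longrightarrow> B x = 1)" for a
  proof -
    obtain B :: "'e \<Rightarrow> real" where "smooth_on UNIV B" "\<And>x. 0 \<le> B x" "\<And>x. B x \<le> 1"
      "\<And>x. dist a x < r / 2 \<Longrightarrow> B x = 0" "\<And>x. 2 * (r / 2) \<le> dist a x \<Longrightarrow> B x = 1"
      using smooth_bump[of "r / 2" a] r by (metis half_gt_zero)
    then show ?thesis by (intro exI[of _ B]) simp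
  qed
  then obtain B :: "'e \<Rightarrow> 'e \<Rightarrow> real" where B: "\<And>a. smooth_on UNIV (B a)"
    "\<And>a x. 0 \<le> B a x" "\<And>a x. B a x \<le> 1"
    "\<And>a x. dist a x < r / 2 \<Longrightarrow> B a x = 0" "\<And>a x. r \<le> dist a x \<Longrightarrow> B a x = 1"
    by metis
  obtain F where F: "F \<subseteq> C" "finite F" "C \<subseteq> (\<Union>a\<in>F. ball a (r / 2))"
  proof (rule compactE_image[OF C])
    show "C \<subseteq> (\<Union>a\<in>C. ball a (r / 2))" using r by force
  qed auto
  show thesis
  proof
    show "smooth_on UNIV (\<lambda>x. \<Prod>a\<in>F. of_real (B a x) :: 'k)"
      by (intro smooth_on_prod smooth_on_of_real open_UNIV F B)
    show "norm (\<Prod>a\<in>F. of_real (B a x) :: 'k) \<le> 1" for x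
      unfolding prod_norm[symmetric] by (rule prod_le_1) (use B(2,3) in \<open>simp add: abs_le_iff\<close>)
    show "open (\<Union>a\<in>F. ball a (r / 2))" by blast
    show "(\<Prod>a\<in>F. of_real (B a x) :: 'k) = 0" if "x \<in> (\<Union>a\<in>F. ball a (r / 2))" for x
      using that F(2) B(4) by auto
    show "(\<Prod>a\<in>F. of_real (B a x) :: 'k) = 1" if "\<forall>c\<in>C. r \<le> dist c x" for x
      using that F(1) by (intro prod.neutral) (auto simp: B(5))
  qed (use F in auto)
qed

section \<open>Differential operators under coordinate changes\<close>

text \<open>The chartwise condition of \<open>diff_operators\<close>, isolated on one open set of
  the model space, so that it can be shown stable under differentiation and coordinate changes. Only
  smooth arguments and points of S are constrained.\<close>

definition diff_expr ::
  "'e::real_normed_vector set \<Rightarrow> nat \<Rightarrow> (('e \<Rightarrow> 'k::real_normed_field) \<Rightarrow> 'e \<Rightarrow> 'k) \<Rightarrow> bool" where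
  "diff_expr S m T \<longleftrightarrow> (\<exists>L a. finite L \<and> (\<forall>vs\<in>L. length vs \<le> m \<and> smooth_on S (a vs)) \<and>
     (\<forall>w. smooth_on S w \<longrightarrow> (\<forall>z\<in>S. T w z = (\<Sum>vs\<in>L. a vs z * iter_deriv vs w z))))"

lemma diff_exprI:
  assumes "finite L" "\<And>vs. vs \<in> L \<Longrightarrow> length vs \<le> m" "\<And>vs. vs \<in> L \<Longrightarrow> smooth_on S (a vs)"
    "\<And>w z. smooth_on S w \<Longrightarrow> z \<in> S \<Longrightarrow> T w z = (\<Sum>vs\<in>L. a vs z * iter_deriv vs w z)"
  shows "diff_expr S m T"
  unfolding diff_expr_def by (intro exI[of _ L] exI[of _ a] conjI ballI allI impI assms)

lemma diff_expr_cong: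
  assumes "diff_expr S m T" "\<And>w z. smooth_on S w \<Longrightarrow> z \<in> S \<Longrightarrow> T w z = T' w z"
  shows "diff_expr S m T'"
proof -
  obtain L a where "finite L" "\<forall>vs\<in>L. length vs \<le> m \<and> smooth_on S (a vs)"
    "\<forall>w. smooth_on S w \<longrightarrow> (\<forall>z\<in>S. T w z = (\<Sum>vs\<in>L. a vs z * iter_deriv vs w z))"
    using assms(1) unfolding diff_expr_def by blast
  then show ?thesis using assms(2) by (intro diff_exprI[of L _ _ a]) auto
qed

lemma diff_expr_ident: "diff_expr S m (\<lambda>w. w)"
  by (rule diff_exprI[of "{[]}" _ _ "\<lambda>_ _. 1"]) (auto intro: smooth_on_const)

lemma diff_expr_zero: "diff_expr S m (\<lambda>w z. 0)"
  by (rule diff_exprI[of "{}"]) auto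

lemma diff_expr_mult:
  assumes "diff_expr S m T" "open S" "smooth_on S c"
  shows "diff_expr S m (\<lambda>w z. c z * T w z)"
proof -
  obtain L a where L: "finite L" "\<And>vs. vs \<in> L \<Longrightarrow> length vs \<le> m" "\<And>vs. vs \<in> L \<Longrightarrow> smooth_on S (a vs)"
    "\<And>w z. smooth_on S w \<Longrightarrow> z \<in> S \<Longrightarrow> T w z = (\<Sum>vs\<in>L. a vs z * iter_deriv vs w z)"
    using assms(1) unfolding diff_expr_def by blast
  show ?thesis
    by (rule diff_exprI[of L _ _ "\<lambda>vs z. c z * a vs z"])
      (use L assms(2,3) in \<open>simp_all add: smooth_on_mult sum_distrib_left mult.assoc\<close>)
qed

lemma diff_expr_add:
  assumes "diff_expr S m T" "diff_expr S m T'" "open S"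
  shows "diff_expr S m (\<lambda>w z. T w z + T' w z)"
proof -
  obtain L a where L: "finite L" "\<And>vs. vs \<in> L \<Longrightarrow> length vs \<le> m" "\<And>vs. vs \<in> L \<Longrightarrow> smooth_on S (a vs)"
    "\<And>w z. smooth_on S w \<Longrightarrow> z \<in> S \<Longrightarrow> T w z = (\<Sum>vs\<in>L. a vs z * iter_deriv vs w z)"
    using assms(1) unfolding diff_expr_def by blast
  obtain L' a' where L': "finite L'" "\<And>vs. vs \<in> L' \<Longrightarrow> length vs \<le> m" "\<And>vs. vs \<in> L' \<Longrightarrow> smooth_on S (a' vs)"
    "\<And>w z. smooth_on S w \<Longrightarrow> z \<in> S \<Longrightarrow> T' w z = (\<Sum>vs\<in>L'. a' vs z * iter_deriv vs w z)"
    using assms(2) unfolding diff_expr_def by blast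
  \<comment> \<open>The two operators may share words, so their coefficients are merged. The default
    0 is needed because smoothness of a coefficient is known only for words of its own
    operator.\<close>
  define c where "c vs z = (if vs \<in> L then a vs z else 0) + (if vs \<in> L' then a' vs z else 0)" for vs z
  have sm: "smooth_on S (c vs)" if "vs \<in> L \<union> L'" for vs
    unfolding c_def
    using L(3)[of vs] L'(3)[of vs] by (cases "vs \<in> L"; cases "vs \<in> L'") (simp_all add: smooth_on_add smooth_on_const assms(3))
  have eq: "T w z + T' w z = (\<Sum>vs\<in>L \<union> L'. c vs z * iter_deriv vs w z)" if "smooth_on S w" "z \<in> S" for w z
  proof -
    have "(\<Sum>vs\<in>L \<union> L'. c vs z * iter_deriv vs w z) =
        (\<Sum>vs\<in>L \<union> L'. (if vs \<in> L then a vs z * iter_deriv vs w z else 0)) +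
        (\<Sum>vs\<in>L \<union> L'. (if vs \<in> L' then a' vs z * iter_deriv vs w z else 0))"
      unfolding c_def sum.distrib[symmetric] by (intro sum.cong) (simp_all add: distrib_right)
    also have "\<dots> = (\<Sum>vs\<in>L. a vs z * iter_deriv vs w z) + (\<Sum>vs\<in>L'. a' vs z * iter_deriv vs w z)"
      by (intro arg_cong2[of _ _ _ _ "(+)"] sum.mono_neutral_cong_right) (use L(1) L'(1) in auto)
    finally show ?thesis using L(4) L'(4) that by simp
  qed
  show ?thesis
    by (rule diff_exprI[of "L \<union> L'" _ _ c]) (use L(1,2) L'(1,2) sm eq in auto)
qed

lemma diff_expr_sum:
  assumes "finite F" "\<And>i. i \<in> F \<Longrightarrow> diff_expr S m (T i)" "open S"
  shows "diff_expr S m (\<lambda>w z. \<Sum>i\<in>F. T i w z)"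
  using assms(1,2)
  by (induction F rule: finite_induct) (simp_all add: diff_expr_zero diff_expr_add assms(3))

lemma smooth_on_diff_expr:
  assumes "diff_expr S m T" "open S" "smooth_on S w"
  shows "smooth_on S (T w)"
proof -
  obtain L a where L: "finite L" "\<And>vs. vs \<in> L \<Longrightarrow> length vs \<le> m" "\<And>vs. vs \<in> L \<Longrightarrow> smooth_on S (a vs)"
    "\<And>w z. smooth_on S w \<Longrightarrow> z \<in> S \<Longrightarrow> T w z = (\<Sum>vs\<in>L. a vs z * iter_deriv vs w z)"
    using assms(1) unfolding diff_expr_def by blast
  have "smooth_on S (\<lambda>z. \<Sum>vs\<in>L. a vs z * iter_deriv vs w z)"
    by (intro smooth_on_sum smooth_on_mult smooth_on_iter_deriv assms L)
  then show ?thesis by (rule smooth_on_cong) (use L(4) assms in auto)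
qed

text \<open>By the Leibniz rule a word vs contributes itself, with a differentiated coefficient, and
  the longer word v # vs.\<close>

lemma diff_expr_deriv:
  assumes "diff_expr S m T" and S: "open S"
  shows "diff_expr S (Suc m) (\<lambda>w z. frechet_derivative (T w) (at z) v)"
proof -
  obtain L a where L: "finite L" "\<And>vs. vs \<in> L \<Longrightarrow> length vs \<le> m" "\<And>vs. vs \<in> L \<Longrightarrow> smooth_on S (a vs)"
    "\<And>w z. smooth_on S w \<Longrightarrow> z \<in> S \<Longrightarrow> T w z = (\<Sum>vs\<in>L. a vs z * iter_deriv vs w z)"
    using assms(1) unfolding diff_expr_def by blast
  have D1: "diff_expr S (Suc m) (\<lambda>w z. frechet_derivative (a vs) (at z) v * iter_deriv vs w z +
      a vs z * iter_deriv (v # vs) w z)" if "vs \<in> L" for vs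
  proof -
    have 1: "diff_expr S (Suc m) (\<lambda>w z. iter_deriv vs w z)"
      by (rule diff_exprI[of "{vs}" _ _ "\<lambda>_ _. 1"]) (use L(2)[OF that] in \<open>simp_all add: smooth_on_const\<close>)
    have 2: "diff_expr S (Suc m) (\<lambda>w z. iter_deriv (v # vs) w z)"
      by (rule diff_exprI[of "{v # vs}" _ _ "\<lambda>_ _. 1"]) (use L(2)[OF that] in \<open>simp_all add: smooth_on_const\<close>)
    show ?thesis
      by (intro diff_expr_add diff_expr_mult 1 2 S smooth_on_deriv L(3)[OF that])
  qed
  have "diff_expr S (Suc m) (\<lambda>w z. \<Sum>vs\<in>L. frechet_derivative (a vs) (at z) v * iter_deriv vs w z +
      a vs z * iter_deriv (v # vs) w z)"
    by (rule diff_expr_sum[OF L(1) D1 S])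
  then show ?thesis
  proof (rule diff_expr_cong)
    fix w :: "'a \<Rightarrow> 'b" and z assume w: "smooth_on S w" and z: "z \<in> S"
    have D: "((\<lambda>z. \<Sum>vs\<in>L. a vs z * iter_deriv vs w z) has_derivative
        (\<lambda>v. \<Sum>vs\<in>L. a vs z * frechet_derivative (iter_deriv vs w) (at z) v + frechet_derivative (a vs) (at z) v * iter_deriv vs w z)) (at z)"
    proof (rule has_derivative_sum, rule has_derivative_mult)
      fix vs assume vs: "vs \<in> L"
      show "(a vs has_derivative frechet_derivative (a vs) (at z)) (at z)"
        unfolding frechet_derivative_works[symmetric] by (rule smooth_on_differentiable[OF L(3)[OF vs] z])
      show "(iter_deriv vs w has_derivative frechet_derivative (iter_deriv vs w) (at z)) (at z)"
        unfolding frechet_derivative_works[symmetric]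
        by (rule smooth_on_differentiable[OF smooth_on_iter_deriv[OF w] z])
    qed
    have "frechet_derivative (T w) (at z) = frechet_derivative (\<lambda>z. \<Sum>vs\<in>L. a vs z * iter_deriv vs w z) (at z)"
      by (rule frechet_derivative_cong_open[OF S z]) (rule L(4)[OF w])
    also have "\<dots> = (\<lambda>v. \<Sum>vs\<in>L. a vs z * frechet_derivative (iter_deriv vs w) (at z) v + frechet_derivative (a vs) (at z) v * iter_deriv vs w z)"
      using frechet_derivative_at[OF D] by simp
    finally show "(\<Sum>vs\<in>L. frechet_derivative (a vs) (at z) v * iter_deriv vs w z +
      a vs z * iter_deriv (v # vs) w z) = frechet_derivative (T w) (at z) v"
      by (simp add: add.commute)
  qed
qed

text \<open>Write T w for the operator of the word vs, as a function on S. On R the iterated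
  derivative of \<open>w \<circ> \<tau>\<close> is T w composed with \<tau>. One more derivative is,
  by the chain rule, a derivative of T w in a direction depending smoothly on z; its expansion in
  \<open>onb\<close> leaves constant directions.\<close>

lemma diff_expr_iter_deriv_change:
  fixes \<tau> :: "'d::{real_inner, heine_borel} \<Rightarrow> 'e::{real_inner, heine_borel}"
  assumes R: "open R" and S: "open S"
    and \<tau>: "smooth_on R \<tau>" "\<tau> ` R \<subseteq> S" and \<sigma>: "smooth_on S \<sigma>" "\<sigma> ` S \<subseteq> R"
    and inv: "\<And>y. y \<in> R \<Longrightarrow> \<sigma> (\<tau> y) = y" "\<And>z. z \<in> S \<Longrightarrow> \<tau> (\<sigma> z) = z"
  shows "diff_expr S (length vs) (\<lambda>(w :: 'e \<Rightarrow> 'k::real_normed_field) z. iter_deriv vs (\<lambda>y. w (\<tau> y)) (\<sigma> z))"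
proof (induction vs)
  case Nil
  show ?case by (rule diff_expr_cong[OF diff_expr_ident]) (simp add: inv)
next
  case (Cons v vs)
  let ?T = "\<lambda>(w :: 'e \<Rightarrow> 'k) z. iter_deriv vs (\<lambda>y. w (\<tau> y)) (\<sigma> z)"
  have sm: "smooth_on S (\<lambda>z. of_real (frechet_derivative \<tau> (at (\<sigma> z)) v \<bullet> b) :: 'k)" for b
    by (rule smooth_on_of_real[OF S], rule smooth_on_compose[OF S \<sigma> R],
        intro smooth_on_bilinear[OF bounded_bilinear_inner] R smooth_on_deriv \<tau> smooth_on_const)
  have "diff_expr S (Suc (length vs)) (\<lambda>w z. \<Sum>b\<in>onb. of_real (frechet_derivative \<tau> (at (\<sigma> z)) v \<bullet> b) *
      frechet_derivative (?T w) (at z) b)"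
    by (intro diff_expr_sum finite_onb S diff_expr_mult diff_expr_deriv Cons sm)
  then show ?case unfolding list.size add_Suc_right add_0_right
  proof (rule diff_expr_cong)
    fix w :: "'e \<Rightarrow> 'k" and z assume w: "smooth_on S w" and z: "z \<in> S"
    have \<sigma>z: "\<sigma> z \<in> R" using \<sigma> z by blast
    have "smooth_on S (?T w)" by (rule smooth_on_diff_expr[OF Cons S w])
    then have d: "?T w differentiable (at (\<tau> (\<sigma> z)))"
      using z by (simp add: inv smooth_on_differentiable)
    have d': "\<tau> differentiable (at (\<sigma> z))" by (rule smooth_on_differentiable[OF \<tau>(1) \<sigma>z])
    have "frechet_derivative (iter_deriv vs (\<lambda>y. w (\<tau> y))) (at (\<sigma> z)) = frechet_derivative (?T w \<circ> \<tau>) (at (\<sigma> z))"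
      by (rule frechet_derivative_cong_open[OF R \<sigma>z]) (simp add: inv)
    also have "\<dots> = frechet_derivative (?T w) (at (\<tau> (\<sigma> z))) \<circ> frechet_derivative \<tau> (at (\<sigma> z))"
      by (rule frechet_derivative_compose[OF d' d])
    finally have "iter_deriv (v # vs) (\<lambda>y. w (\<tau> y)) (\<sigma> z) =
        frechet_derivative (?T w) (at (\<tau> (\<sigma> z))) (frechet_derivative \<tau> (at (\<sigma> z)) v)" by simp
    also have "\<dots> = (\<Sum>b\<in>onb. (frechet_derivative \<tau> (at (\<sigma> z)) v \<bullet> b) *\<^sub>R frechet_derivative (?T w) (at (\<tau> (\<sigma> z))) b)"
      by (rule frechet_derivative_onb[OF d])
    finally show "(\<Sum>b\<in>onb. of_real (frechet_derivative \<tau> (at (\<sigma> z)) v \<bullet> b) *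
        frechet_derivative (?T w) (at z) b) = iter_deriv (v # vs) (\<lambda>y. w (\<tau> y)) (\<sigma> z)"
      by (simp add: inv z scaleR_conv_of_real)
  qed
qed

section \<open>Moderate and negligible nets on a manifold\<close>

text \<open>The common form of all passages from points to compact sets below: moderate bounds,
  negligible bounds, and finiteness of the number of members of a family that meet a set.\<close>

lemma compactin_finite_cover_induct:
  assumes "compactin X K" "\<And>p. p \<in> K \<Longrightarrow> \<exists>G. openin X G \<and> p \<in> G \<and> Q G"
    and "Q {}" "\<And>G H. Q G \<Longrightarrow> Q H \<Longrightarrow> Q (G \<union> H)" "\<And>G H. Q G \<Longrightarrow> H \<subseteq> G \<Longrightarrow> Q H"
  shows "Q K"
proof -
  define \<G> where "\<G> = {G. openin X G \<and> Q G}"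
  have "K \<subseteq> \<Union>\<G>" using assms(2) by (fastforce simp: \<G>_def)
  moreover have "\<And>G. G \<in> \<G> \<Longrightarrow> openin X G" by (simp add: \<G>_def)
  ultimately obtain \<F> where \<F>: "finite \<F>" "\<F> \<subseteq> \<G>" "K \<subseteq> \<Union>\<F>"
    using compactinD[OF assms(1), of \<G>] by blast
  have "Q (\<Union>\<F>)" using \<F>(1,2)
  proof (induction \<F> rule: finite_induct)
    case (insert G \<F>)
    then have "Q G" "Q (\<Union>\<F>)" by (simp_all add: \<G>_def)
    then show ?case by (simp add: assms(4))
  qed (simp add: assms(3))
  then show ?thesis using \<F>(3) by (rule assms(5))
qed

section \<open>Charts of a Hausdorff manifold\<close>

locale hausdorff_manifold =
  fixes X :: "'a topology" and A :: "('a, 'e::{real_inner, heine_borel}) chart set"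
  assumes manifold: "smooth_manifold X A" and hausdorff: "Hausdorff_space X"
begin

lemma chart_at:
  assumes "p \<in> topspace X"
  obtains V \<phi> where "(V, \<phi>) \<in> A" "p \<in> V"
proof -
  have "p \<in> (\<Union>(V, \<phi>)\<in>A. V)" using assms manifold by (simp add: smooth_manifold_def)
  then show ?thesis using that by fast
qed

lemma transition_smooth:
  assumes "(V, \<phi>) \<in> A" "(W, \<psi>) \<in> A"
  shows "smooth_on (\<phi> ` (V \<inter> W)) (\<lambda>x. \<psi> (inv_into V \<phi> x))"
proof -
  have "\<forall>(V, \<phi>)\<in>A. \<forall>(W, \<psi>)\<in>A. smooth_on (\<phi> ` (V \<inter> W)) (\<psi> \<circ> inv_into V \<phi>)"
    using manifold by (simp add: smooth_manifold_def)
  then show ?thesis using assms unfolding comp_def by fast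
qed

lemma openin_chart: "(V, \<phi>) \<in> A \<Longrightarrow> openin X V"
  and open_chart_image: "(V, \<phi>) \<in> A \<Longrightarrow> open (\<phi> ` V)"
  and homeomorphic_chart: "(V, \<phi>) \<in> A \<Longrightarrow> homeomorphic_map (subtopology X V) (top_of_set (\<phi> ` V)) \<phi>"
  using manifold unfolding smooth_manifold_def by fast+

context
  fixes V \<phi>
  assumes chart: "(V, \<phi>) \<in> A"
begin

lemma chart_subset: "V \<subseteq> topspace X"
  using openin_chart[OF chart] by (rule openin_subset)

lemma inj_on_chart: "inj_on \<phi> V"
  using homeomorphic_imp_injective_map[OF homeomorphic_chart[OF chart]] chart_subset
  by (simp add: Int_absorb1)

lemma chart_inv [simp]: "p \<in> V \<Longrightarrow> inv_into V \<phi> (\<phi> p) = p"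
  by (rule inv_into_f_f[OF inj_on_chart])

lemma open_chart_image_Int:
  assumes "openin X W"
  shows "open (\<phi> ` (V \<inter> W))"
proof -
  have "openin (subtopology X V) (V \<inter> W)" using assms by (rule openin_subtopology_Int2)
  then have "openin (top_of_set (\<phi> ` V)) (\<phi> ` (V \<inter> W))"
    using homeomorphic_imp_open_map[OF homeomorphic_chart[OF chart]] by (simp add: open_map_def)
  then show ?thesis using open_chart_image[OF chart] by (simp add: openin_open_eq)
qed

lemma openin_chart_vimage:
  assumes "open T"
  shows "openin X {p \<in> V. \<phi> p \<in> T}"
proof -
  have "openin (top_of_set (\<phi> ` V)) (\<phi> ` V \<inter> T)" using assms by (rule openin_open_Int)
  then have "openin (subtopology X V) {p \<in> topspace (subtopology X V). \<phi> p \<in> \<phi> ` V \<inter> T}"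
    by (rule openin_continuous_map_preimage[OF homeomorphic_imp_continuous_map[OF homeomorphic_chart[OF chart]]])
  then have "openin X {p \<in> topspace (subtopology X V). \<phi> p \<in> \<phi> ` V \<inter> T}"
    by (rule openin_trans_full) (rule openin_chart[OF chart])
  moreover have "{p \<in> topspace (subtopology X V). \<phi> p \<in> \<phi> ` V \<inter> T} = {p \<in> V. \<phi> p \<in> T}"
    using chart_subset by auto
  ultimately show ?thesis by simp
qed

lemma compact_chart_image:
  assumes "compactin X K" "K \<subseteq> V"
  shows "compact (\<phi> ` K)"
proof -
  have "compactin (subtopology X V) K" using assms by (simp add: compactin_subtopology)
  then have "compactin (top_of_set (\<phi> ` V)) (\<phi> ` K)"
    by (rule image_compactin[OF _ homeomorphic_imp_continuous_map[OF homeomorphic_chart[OF chart]]])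
  then show ?thesis by (simp add: compactin_subtopology)
qed

lemma compactin_chart_vimage:
  assumes "compact K" "K \<subseteq> \<phi> ` V"
  shows "compactin X {p \<in> V. \<phi> p \<in> K}"
proof -
  obtain g where g: "homeomorphic_maps (subtopology X V) (top_of_set (\<phi> ` V)) \<phi> g"
    using homeomorphic_chart[OF chart] unfolding homeomorphic_map_maps by blast
  have "compactin (top_of_set (\<phi> ` V)) K" using assms by (simp add: compactin_subtopology)
  then have "compactin (subtopology X V) (g ` K)"
    by (rule image_compactin) (use g in \<open>simp add: homeomorphic_maps_def\<close>)
  moreover have gV: "g (\<phi> p) = p" if "p \<in> V" for p
    using g that chart_subset by (auto simp: homeomorphic_maps_def)
  have "g ` K = {p \<in> V. \<phi> p \<in> K}"
  proof
    show "g ` K \<subseteq> {p \<in> V. \<phi> p \<in> K}" using assms(2) gV by force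
    show "{p \<in> V. \<phi> p \<in> K} \<subseteq> g ` K" using gV by force
  qed
  ultimately show ?thesis by (simp add: compactin_subtopology)
qed

text \<open>Closedness holds in X and not only in V; this is the use of the Hausdorff property. A
  function on the chart that is constant off such a set can thus be continued beyond the boundary of
  the chart domain.\<close>

lemma closedin_chart_vimage:
  assumes "compact K" "K \<subseteq> \<phi> ` V"
  shows "closedin X {p \<in> V. \<phi> p \<in> K}"
  by (rule compactin_imp_closedin[OF hausdorff compactin_chart_vimage[OF assms]])

end

text \<open>The neighbourhood may shrink with the order k. It can always be intersected with the
  chart image, so unspecified values of \<open>inv_into\<close> outside that image do no
  harm.\<close>

definition tame_at :: "'a \<Rightarrow> ('a, 'k::real_normed_field) net \<Rightarrow> bool" where
  "tame_at p u \<longleftrightarrow> (\<exists>V \<phi>. (V, \<phi>) \<in> A \<and> p \<in> V \<and>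
     (\<forall>k. \<exists>T. open T \<and> \<phi> p \<in> T \<and> tame k T (\<lambda>\<epsilon> x. u \<epsilon> (inv_into V \<phi> x))))"

text \<open>Changing the chart means composing with a smooth transition map, so one chart may be
  traded for any other; H lies in both chart domains.\<close>

lemma tame_at_chart:
  assumes "tame_at p u" and W: "(W, \<psi>) \<in> A" "p \<in> W" and G: "openin X G" "p \<in> G"
  shows "\<exists>H. openin X H \<and> p \<in> H \<and> H \<subseteq> W \<inter> G \<and> tame k (\<psi> ` H) (\<lambda>\<epsilon> x. u \<epsilon> (inv_into W \<psi> x))"
proof -
  obtain V \<phi> where V: "(V, \<phi>) \<in> A" "p \<in> V"
    and "\<forall>k. \<exists>T. open T \<and> \<phi> p \<in> T \<and> tame k T (\<lambda>\<epsilon> x. u \<epsilon> (inv_into V \<phi> x))"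
    using assms(1) unfolding tame_at_def by blast
  then obtain T where T: "open T" "\<phi> p \<in> T" "tame k T (\<lambda>\<epsilon> x. u \<epsilon> (inv_into V \<phi> x))" by blast
  define H where "H = W \<inter> ({q \<in> V. \<phi> q \<in> T} \<inter> G)"
  have oH: "openin X ({q \<in> V. \<phi> q \<in> T} \<inter> G)"
    using openin_chart_vimage[OF V(1) T(1)] G(1) by (rule openin_Int)
  have H: "openin X H" unfolding H_def using openin_chart[OF W(1)] oH by (rule openin_Int)
  have o: "open (\<psi> ` H)" unfolding H_def by (rule open_chart_image_Int[OF W(1) oH])
  have "smooth_on (\<psi> ` H) (\<lambda>x. \<phi> (inv_into W \<psi> x))"
    by (rule smooth_on_subset[OF open_chart_image_Int[OF W(1) openin_chart[OF V(1)]] o transition_smooth[OF W(1) V(1)]])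
      (auto simp: H_def)
  moreover have "(\<lambda>x. \<phi> (inv_into W \<psi> x)) ` \<psi> ` H \<subseteq> T"
    using chart_inv[OF W(1)] by (auto simp: H_def)
  ultimately have "tame k (\<psi> ` H) (\<lambda>\<epsilon> x. u \<epsilon> (inv_into V \<phi> (\<phi> (inv_into W \<psi> x))))"
    using tame_compose[OF o _ _ T(3)] by blast
  then have "tame k (\<psi> ` H) (\<lambda>\<epsilon> x. u \<epsilon> (inv_into W \<psi> x))"
    by (rule tame_cong[OF _ o]) (auto simp: H_def chart_inv[OF W(1)] chart_inv[OF V(1)])
  then show ?thesis using H V(2) W(2) T(2) G(2) by (intro exI[of _ H]) (auto simp: H_def)
qed

lemma tame_atI:
  assumes "(V, \<phi>) \<in> A" "p \<in> V" "open S" "\<phi> p \<in> S" "\<And>k. tame k S (\<lambda>\<epsilon> x. u \<epsilon> (inv_into V \<phi> x))"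
  shows "tame_at p u"
  unfolding tame_at_def using assms by blast

lemma tame_at_cong:
  assumes "tame_at p u" and G: "openin X G" "p \<in> G"
    and eq: "\<And>\<epsilon> q. \<epsilon> \<in> {0<..<1} \<Longrightarrow> q \<in> G \<Longrightarrow> u \<epsilon> q = w \<epsilon> q"
  shows "tame_at p w"
proof -
  obtain V \<phi> where V: "(V, \<phi>) \<in> A" "p \<in> V"
    using chart_at[of p] openin_subset[OF G(1)] G(2) by blast
  have "\<exists>T. open T \<and> \<phi> p \<in> T \<and> tame k T (\<lambda>\<epsilon> x. w \<epsilon> (inv_into V \<phi> x))" for k
  proof -
    obtain H where H: "openin X H" "p \<in> H" "H \<subseteq> V \<inter> G" "tame k (\<phi> ` H) (\<lambda>\<epsilon> x. u \<epsilon> (inv_into V \<phi> x))"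
      using tame_at_chart[OF assms(1) V G] by blast
    then have "H = V \<inter> H" by blast
    then have o: "open (\<phi> ` H)" using open_chart_image_Int[OF V(1) H(1)] by simp
    have "tame k (\<phi> ` H) (\<lambda>\<epsilon> x. w \<epsilon> (inv_into V \<phi> x))"
      by (rule tame_cong[OF H(4) o]) (use H(3) chart_inv[OF V(1)] eq in force)
    with o H(2) show ?thesis by blast
  qed
  with V show ?thesis unfolding tame_at_def by blast
qed

lemma tame_at_const: "p \<in> topspace X \<Longrightarrow> tame_at p (\<lambda>_ _. c)"
  by (rule chart_at, assumption) (rule tame_atI[of _ _ p UNIV]; simp add: tame_const)

text \<open>The assumption on h quantifies over nets on the model space, so one argument serves sums
  and products. The two nets may be tame in different charts; the second is transported to the chart
  of the first.\<close>

lemma tame_at_combine: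
  assumes "tame_at p u" "tame_at p w"
    and h: "\<And>k T (u :: real \<Rightarrow> 'e \<Rightarrow> 'k::real_normed_field) w. open T \<Longrightarrow> tame k T u \<Longrightarrow> tame k T w \<Longrightarrow> tame k T (\<lambda>\<epsilon> x. h (u \<epsilon> x) (w \<epsilon> x))"
  shows "tame_at p (\<lambda>\<epsilon> q. h (u \<epsilon> q) (w \<epsilon> q))"
proof -
  obtain V \<phi> where V: "(V, \<phi>) \<in> A" "p \<in> V"
    and u: "\<forall>k. \<exists>T. open T \<and> \<phi> p \<in> T \<and> tame k T (\<lambda>\<epsilon> x. u \<epsilon> (inv_into V \<phi> x))"
    using assms(1) unfolding tame_at_def by blast
  have "\<exists>T. open T \<and> \<phi> p \<in> T \<and> tame k T (\<lambda>\<epsilon> x. h (u \<epsilon> (inv_into V \<phi> x)) (w \<epsilon> (inv_into V \<phi> x)))" for k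
  proof -
    obtain T where T: "open T" "\<phi> p \<in> T" "tame k T (\<lambda>\<epsilon> x. u \<epsilon> (inv_into V \<phi> x))" using u by blast
    obtain H where H: "openin X H" "p \<in> H" "H \<subseteq> V \<inter> V" "tame k (\<phi> ` H) (\<lambda>\<epsilon> x. w \<epsilon> (inv_into V \<phi> x))"
      using tame_at_chart[OF assms(2) V openin_chart[OF V(1)] V(2)] by blast
    then have "H = V \<inter> H" by blast
    then have "open (\<phi> ` H)" using open_chart_image_Int[OF V(1) H(1)] by simp
    then have o: "open (T \<inter> \<phi> ` H)" using T(1) by blast
    have "tame k (T \<inter> \<phi> ` H) (\<lambda>\<epsilon> x. h (u \<epsilon> (inv_into V \<phi> x)) (w \<epsilon> (inv_into V \<phi> x)))"
      by (rule h[OF o tame_subset[OF T(3) Int_lower1] tame_subset[OF H(4) Int_lower2]])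
    with o T(2) H(2) show ?thesis by (intro exI[of _ "T \<inter> \<phi> ` H"]) simp
  qed
  with V show ?thesis unfolding tame_at_def by blast
qed

lemma tame_at_mult: "tame_at p u \<Longrightarrow> tame_at p w \<Longrightarrow> tame_at p (\<lambda>\<epsilon> q. u \<epsilon> q * w \<epsilon> q)"
  by (rule tame_at_combine) (auto intro: tame_mult)

lemma tame_at_add: "tame_at p u \<Longrightarrow> tame_at p w \<Longrightarrow> tame_at p (\<lambda>\<epsilon> q. u \<epsilon> q + w \<epsilon> q)"
  by (rule tame_at_combine) (auto intro: tame_add)

lemma tame_at_prod:
  assumes "finite F" "\<And>i. i \<in> F \<Longrightarrow> tame_at p (u i)" "p \<in> topspace X"
  shows "tame_at p (\<lambda>\<epsilon> q. \<Prod>i\<in>F. u i \<epsilon> q)"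
  using assms(1,2)
  by (induction F rule: finite_induct) (simp_all add: tame_at_const tame_at_mult assms(3))

lemma tame_chart_if_tame_at:
  assumes "openin X \<Omega>" "(V, \<phi>) \<in> A" "\<And>p. p \<in> \<Omega> \<Longrightarrow> tame_at p u"
  shows "tame k (\<phi> ` (V \<inter> \<Omega>)) (\<lambda>\<epsilon> x. u \<epsilon> (inv_into V \<phi> x))"
proof (rule tame_local)
  fix x assume "x \<in> \<phi> ` (V \<inter> \<Omega>)"
  then obtain p where p: "p \<in> V" "p \<in> \<Omega>" "x = \<phi> p" by blast
  obtain H where H: "openin X H" "p \<in> H" "H \<subseteq> V \<inter> \<Omega>" "tame k (\<phi> ` H) (\<lambda>\<epsilon> x. u \<epsilon> (inv_into V \<phi> x))"
    using tame_at_chart[OF assms(3)[OF p(2)] assms(2) p(1) assms(1) p(2)] by blast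
  then have "H = V \<inter> H" by blast
  then have "open (\<phi> ` H)" using open_chart_image_Int[OF assms(2) H(1)] by simp
  then show "\<exists>T. open T \<and> x \<in> T \<and> tame k T (\<lambda>\<epsilon> x. u \<epsilon> (inv_into V \<phi> x))"
    using H p by blast
qed

end

section \<open>Moderate nets as the nets that are tame at every point\<close>

lemma (in hausdorff_manifold) smooth_functions_iff:
  "u \<in> smooth_functions A \<Omega> \<longleftrightarrow> (\<forall>(V, \<phi>)\<in>A. smooth_on (\<phi> ` (V \<inter> \<Omega>)) (\<lambda>x. u (inv_into V \<phi> x)))"
  by (simp add: smooth_functions_def comp_def)

lemma (in hausdorff_manifold) smooth_functionsD:
  assumes "u \<in> smooth_functions A \<Omega>" "(V, \<phi>) \<in> A"
  shows "smooth_on (\<phi> ` (V \<inter> \<Omega>)) (\<lambda>x. u (inv_into V \<phi> x))"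
  using assms unfolding smooth_functions_iff by fast

lemma diff_operators_chart:
  assumes "P \<in> diff_operators A \<Omega>" "(V, \<phi>) \<in> A"
  obtains L a where "finite L" "\<And>vs. vs \<in> L \<Longrightarrow> smooth_on (\<phi> ` (V \<inter> \<Omega>)) (a vs)"
    "\<And>u p. u \<in> smooth_functions A \<Omega> \<Longrightarrow> p \<in> V \<inter> \<Omega> \<Longrightarrow>
       P u p = (\<Sum>vs\<in>L. a vs (\<phi> p) * iter_deriv vs (\<lambda>x. u (inv_into V \<phi> x)) (\<phi> p))"
proof -
  obtain m where "\<forall>(V, \<phi>)\<in>A. \<exists>L a. finite L \<and>
        (\<forall>vs\<in>L. length vs \<le> m \<and> smooth_on (\<phi> ` (V \<inter> \<Omega>)) (a vs)) \<and>
        (\<forall>u\<in>smooth_functions A \<Omega>. \<forall>p\<in>V \<inter> \<Omega>.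
           P u p = (\<Sum>vs\<in>L. a vs (\<phi> p) * iter_deriv vs (u \<circ> inv_into V \<phi>) (\<phi> p)))"
    using assms(1) unfolding diff_operators_def by blast
  then have "\<exists>L a. finite L \<and>
        (\<forall>vs\<in>L. length vs \<le> m \<and> smooth_on (\<phi> ` (V \<inter> \<Omega>)) (a vs)) \<and>
        (\<forall>u\<in>smooth_functions A \<Omega>. \<forall>p\<in>V \<inter> \<Omega>.
           P u p = (\<Sum>vs\<in>L. a vs (\<phi> p) * iter_deriv vs (u \<circ> inv_into V \<phi>) (\<phi> p)))"
    using assms(2) by fast
  then show ?thesis using that unfolding comp_def by blast
qed

context hausdorff_manifold
begin

text \<open>In a chart, P applied to the net is a finite sum of smooth coefficients, tame as
  constant nets, times iterated derivatives. Being tame of order 0, this sum is locally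
  bounded.\<close>

lemma moderate_local_bound:
  assumes \<Omega>: "openin X \<Omega>" and p: "p \<in> \<Omega>" and u: "\<And>p. p \<in> \<Omega> \<Longrightarrow> tame_at p u"
    and P: "P \<in> diff_operators A \<Omega>"
    and sm: "\<And>\<epsilon>. \<epsilon> \<in> {0<..<1} \<Longrightarrow> u \<epsilon> \<in> smooth_functions A \<Omega>"
  shows "\<exists>G. openin X G \<and> p \<in> G \<and> (\<exists>C N. 0 \<le> C \<and> (\<forall>\<^sub>F \<epsilon> in at_right 0. \<forall>q\<in>G. norm (P (u \<epsilon>) q) \<le> C * (1 / \<epsilon>) ^ N))"
proof -
  obtain V \<phi> where V: "(V, \<phi>) \<in> A" "p \<in> V"
    using chart_at[of p] openin_subset[OF \<Omega>] p by blast
  let ?S = "\<phi> ` (V \<inter> \<Omega>)" and ?u = "\<lambda>\<epsilon> x. u \<epsilon> (inv_into V \<phi> x)"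
  have S: "open ?S" by (rule open_chart_image_Int[OF V(1) \<Omega>])
  obtain L a where L: "finite L" "\<And>vs. vs \<in> L \<Longrightarrow> smooth_on ?S (a vs)"
    "\<And>u p. u \<in> smooth_functions A \<Omega> \<Longrightarrow> p \<in> V \<inter> \<Omega> \<Longrightarrow>
       P u p = (\<Sum>vs\<in>L. a vs (\<phi> p) * iter_deriv vs (\<lambda>x. u (inv_into V \<phi> x)) (\<phi> p))"
    by (rule diff_operators_chart[OF P V(1)]) (rule that)
  have "tame 0 ?S (\<lambda>\<epsilon> x. \<Sum>vs\<in>L. a vs x * iter_deriv vs (?u \<epsilon>) x)"
    by (intro tame_sum tame_mult S L tame_if_smooth_on tame_iter_deriv tame_chart_if_tame_at[OF \<Omega> V(1) u])
  then have "loc_bdd (\<lambda>\<epsilon> x. \<Sum>vs\<in>L. a vs x * iter_deriv vs (?u \<epsilon>) x) (\<phi> p)"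
    by (rule tame_loc_bdd) (use p V in blast)
  then obtain T C N where T: "open T" "\<phi> p \<in> T" "0 \<le> C" and
    ev: "\<forall>\<^sub>F \<epsilon> in at_right 0. \<forall>y\<in>T. norm (\<Sum>vs\<in>L. a vs y * iter_deriv vs (?u \<epsilon>) y) \<le> C * (1 / \<epsilon>) ^ N"
    by (rule loc_bddE)
  define G where "G = {q \<in> V. \<phi> q \<in> T} \<inter> \<Omega>"
  have "openin X G" unfolding G_def using openin_chart_vimage[OF V(1) T(1)] \<Omega> by (rule openin_Int)
  moreover have "\<forall>\<^sub>F \<epsilon> in at_right 0. \<forall>q\<in>G. norm (P (u \<epsilon>) q) \<le> C * (1 / \<epsilon>) ^ N"
  proof (rule eventually_at_right_mono_unit[OF ev], rule ballI)
    fix \<epsilon> :: real and q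
    assume \<epsilon>: "0 < \<epsilon>" "\<epsilon> < 1" and q: "q \<in> G"
      and b: "\<forall>y\<in>T. norm (\<Sum>vs\<in>L. a vs y * iter_deriv vs (?u \<epsilon>) y) \<le> C * (1 / \<epsilon>) ^ N"
    have q': "q \<in> V \<inter> \<Omega>" "\<phi> q \<in> T" using q by (auto simp: G_def)
    have "u \<epsilon> \<in> smooth_functions A \<Omega>" using \<epsilon> by (intro sm) simp
    from L(3)[OF this q'(1)] show "norm (P (u \<epsilon>) q) \<le> C * (1 / \<epsilon>) ^ N"
      using b q'(2) by simp
  qed
  moreover have "p \<in> G" using p V T by (simp add: G_def)
  ultimately show ?thesis using T(3) by blast
qed

lemma moderate_if_tame:
  assumes \<Omega>: "openin X \<Omega>" and u: "\<And>p. p \<in> \<Omega> \<Longrightarrow> tame_at p u"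
  shows "u \<in> moderate_nets X A \<Omega>"
proof -
  have sm: "u \<epsilon> \<in> smooth_functions A \<Omega>" if "\<epsilon> \<in> {0<..<1}" for \<epsilon>
    unfolding smooth_functions_iff
  proof clarify
    fix V \<phi> assume V: "(V, \<phi>) \<in> A"
    show "smooth_on (\<phi> ` (V \<inter> \<Omega>)) (\<lambda>x. u \<epsilon> (inv_into V \<phi> x))"
      using smooth_on_if_tame[OF tame_chart_if_tame_at[OF \<Omega> V u] that] .
  qed
  have bd: "\<exists>N::nat. (\<lambda>\<epsilon>. sup_norm K (P (u \<epsilon>))) \<in> O[at_right 0](\<lambda>\<epsilon>. \<epsilon> powr (- real N))"
    if K: "compactin X K" "K \<subseteq> \<Omega>" and P: "P \<in> diff_operators A \<Omega>" for K P
  proof -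
    have "\<exists>C N. 0 \<le> C \<and> (\<forall>\<^sub>F \<epsilon> in at_right 0. \<forall>q\<in>K. norm (P (u \<epsilon>) q) \<le> C * (1 / \<epsilon>) ^ N)"
    proof (rule compactin_finite_cover_induct[OF K(1)])
      show "\<exists>G. openin X G \<and> p \<in> G \<and> (\<exists>C N. 0 \<le> C \<and> (\<forall>\<^sub>F \<epsilon> in at_right 0. \<forall>q\<in>G. norm (P (u \<epsilon>) q) \<le> C * (1 / \<epsilon>) ^ N))"
        if "p \<in> K" for p
        using moderate_local_bound[OF \<Omega> _ u P sm] that K(2) by blast
    next
      fix G H
      assume "\<exists>C N. 0 \<le> C \<and> (\<forall>\<^sub>F \<epsilon> in at_right 0. \<forall>q\<in>G. norm (P (u \<epsilon>) q) \<le> C * (1 / \<epsilon>) ^ N)"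
        "\<exists>C N. 0 \<le> C \<and> (\<forall>\<^sub>F \<epsilon> in at_right 0. \<forall>q\<in>H. norm (P (u \<epsilon>) q) \<le> C * (1 / \<epsilon>) ^ N)"
      then obtain C N C' N' where C: "0 \<le> C" "0 \<le> C'"
        and 1: "\<forall>\<^sub>F \<epsilon> in at_right 0. \<forall>q\<in>G. norm (P (u \<epsilon>) q) \<le> C * (1 / \<epsilon>) ^ N"
        and 2: "\<forall>\<^sub>F \<epsilon> in at_right 0. \<forall>q\<in>H. norm (P (u \<epsilon>) q) \<le> C' * (1 / \<epsilon>) ^ N'" by blast
      have "\<forall>\<^sub>F \<epsilon> in at_right 0. \<forall>q\<in>G \<union> H. norm (P (u \<epsilon>) q) \<le> (C + C') * (1 / \<epsilon>) ^ (N + N')"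
      proof (rule eventually_at_right_mono_unit[OF eventually_conj[OF 1 2]], rule ballI)
        fix \<epsilon> :: real and q
        assume \<epsilon>: "0 < \<epsilon>" "\<epsilon> < 1" and q: "q \<in> G \<union> H" and
          b: "(\<forall>q\<in>G. norm (P (u \<epsilon>) q) \<le> C * (1 / \<epsilon>) ^ N) \<and> (\<forall>q\<in>H. norm (P (u \<epsilon>) q) \<le> C' * (1 / \<epsilon>) ^ N')"
        have "C * (1 / \<epsilon>) ^ N \<le> (C + C') * (1 / \<epsilon>) ^ (N + N')"
          using \<epsilon> C by (intro mult_mono power_increasing) auto
        moreover have "C' * (1 / \<epsilon>) ^ N' \<le> (C + C') * (1 / \<epsilon>) ^ (N + N')"
          using \<epsilon> C by (intro mult_mono power_increasing) auto
        ultimately show "norm (P (u \<epsilon>) q) \<le> (C + C') * (1 / \<epsilon>) ^ (N + N')"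
          using b q order_trans by blast
      qed
      moreover have "0 \<le> C + C'" using C by simp
      ultimately show "\<exists>C N. 0 \<le> C \<and> (\<forall>\<^sub>F \<epsilon> in at_right 0. \<forall>q\<in>G \<union> H. norm (P (u \<epsilon>) q) \<le> C * (1 / \<epsilon>) ^ N)"
        by blast
    next
      fix G H
      assume "\<exists>C N. 0 \<le> C \<and> (\<forall>\<^sub>F \<epsilon> in at_right 0. \<forall>q\<in>G. norm (P (u \<epsilon>) q) \<le> C * (1 / \<epsilon>) ^ N)" and HG: "H \<subseteq> G"
      then obtain C N where C: "0 \<le> C"
        and 1: "\<forall>\<^sub>F \<epsilon> in at_right 0. \<forall>q\<in>G. norm (P (u \<epsilon>) q) \<le> C * (1 / \<epsilon>) ^ N" by blast
      have "\<forall>\<^sub>F \<epsilon> in at_right 0. \<forall>q\<in>H. norm (P (u \<epsilon>) q) \<le> C * (1 / \<epsilon>) ^ N"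
        using 1 by eventually_elim (use HG in blast)
      with C show "\<exists>C N. 0 \<le> C \<and> (\<forall>\<^sub>F \<epsilon> in at_right 0. \<forall>q\<in>H. norm (P (u \<epsilon>) q) \<le> C * (1 / \<epsilon>) ^ N)"
        by blast
    qed auto
    then obtain C N where C: "0 \<le> C"
      and ev: "\<forall>\<^sub>F \<epsilon> in at_right 0. \<forall>q\<in>K. norm (P (u \<epsilon>) q) \<le> C * (1 / \<epsilon>) ^ N" by blast
    have "\<forall>\<^sub>F \<epsilon> in at_right 0. norm (sup_norm K (P (u \<epsilon>))) \<le> C * norm (\<epsilon> powr (- real N))"
    proof (rule eventually_at_right_mono_unit[OF ev])
      fix \<epsilon> :: real
      assume \<epsilon>: "0 < \<epsilon>" and b: "\<forall>q\<in>K. norm (P (u \<epsilon>) q) \<le> C * (1 / \<epsilon>) ^ N"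
      have e: "\<epsilon> powr (- real N) = (1 / \<epsilon>) ^ N"
        using \<epsilon> by (simp add: powr_minus powr_realpow power_inverse divide_inverse)
      show "norm (sup_norm K (P (u \<epsilon>))) \<le> C * norm (\<epsilon> powr (- real N))"
      proof (cases "K = {}")
        case False
        then obtain q where q: "q \<in> K" by blast
        have bdd: "bdd_above ((\<lambda>p. norm (P (u \<epsilon>) p)) ` K)" using b by (intro bdd_aboveI2) blast
        have "0 \<le> sup_norm K (P (u \<epsilon>))"
          using cSUP_upper2[OF bdd q norm_ge_zero] False by (simp add: sup_norm_def)
        moreover have "sup_norm K (P (u \<epsilon>)) \<le> C * (1 / \<epsilon>) ^ N"
          unfolding sup_norm_def using False b by (auto intro!: cSUP_least)
        ultimately show ?thesis using \<epsilon> by (simp add: e)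
      qed (use C in \<open>simp add: sup_norm_def\<close>)
    qed
    \<comment> \<open>The Landau rule asks for a positive constant, while C may be 0; hence C +
      1.\<close>
    then show ?thesis by (intro exI[of _ N] landau_o.bigI[of "C + 1"])
        (use C in \<open>auto elim!: eventually_mono simp: distrib_right intro: add_increasing2\<close>)
  qed
  show ?thesis unfolding moderate_nets_def smooth_nets_def using sm bd by simp
qed

text \<open>A moderate net is tested against globally defined operators only; cutting an iterated derivative
  in a single chart off outside a compact subset of the chart makes it such an operator.\<close>

lemma localized_iter_deriv_operator:
  fixes b :: "'e \<Rightarrow> real" and vs :: "'e list"
  assumes \<Omega>: "openin X \<Omega>" and V: "(V, \<phi>) \<in> A" and b: "smooth_on UNIV b"
    and K: "compact K" "K \<subseteq> \<phi> ` (V \<inter> \<Omega>)" "\<And>x. x \<notin> K \<Longrightarrow> b x = 0"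
  defines "P \<equiv> \<lambda>(u :: 'a \<Rightarrow> 'k::real_normed_field) q. if q \<in> V then of_real (b (\<phi> q)) * iter_deriv vs (\<lambda>x. u (inv_into V \<phi> x)) (\<phi> q) else 0"
  shows "P \<in> diff_operators A \<Omega>"
proof -
  have "\<exists>L a. finite L \<and> (\<forall>ws\<in>L. length ws \<le> length vs \<and> smooth_on (\<psi> ` (W \<inter> \<Omega>)) (a ws)) \<and>
        (\<forall>u\<in>smooth_functions A \<Omega>. \<forall>p\<in>W \<inter> \<Omega>.
           P u p = (\<Sum>ws\<in>L. a ws (\<psi> p) * iter_deriv ws (u \<circ> inv_into W \<psi>) (\<psi> p)))"
    if W: "(W, \<psi>) \<in> A" for W \<psi>
  proof -
    let ?R = "\<phi> ` (V \<inter> (W \<inter> \<Omega>))" and ?S = "\<psi> ` (W \<inter> (V \<inter> \<Omega>))"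
    let ?\<tau> = "\<lambda>x. \<psi> (inv_into V \<phi> x)" and ?\<sigma> = "\<lambda>x. \<phi> (inv_into W \<psi> x)"
    note invV = chart_inv[OF V] and invW = chart_inv[OF W]
    have WO: "openin X (W \<inter> \<Omega>)" using openin_chart[OF W] \<Omega> by (rule openin_Int)
    have VO: "openin X (V \<inter> \<Omega>)" using openin_chart[OF V] \<Omega> by (rule openin_Int)
    have R: "open ?R" using WO by (rule open_chart_image_Int[OF V])
    have S: "open ?S" using VO by (rule open_chart_image_Int[OF W])
    have S': "open (\<psi> ` (W \<inter> \<Omega>))" using \<Omega> by (rule open_chart_image_Int[OF W])
    have \<tau>: "smooth_on ?R ?\<tau>"
      by (rule smooth_on_subset[OF open_chart_image_Int[OF V openin_chart[OF W]] R transition_smooth[OF V W]]) auto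
    have \<sigma>: "smooth_on ?S ?\<sigma>"
      by (rule smooth_on_subset[OF open_chart_image_Int[OF W openin_chart[OF V]] S transition_smooth[OF W V]]) auto
    have "diff_expr ?S (length vs) (\<lambda>(w :: 'e \<Rightarrow> 'k) z. iter_deriv vs (\<lambda>y. w (?\<tau> y)) (?\<sigma> z))"
    proof (rule diff_expr_iter_deriv_change[OF R S \<tau> _ \<sigma>])
      show "?\<tau> ` ?R \<subseteq> ?S" "?\<sigma> ` ?S \<subseteq> ?R" using invV invW by auto
      show "?\<sigma> (?\<tau> y) = y" if "y \<in> ?R" for y using that invV invW by auto
      show "?\<tau> (?\<sigma> z) = z" if "z \<in> ?S" for z using that invV invW by auto
    qed
    then obtain L a where L: "finite L" "\<forall>ws\<in>L. length ws \<le> length vs \<and> smooth_on ?S (a ws)"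
      and La: "\<forall>w :: 'e \<Rightarrow> 'k. smooth_on ?S w \<longrightarrow> (\<forall>z\<in>?S. iter_deriv vs (\<lambda>y. w (?\<tau> y)) (?\<sigma> z) = (\<Sum>ws\<in>L. a ws z * iter_deriv ws w z))"
      unfolding diff_expr_def by blast
    \<comment> \<open>The transformed coefficients exist only on the overlap of the two charts;
      multiplied by the cutoff they extend by 0 to the whole of
      \<open>W \<inter> \<Omega>\<close>.\<close>
    define a' where "a' ws z = (if z \<in> ?S then of_real (b (?\<sigma> z)) * a ws z else 0)" for ws z
    have sm: "smooth_on (\<psi> ` (W \<inter> \<Omega>)) (a' ws)" if "ws \<in> L" for ws
    proof (rule smooth_on_local[OF _ S'])
      fix z assume "z \<in> \<psi> ` (W \<inter> \<Omega>)"
      then obtain q where q: "q \<in> W" "q \<in> \<Omega>" "z = \<psi> q" by blast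
      show "\<exists>T. open T \<and> z \<in> T \<and> smooth_on T (a' ws)"
      proof (cases "q \<in> V")
        case True
        have "smooth_on ?S (\<lambda>z. of_real (b (?\<sigma> z)) * a ws z)"
          using L(2) that
          by (intro smooth_on_mult smooth_on_of_real S smooth_on_compose[OF S \<sigma> subset_UNIV open_UNIV b]) blast
        then have "smooth_on ?S (a' ws)" by (rule smooth_on_cong[OF _ S]) (simp add: a'_def)
        then show ?thesis using S q True by blast
      next
        case False
        let ?Q = "{p \<in> V. \<phi> p \<in> K}"
        let ?G = "W \<inter> (\<Omega> - ?Q)"
        \<comment> \<open>A point outside V may be a limit of points of the overlap. As
          \<open>?Q\<close> is closed in X, such a point has a neighbourhood off \<open>?Q\<close>,
          where the cutoff and hence \<open>a'\<close> vanish.\<close>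
        have "closedin X ?Q" by (rule closedin_chart_vimage[OF V K(1)]) (use K(2) in blast)
        then have o: "open (\<psi> ` ?G)" using \<Omega> by (intro open_chart_image_Int[OF W] openin_diff)
        have "a' ws y = 0" if "y \<in> \<psi> ` ?G" for y
        proof -
          from that obtain q' where "y = \<psi> q'" "q' \<in> ?G" by (rule imageE)
          then have q': "q' \<in> W" "q' \<in> \<Omega>" "\<not> (q' \<in> V \<and> \<phi> q' \<in> K)" "y = \<psi> q'" by simp_all
          show ?thesis
          proof (cases "y \<in> ?S")
            case True
            then obtain q'' where q'': "q'' \<in> W" "q'' \<in> V" "y = \<psi> q''" by blast
            then have "q'' = q'" using q'(1,4) inj_onD[OF inj_on_chart[OF W]] by metis
            then show ?thesis using q' q'' K(3) by (simp add: a'_def invW)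
          qed (simp add: a'_def)
        qed
        then have "smooth_on (\<psi> ` ?G) (a' ws)"
          by (intro smooth_on_cong[OF smooth_on_const[of _ 0] o]) simp
        then show ?thesis using o q False by blast
      qed
    qed
    have eq: "P u p = (\<Sum>ws\<in>L. a' ws (\<psi> p) * iter_deriv ws (u \<circ> inv_into W \<psi>) (\<psi> p))"
      if u: "u \<in> smooth_functions A \<Omega>" and p: "p \<in> W" "p \<in> \<Omega>" for u p
    proof (cases "p \<in> V")
      case True
      let ?w = "\<lambda>x. u (inv_into W \<psi> x)"
      have w: "smooth_on ?S ?w"
        by (rule smooth_on_subset[OF S' S smooth_functionsD[OF u W]]) blast
      have pS: "\<psi> p \<in> ?S" using p True by blast
      have "iter_deriv vs (\<lambda>x. u (inv_into V \<phi> x)) (\<phi> p) = iter_deriv vs (\<lambda>y. ?w (?\<tau> y)) (\<phi> p)"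
        by (rule iter_deriv_cong[OF R]) (use p True invV invW in auto)
      also have "\<dots> = (\<Sum>ws\<in>L. a ws (\<psi> p) * iter_deriv ws ?w (\<psi> p))"
        using La[rule_format, OF w pS] p(1) by (simp only: invW)
      finally show ?thesis
        using True pS p(1) by (simp add: P_def a'_def sum_distrib_left mult.assoc comp_def invW)
    next
      case False
      have "\<psi> p \<notin> ?S"
      proof
        assume "\<psi> p \<in> ?S"
        then obtain q where q: "q \<in> W" "q \<in> V" "\<psi> p = \<psi> q" by blast
        then have "q = p" using p(1) inj_onD[OF inj_on_chart[OF W]] by metis
        then show False using q False by simp
      qed
      then show ?thesis using False by (simp add: P_def a'_def)
    qed
    show ?thesis
      by (intro exI[of _ L] exI[of _ a'] conjI ballI) (use L sm eq in auto)
  qed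
  then show ?thesis unfolding diff_operators_def by (intro CollectI exI[of _ "length vs"]) fast
qed

lemma moderate_smooth:
  "u \<in> moderate_nets X A \<Omega> \<Longrightarrow> \<epsilon> \<in> {0<..<1} \<Longrightarrow> u \<epsilon> \<in> smooth_functions A \<Omega>"
  by (simp add: moderate_nets_def smooth_nets_def)

text \<open>For each word vs and each point x of the chart image, a cutoff equal to 1 near x makes
  the iterated derivative a global test operator. The moderate bound on a small compact ball around
  x is then the required local bound.\<close>

lemma tame_if_moderate:
  fixes u :: "('a, 'k::real_normed_field) net"
  assumes \<Omega>: "openin X \<Omega>" and u: "u \<in> moderate_nets X A \<Omega>" and p: "p \<in> \<Omega>"
  shows "tame_at p u"
proof -
  obtain V \<phi> where V: "(V, \<phi>) \<in> A" "p \<in> V"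
    using chart_at[of p] openin_subset[OF \<Omega>] p by blast
  let ?S = "\<phi> ` (V \<inter> \<Omega>)" and ?u = "\<lambda>\<epsilon> x. u \<epsilon> (inv_into V \<phi> x)"
  have S: "open ?S" by (rule open_chart_image_Int[OF V(1) \<Omega>])
  have sm: "smooth_on ?S (?u \<epsilon>)" if "\<epsilon> \<in> {0<..<1}" for \<epsilon>
    by (rule smooth_functionsD[OF moderate_smooth[OF u that] V(1)])
  have bd: "loc_bdd (\<lambda>\<epsilon>. iter_deriv vs (?u \<epsilon>)) x" if x: "x \<in> ?S" for vs x
  proof -
    obtain r where r: "0 < r" "cball x r \<subseteq> ?S" using S x by (meson open_contains_cball)
    have "0 < r / 2" using r(1) by simp
    then obtain B :: "'e \<Rightarrow> real" where B: "smooth_on UNIV B"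
      "\<And>y. dist x y < r / 2 \<Longrightarrow> B y = 0" "\<And>y. 2 * (r / 2) \<le> dist x y \<Longrightarrow> B y = 1"
      by (rule smooth_bump) (rule that)
    define b where "b y = 1 + (- 1) * B y" for y
    have b: "smooth_on UNIV b" unfolding b_def
      by (intro smooth_on_add smooth_on_mult smooth_on_const B(1) open_UNIV)
    define P where "P = (\<lambda>(u :: 'a \<Rightarrow> 'k) q. if q \<in> V then of_real (b (\<phi> q)) * iter_deriv vs (\<lambda>x. u (inv_into V \<phi> x)) (\<phi> q) else 0)"
    have P: "P \<in> diff_operators A \<Omega>" unfolding P_def
    proof (rule localized_iter_deriv_operator[OF \<Omega> V(1) b, of "cball x r"])
      show "b y = 0" if "y \<notin> cball x r" for y using that B(3)[of y] by (simp add: b_def)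
    qed (use r(2) in auto)
    \<comment> \<open>Three nested radii: b vanishes outside \<open>cball x r\<close> and is 1 on
      the open ball of radius r/2, so on the closed ball of radius r/4 the operator P is exactly the
      iterated derivative.\<close>
    let ?r = "r / 4"
    define K where "K = {q \<in> V. \<phi> q \<in> cball x ?r}"
    have "cball x ?r \<subseteq> cball x r" using r(1) by (intro subset_cball) simp
    with r(2) have sub: "cball x ?r \<subseteq> ?S" by (rule order_trans[rotated])
    have KX: "compactin X K" unfolding K_def by (rule compactin_chart_vimage[OF V(1)]) (use sub in auto)
    have K\<Omega>: "K \<subseteq> \<Omega>"
    proof
      fix q assume "q \<in> K"
      then have q: "q \<in> V" "\<phi> q \<in> ?S" using sub by (auto simp: K_def)
      then obtain q' where q': "q' \<in> V" "q' \<in> \<Omega>" "\<phi> q = \<phi> q'" by blast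
      then have "q = q'" using q(1) inj_onD[OF inj_on_chart[OF V(1)]] by metis
      with q' show "q \<in> \<Omega>" by simp
    qed
    have PK: "P (u \<epsilon>) q = iter_deriv vs (?u \<epsilon>) (\<phi> q)" if "q \<in> K" for \<epsilon> q
    proof -
      have "q \<in> V" "dist x (\<phi> q) < r / 2" using that r(1) by (auto simp: K_def)
      then show ?thesis by (simp add: P_def b_def B(2))
    qed
    obtain N :: nat where "(\<lambda>\<epsilon>. sup_norm K (P (u \<epsilon>))) \<in> O[at_right 0](\<lambda>\<epsilon>. \<epsilon> powr (- real N))"
      using u KX K\<Omega> P unfolding moderate_nets_def by blast
    then obtain c where ev: "\<forall>\<^sub>F \<epsilon> in at_right 0. norm (sup_norm K (P (u \<epsilon>))) \<le> c * norm (\<epsilon> powr (- real N))"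
      by (rule landau_o.bigE)
    have "\<forall>\<^sub>F \<epsilon> in at_right 0. \<forall>y\<in>ball x ?r. norm (iter_deriv vs (?u \<epsilon>) y) \<le> c * (1 / \<epsilon>) ^ N"
    proof (rule eventually_at_right_mono_unit[OF ev], rule ballI)
      fix \<epsilon> :: real and y
      assume \<epsilon>: "0 < \<epsilon>" "\<epsilon> < 1" and y: "y \<in> ball x ?r"
        and bound: "norm (sup_norm K (P (u \<epsilon>))) \<le> c * norm (\<epsilon> powr (- real N))"
      have e: "\<epsilon> powr (- real N) = (1 / \<epsilon>) ^ N"
        using \<epsilon> by (simp add: powr_minus powr_realpow power_inverse divide_inverse)
      have "y \<in> ?S" using y sub by auto
      then obtain q where q: "q \<in> V" "y = \<phi> q" by blast
      then have qK: "q \<in> K" using y by (simp add: K_def)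
      \<comment> \<open>The supremum in \<open>sup_norm\<close> dominates the single values only if
        these are bounded above; continuity on a compact ball ensures it.\<close>
      have "continuous_on (cball x ?r) (\<lambda>y. norm (iter_deriv vs (?u \<epsilon>) y))"
        by (intro continuous_on_norm continuous_on_subset[OF smooth_on_continuous sub] smooth_on_iter_deriv sm)
          (use \<epsilon> in simp)
      then have "bdd_above ((\<lambda>y. norm (iter_deriv vs (?u \<epsilon>) y)) ` cball x ?r)"
        by (intro bounded_imp_bdd_above compact_imp_bounded compact_continuous_image) auto
      then have "bdd_above ((\<lambda>p. norm (P (u \<epsilon>) p)) ` K)"
        by (rule bdd_above_mono) (auto simp: PK K_def)
      then have "norm (P (u \<epsilon>) q) \<le> sup_norm K (P (u \<epsilon>))"
        using qK by (auto simp: sup_norm_def intro: cSUP_upper)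
      also have "\<dots> \<le> c * (1 / \<epsilon>) ^ N" using bound \<epsilon> unfolding e by simp
      finally show "norm (iter_deriv vs (?u \<epsilon>) y) \<le> c * (1 / \<epsilon>) ^ N"
        using PK[OF qK] q(2) by simp
    qed
    then show ?thesis unfolding loc_bdd_def using r(1)
      by (intro exI[of _ "ball x ?r"] exI[of _ c] exI[of _ N]) simp
  qed
  show ?thesis
  proof (rule tame_atI[OF V S])
    show "\<phi> p \<in> ?S" using V p by blast
    show "tame k ?S ?u" for k by (rule tame_if_iter_deriv_onb[OF S sm bd])
  qed
qed

lemma moderate_iff_tame:
  assumes "openin X \<Omega>"
  shows "u \<in> moderate_nets X A \<Omega> \<longleftrightarrow> (\<forall>p\<in>\<Omega>. tame_at p u)"
proof
  show "\<forall>p\<in>\<Omega>. tame_at p u" if "u \<in> moderate_nets X A \<Omega>"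
    using tame_if_moderate[OF assms that] by (rule ballI)
  show "u \<in> moderate_nets X A \<Omega>" if "\<forall>p\<in>\<Omega>. tame_at p u"
    by (rule moderate_if_tame[OF assms bspec[OF that]])
qed

end

text \<open>A spare power of \<epsilon> absorbs any constant; this permits smallness conditions
  without constants below.\<close>

lemma eventually_mult_power_le:
  "\<forall>\<^sub>F \<epsilon>::real in at_right 0. c * \<epsilon> ^ Suc m \<le> \<epsilon> ^ m"
proof -
  have "((\<lambda>\<epsilon>::real. c * \<epsilon>) \<longlongrightarrow> 0) (at_right 0)"
    by (auto intro!: tendsto_eq_intros)
  then have "\<forall>\<^sub>F \<epsilon> in at_right 0. c * \<epsilon> < 1" by (rule order_tendstoD) simp
  then show ?thesis
  proof (rule eventually_at_right_mono_unit)
    fix \<epsilon> :: real assume "0 < \<epsilon>" "c * \<epsilon> < 1"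
    then show "c * \<epsilon> ^ Suc m \<le> \<epsilon> ^ m"
      using mult_right_mono[of "c * \<epsilon>" 1 "\<epsilon> ^ m"] by (simp add: mult.assoc)
  qed
qed

section \<open>Negligibility as a pointwise condition\<close>

context hausdorff_manifold
begin

text \<open>One neighbourhood serves all m, whereas the threshold in \<epsilon> may depend on m.
  Derivatives do not occur, in accordance with the definition of negligible nets inside the moderate
  ones.\<close>

definition null_at :: "'a \<Rightarrow> ('a, 'k::real_normed_field) net \<Rightarrow> bool" where
  "null_at p u \<longleftrightarrow> (\<exists>G. openin X G \<and> p \<in> G \<and>
     (\<forall>m::nat. \<forall>\<^sub>F \<epsilon> in at_right 0. \<forall>q\<in>G. norm (u \<epsilon> q) \<le> \<epsilon> ^ m))"

lemma null_at_dominated: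
  assumes "null_at p u" "openin X G" "p \<in> G"
    and "\<forall>\<^sub>F \<epsilon> in at_right 0. \<forall>q\<in>G. norm (w \<epsilon> q) \<le> norm (u \<epsilon> q)"
  shows "null_at p w"
proof -
  obtain H where H: "openin X H" "p \<in> H" "\<forall>m::nat. \<forall>\<^sub>F \<epsilon> in at_right 0. \<forall>q\<in>H. norm (u \<epsilon> q) \<le> \<epsilon> ^ m"
    using assms(1) unfolding null_at_def by blast
  have "\<forall>\<^sub>F \<epsilon> in at_right 0. \<forall>q\<in>H \<inter> G. norm (w \<epsilon> q) \<le> \<epsilon> ^ m" for m
    using H(3)[rule_format, of m] assms(4) by eventually_elim force
  moreover have "openin X (H \<inter> G)" using H(1) assms(2) by (rule openin_Int)
  ultimately show ?thesis unfolding null_at_def using H(2) assms(3) by blast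
qed

lemma null_at_add:
  assumes "null_at p u" "null_at p w"
  shows "null_at p (\<lambda>\<epsilon> q. u \<epsilon> q + w \<epsilon> q)"
proof -
  obtain G where G: "openin X G" "p \<in> G" "\<forall>m::nat. \<forall>\<^sub>F \<epsilon> in at_right 0. \<forall>q\<in>G. norm (u \<epsilon> q) \<le> \<epsilon> ^ m"
    using assms(1) unfolding null_at_def by blast
  obtain H where H: "openin X H" "p \<in> H" "\<forall>m::nat. \<forall>\<^sub>F \<epsilon> in at_right 0. \<forall>q\<in>H. norm (w \<epsilon> q) \<le> \<epsilon> ^ m"
    using assms(2) unfolding null_at_def by blast
  have "\<forall>\<^sub>F \<epsilon> in at_right 0. \<forall>q\<in>G \<inter> H. norm (u \<epsilon> q + w \<epsilon> q) \<le> \<epsilon> ^ m" for m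
    using G(3)[rule_format, of "Suc m"] H(3)[rule_format, of "Suc m"] eventually_mult_power_le[of 2 m]
  proof eventually_elim
    case (elim \<epsilon>)
    show ?case
    proof
      fix q assume "q \<in> G \<inter> H"
      then have "norm (u \<epsilon> q) \<le> \<epsilon> ^ Suc m" "norm (w \<epsilon> q) \<le> \<epsilon> ^ Suc m" using elim by blast+
      then show "norm (u \<epsilon> q + w \<epsilon> q) \<le> \<epsilon> ^ m"
        using norm_triangle_ineq[of "u \<epsilon> q" "w \<epsilon> q"] elim(3) by linarith
    qed
  qed
  moreover have "openin X (G \<inter> H)" using G(1) H(1) by (rule openin_Int)
  ultimately show ?thesis unfolding null_at_def using G(2) H(2) by blast
qed

lemma null_at_zero: "p \<in> topspace X \<Longrightarrow> null_at p (\<lambda>_ _. 0)"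
  unfolding null_at_def
  by (rule exI[of _ "topspace X"])
    (auto intro!: eventually_mono[OF eventually_at_right_unit])

lemma null_on_compact:
  assumes "compactin X K" "\<And>p. p \<in> K \<Longrightarrow> null_at p u"
  shows "\<forall>\<^sub>F \<epsilon> in at_right 0. \<forall>q\<in>K. norm (u \<epsilon> q) \<le> \<epsilon> ^ m"
proof (rule compactin_finite_cover_induct[OF assms(1)])
  show "\<exists>G. openin X G \<and> p \<in> G \<and> (\<forall>\<^sub>F \<epsilon> in at_right 0. \<forall>q\<in>G. norm (u \<epsilon> q) \<le> \<epsilon> ^ m)" if "p \<in> K" for p
    using assms(2)[OF that] unfolding null_at_def by blast
next
  fix G H
  assume "\<forall>\<^sub>F \<epsilon> in at_right 0. \<forall>q\<in>G. norm (u \<epsilon> q) \<le> \<epsilon> ^ m" "\<forall>\<^sub>F \<epsilon> in at_right 0. \<forall>q\<in>H. norm (u \<epsilon> q) \<le> \<epsilon> ^ m"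
  then show "\<forall>\<^sub>F \<epsilon> in at_right 0. \<forall>q\<in>G \<union> H. norm (u \<epsilon> q) \<le> \<epsilon> ^ m" by eventually_elim blast
next
  fix G H assume "\<forall>\<^sub>F \<epsilon> in at_right 0. \<forall>q\<in>G. norm (u \<epsilon> q) \<le> \<epsilon> ^ m" and "H \<subseteq> G"
  then show "\<forall>\<^sub>F \<epsilon> in at_right 0. \<forall>q\<in>H. norm (u \<epsilon> q) \<le> \<epsilon> ^ m" by (auto elim!: eventually_mono)
qed simp

text \<open>A compact coordinate ball inside \<open>\<Omega>\<close> provides a neighbourhood
  independent of m. The estimate is invoked with exponent Suc m, which leaves one power of
  \<epsilon> for the Landau constant.\<close>

lemma null_at_if_negligible:
  assumes \<Omega>: "openin X \<Omega>" and u: "u \<in> negligible_nets X A \<Omega>" and p: "p \<in> \<Omega>"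
  shows "null_at p u"
proof -
  obtain V \<phi> where V: "(V, \<phi>) \<in> A" "p \<in> V"
    using chart_at[of p] openin_subset[OF \<Omega>] p by blast
  let ?S = "\<phi> ` (V \<inter> \<Omega>)"
  have mod: "u \<in> moderate_nets X A \<Omega>" using u by (simp add: negligible_nets_def)
  have "open ?S" by (rule open_chart_image_Int[OF V(1) \<Omega>])
  moreover have "\<phi> p \<in> ?S" using V p by blast
  ultimately obtain r where r: "0 < r" "cball (\<phi> p) r \<subseteq> ?S" by (meson open_contains_cball)
  define K where "K = {q \<in> V. \<phi> q \<in> cball (\<phi> p) r}"
  have KX: "compactin X K" unfolding K_def by (rule compactin_chart_vimage[OF V(1)]) (use r(2) in auto)
  have K\<Omega>: "K \<subseteq> \<Omega>"
  proof
    fix q assume "q \<in> K"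
    then have q: "q \<in> V" "\<phi> q \<in> ?S" using r(2) by (auto simp: K_def)
    then obtain q' where q': "q' \<in> V" "q' \<in> \<Omega>" "\<phi> q = \<phi> q'" by blast
    then have "q = q'" using q(1) inj_onD[OF inj_on_chart[OF V(1)]] by metis
    with q' show "q \<in> \<Omega>" by simp
  qed
  define G where "G = {q \<in> V. \<phi> q \<in> ball (\<phi> p) r}"
  have "openin X G" unfolding G_def by (rule openin_chart_vimage[OF V(1) open_ball])
  moreover have "p \<in> G" using V r by (simp add: G_def)
  moreover have "\<forall>\<^sub>F \<epsilon> in at_right 0. \<forall>q\<in>G. norm (u \<epsilon> q) \<le> \<epsilon> ^ m" for m
  proof -
    have "(\<lambda>\<epsilon>. sup_norm K (u \<epsilon>)) \<in> O[at_right 0](\<lambda>\<epsilon>. \<epsilon> ^ Suc m)"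
      using u KX K\<Omega> unfolding negligible_nets_def by blast
    then obtain c where ev: "\<forall>\<^sub>F \<epsilon> in at_right 0. norm (sup_norm K (u \<epsilon>)) \<le> c * norm (\<epsilon> ^ Suc m)"
      by (rule landau_o.bigE)
    show ?thesis
    proof (rule eventually_at_right_mono_unit[OF eventually_conj[OF ev eventually_mult_power_le[of c m]]], rule ballI)
      fix \<epsilon> :: real and q
      assume \<epsilon>: "0 < \<epsilon>" "\<epsilon> < 1" and q: "q \<in> G"
        and b: "norm (sup_norm K (u \<epsilon>)) \<le> c * norm (\<epsilon> ^ Suc m) \<and> c * \<epsilon> ^ Suc m \<le> \<epsilon> ^ m"
      have qK: "q \<in> K" using q by (simp add: G_def K_def)
      have "continuous_on (cball (\<phi> p) r) (\<lambda>x. norm (u \<epsilon> (inv_into V \<phi> x)))"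
        by (intro continuous_on_norm continuous_on_subset[OF smooth_on_continuous r(2)]
            smooth_functionsD[OF moderate_smooth[OF mod] V(1)]) (use \<epsilon> in simp)
      then have "bdd_above ((\<lambda>x. norm (u \<epsilon> (inv_into V \<phi> x))) ` cball (\<phi> p) r)"
        by (intro bounded_imp_bdd_above compact_imp_bounded compact_continuous_image) auto
      then have "bdd_above ((\<lambda>p. norm (u \<epsilon> p)) ` K)"
        by (rule bdd_above_mono) (force simp: K_def chart_inv[OF V(1)] intro: rev_image_eqI)
      then have "norm (u \<epsilon> q) \<le> sup_norm K (u \<epsilon>)"
        using qK by (auto simp: sup_norm_def intro: cSUP_upper)
      also have "\<dots> \<le> norm (sup_norm K (u \<epsilon>))" by simp
      also have "\<dots> \<le> c * \<epsilon> ^ Suc m" using b \<epsilon> by simp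
      also have "\<dots> \<le> \<epsilon> ^ m" using b by (rule conjunct2)
      finally show "norm (u \<epsilon> q) \<le> \<epsilon> ^ m" .
    qed
  qed
  ultimately show ?thesis unfolding null_at_def by blast
qed

lemma negligible_if_null:
  assumes \<Omega>: "openin X \<Omega>" and u: "u \<in> moderate_nets X A \<Omega>" and null: "\<And>p. p \<in> \<Omega> \<Longrightarrow> null_at p u"
  shows "u \<in> negligible_nets X A \<Omega>"
proof -
  have "(\<lambda>\<epsilon>. sup_norm K (u \<epsilon>)) \<in> O[at_right 0](\<lambda>\<epsilon>. \<epsilon> ^ m)"
    if K: "compactin X K" "K \<subseteq> \<Omega>" for K m
  proof (rule landau_o.bigI[of 1])
    have "\<forall>\<^sub>F \<epsilon> in at_right 0. \<forall>q\<in>K. norm (u \<epsilon> q) \<le> \<epsilon> ^ m"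
      by (rule null_on_compact[OF K(1)]) (use null K(2) in blast)
    then show "\<forall>\<^sub>F \<epsilon> in at_right 0. norm (sup_norm K (u \<epsilon>)) \<le> 1 * norm (\<epsilon> ^ m)"
    proof (rule eventually_at_right_mono_unit)
      fix \<epsilon> :: real
      assume \<epsilon>: "0 < \<epsilon>" and b: "\<forall>q\<in>K. norm (u \<epsilon> q) \<le> \<epsilon> ^ m"
      show "norm (sup_norm K (u \<epsilon>)) \<le> 1 * norm (\<epsilon> ^ m)"
      proof (cases "K = {}")
        case False
        then obtain q where q: "q \<in> K" by blast
        have bdd: "bdd_above ((\<lambda>p. norm (u \<epsilon> p)) ` K)" using b by (intro bdd_aboveI2) blast
        have "0 \<le> sup_norm K (u \<epsilon>)"
          using cSUP_upper2[OF bdd q norm_ge_zero] False by (simp add: sup_norm_def)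
        moreover have "sup_norm K (u \<epsilon>) \<le> \<epsilon> ^ m"
          unfolding sup_norm_def using False b by (auto intro!: cSUP_least)
        ultimately show ?thesis using \<epsilon> by simp
      qed (use \<epsilon> in \<open>simp add: sup_norm_def\<close>)
    qed
  qed simp
  then show ?thesis unfolding negligible_nets_def using u by simp
qed

text \<open>Both conditions depend only on arbitrarily small neighbourhoods of p. Hence
  negligibility passes to open subsets and can be verified point by point, which is what
  restrictions and supports require.\<close>

lemma negligible_iff:
  assumes "openin X \<Omega>"
  shows "u \<in> negligible_nets X A \<Omega> \<longleftrightarrow> (\<forall>p\<in>\<Omega>. tame_at p u \<and> null_at p u)"
proof
  show "\<forall>p\<in>\<Omega>. tame_at p u \<and> null_at p u" if u: "u \<in> negligible_nets X A \<Omega>"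
  proof
    fix p assume p: "p \<in> \<Omega>"
    have "u \<in> moderate_nets X A \<Omega>" using u by (simp add: negligible_nets_def)
    then show "tame_at p u \<and> null_at p u"
      using tame_if_moderate[OF assms _ p] null_at_if_negligible[OF assms u p] by simp
  qed
  show "u \<in> negligible_nets X A \<Omega>" if a: "\<forall>p\<in>\<Omega>. tame_at p u \<and> null_at p u"
    by (rule negligible_if_null[OF assms moderate_if_tame[OF assms]]) (use a in simp_all)
qed

section \<open>Cosets of nets, their restriction and their support\<close>

lemma gen_class_eq:
  "gen_class X A \<Omega> u = (\<lambda>n \<epsilon> p. n \<epsilon> p + u \<epsilon> p) ` negligible_nets X A \<Omega>"
  by (auto simp: gen_class_def a_r_coset_def r_coset_def moderate_ring_def)

lemma carrier_gen_fun: "carrier (gen_fun X A \<Omega>) = gen_class X A \<Omega> ` moderate_nets X A \<Omega>"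
  by (auto simp: gen_fun_def FactRing_def A_RCOSETS_def RCOSETS_def gen_class_def a_r_coset_def moderate_ring_def)

lemma zero_gen_fun: "\<zero>\<^bsub>gen_fun X A \<Omega>\<^esub> = negligible_nets X A \<Omega>"
  by (simp add: gen_fun_def FactRing_def)

lemma negligible_add:
  assumes "openin X \<Omega>" "u \<in> negligible_nets X A \<Omega>" "w \<in> negligible_nets X A \<Omega>"
  shows "(\<lambda>\<epsilon> p. u \<epsilon> p + w \<epsilon> p) \<in> negligible_nets X A \<Omega>"
  using assms(2,3) unfolding negligible_iff[OF assms(1)] by (simp add: tame_at_add null_at_add)

lemma negligible_minus:
  assumes \<Omega>: "openin X \<Omega>" and u: "u \<in> negligible_nets X A \<Omega>"
  shows "(\<lambda>\<epsilon> p. - u \<epsilon> p) \<in> negligible_nets X A \<Omega>"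
  unfolding negligible_iff[OF \<Omega>]
proof
  fix p assume p: "p \<in> \<Omega>"
  then have pX: "p \<in> topspace X" using openin_subset[OF \<Omega>] by blast
  have 1: "tame_at p u" "null_at p u" using u p unfolding negligible_iff[OF \<Omega>] by simp_all
  have "tame_at p (\<lambda>\<epsilon> q. - 1 * u \<epsilon> q)"
    by (intro tame_at_mult tame_at_const pX 1)
  moreover have "null_at p (\<lambda>\<epsilon> q. - u \<epsilon> q)"
    by (rule null_at_dominated[OF 1(2) \<Omega> p]) simp
  ultimately show "tame_at p (\<lambda>\<epsilon> q. - u \<epsilon> q) \<and> null_at p (\<lambda>\<epsilon> q. - u \<epsilon> q)" by simp
qed

lemma negligible_zero: "openin X \<Omega> \<Longrightarrow> (\<lambda>_ _. 0) \<in> negligible_nets X A \<Omega>"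
  using openin_subset[of X \<Omega>] by (auto simp: negligible_iff tame_at_const null_at_zero)

lemma gen_class_self: "openin X \<Omega> \<Longrightarrow> u \<in> gen_class X A \<Omega> u"
  unfolding gen_class_eq by (rule image_eqI[OF _ negligible_zero]) auto

lemma gen_class_negligible:
  fixes u :: "('a, 'k::real_normed_field) net"
  assumes \<Omega>: "openin X \<Omega>" and u: "u \<in> negligible_nets X A \<Omega>"
  shows "gen_class X A \<Omega> u = negligible_nets X A \<Omega>"
proof
  show "gen_class X A \<Omega> u \<subseteq> negligible_nets X A \<Omega>"
    unfolding gen_class_eq using negligible_add[OF \<Omega> _ u] by (rule image_subsetI)
  show "negligible_nets X A \<Omega> \<subseteq> gen_class X A \<Omega> u"
  proof
    fix w :: "('a, 'k) net" assume w: "w \<in> negligible_nets X A \<Omega>"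
    show "w \<in> gen_class X A \<Omega> u" unfolding gen_class_eq
      by (rule image_eqI[OF _ negligible_add[OF \<Omega> w negligible_minus[OF \<Omega> u]]]) simp
  qed
qed

text \<open>From left to right: u lies in its own coset over either set, hence in the union that
  forms the restriction. Conversely all representatives are negligible over V, so the cosets in the
  union coincide, and the union is over a nonempty set.\<close>

lemma gen_restrict_eq_zero_iff:
  assumes \<Omega>: "openin X \<Omega>" and V: "openin X V" "V \<subseteq> \<Omega>"
  shows "gen_restrict X A V (gen_class X A \<Omega> u) = \<zero>\<^bsub>gen_fun X A V\<^esub> \<longleftrightarrow> u \<in> negligible_nets X A V"
  unfolding zero_gen_fun
proof
  assume "gen_restrict X A V (gen_class X A \<Omega> u) = negligible_nets X A V"
  then show "u \<in> negligible_nets X A V"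
    using gen_class_self[OF \<Omega>, of u] gen_class_self[OF V(1), of u] unfolding gen_restrict_def by blast
next
  assume u: "u \<in> negligible_nets X A V"
  have "w \<in> negligible_nets X A V" if "w \<in> gen_class X A \<Omega> u" for w
  proof -
    from that obtain n where w: "w = (\<lambda>\<epsilon> p. n \<epsilon> p + u \<epsilon> p)" and n: "n \<in> negligible_nets X A \<Omega>"
      unfolding gen_class_eq by (rule imageE)
    have "n \<in> negligible_nets X A V"
      using n V(2) unfolding negligible_iff[OF \<Omega>] negligible_iff[OF V(1)] by blast
    then show ?thesis unfolding w using u by (rule negligible_add[OF V(1)])
  qed
  then have "gen_class X A V w = negligible_nets X A V" if "w \<in> gen_class X A \<Omega> u" for w
    using gen_class_negligible[OF V(1)] that by blast
  then show "gen_restrict X A V (gen_class X A \<Omega> u) = negligible_nets X A V"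
    unfolding gen_restrict_def using gen_class_self[OF \<Omega>, of u] by blast
qed

text \<open>Moderateness is inherited by open subsets, so whether the class vanishes near p is
  decided by \<open>null_at\<close> alone. This turns suppleness into a statement about
  representatives.\<close>

lemma sheaf_supp_gen_class:
  fixes u :: "('a, 'k::real_normed_field) net"
  assumes \<Omega>: "openin X \<Omega>" and u: "u \<in> moderate_nets X A \<Omega>"
  shows "sheaf_supp X (gen_fun X A) (gen_restrict X A) \<Omega> (gen_class X A \<Omega> u) = {p \<in> \<Omega>. \<not> null_at p u}"
proof -
  have "p \<in> \<Union>{V. openin X V \<and> V \<subseteq> \<Omega> \<and> gen_restrict X A V (gen_class X A \<Omega> u) = \<zero>\<^bsub>gen_fun X A V\<^esub>} \<longleftrightarrow> null_at p u"
    if p: "p \<in> \<Omega>" for p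
  proof
    assume "p \<in> \<Union>{V. openin X V \<and> V \<subseteq> \<Omega> \<and> gen_restrict X A V (gen_class X A \<Omega> u) = \<zero>\<^bsub>gen_fun X A V\<^esub>}"
    then obtain V where V: "openin X V" "V \<subseteq> \<Omega>" "p \<in> V"
      and z: "gen_restrict X A V (gen_class X A \<Omega> u) = \<zero>\<^bsub>gen_fun X A V\<^esub>" by blast
    have "u \<in> negligible_nets X A V" using iffD1[OF gen_restrict_eq_zero_iff[OF \<Omega> V(1,2)] z] .
    then show "null_at p u" by (rule null_at_if_negligible[OF V(1) _ V(3)])
  next
    assume "null_at p u"
    then obtain G where G: "openin X G" "p \<in> G" "\<forall>m::nat. \<forall>\<^sub>F \<epsilon> in at_right 0. \<forall>q\<in>G. norm (u \<epsilon> q) \<le> \<epsilon> ^ m"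
      unfolding null_at_def by blast
    have V: "openin X (G \<inter> \<Omega>)" using G(1) \<Omega> by (rule openin_Int)
    have "null_at q u" if "q \<in> G" for q using G that unfolding null_at_def by blast
    then have "u \<in> negligible_nets X A (G \<inter> \<Omega>)"
      using u unfolding negligible_iff[OF V] moderate_iff_tame[OF \<Omega>] by blast
    then have "gen_restrict X A (G \<inter> \<Omega>) (gen_class X A \<Omega> u) = \<zero>\<^bsub>gen_fun X A (G \<inter> \<Omega>)\<^esub>"
      by (rule iffD2[OF gen_restrict_eq_zero_iff[OF \<Omega> V Int_lower2]])
    with V G(2) p show "p \<in> \<Union>{V. openin X V \<and> V \<subseteq> \<Omega> \<and> gen_restrict X A V (gen_class X A \<Omega> u) = \<zero>\<^bsub>gen_fun X A V\<^esub>}"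
      by blast
  qed
  then show ?thesis unfolding sheaf_supp_def by blast
qed

lemma gen_class_add:
  assumes \<Omega>: "openin X \<Omega>"
  shows "gen_class X A \<Omega> u \<oplus>\<^bsub>gen_fun X A \<Omega>\<^esub> gen_class X A \<Omega> w = gen_class X A \<Omega> (\<lambda>\<epsilon> p. u \<epsilon> p + w \<epsilon> p)"
proof -
  have "gen_class X A \<Omega> u \<oplus>\<^bsub>gen_fun X A \<Omega>\<^esub> gen_class X A \<Omega> w =
      (\<Union>a\<in>gen_class X A \<Omega> u. \<Union>b\<in>gen_class X A \<Omega> w. {\<lambda>\<epsilon> p. a \<epsilon> p + b \<epsilon> p})"
    by (simp add: gen_fun_def FactRing_def set_add_def set_mult_def moderate_ring_def)
  also have "\<dots> = gen_class X A \<Omega> (\<lambda>\<epsilon> p. u \<epsilon> p + w \<epsilon> p)"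
  proof (intro equalityI subsetI)
    fix f assume "f \<in> (\<Union>a\<in>gen_class X A \<Omega> u. \<Union>b\<in>gen_class X A \<Omega> w. {\<lambda>\<epsilon> p. a \<epsilon> p + b \<epsilon> p})"
    then obtain m n where mn: "m \<in> negligible_nets X A \<Omega>" "n \<in> negligible_nets X A \<Omega>"
      and f: "f = (\<lambda>\<epsilon> p. (m \<epsilon> p + u \<epsilon> p) + (n \<epsilon> p + w \<epsilon> p))"
      unfolding gen_class_eq by blast
    show "f \<in> gen_class X A \<Omega> (\<lambda>\<epsilon> p. u \<epsilon> p + w \<epsilon> p)"
      unfolding gen_class_eq f by (rule image_eqI[OF _ negligible_add[OF \<Omega> mn]]) (simp add: algebra_simps)
  next
    fix f assume "f \<in> gen_class X A \<Omega> (\<lambda>\<epsilon> p. u \<epsilon> p + w \<epsilon> p)"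
    then obtain n where n: "n \<in> negligible_nets X A \<Omega>" and f: "f = (\<lambda>\<epsilon> p. n \<epsilon> p + (u \<epsilon> p + w \<epsilon> p))"
      unfolding gen_class_eq by blast
    \<comment> \<open>The negligible part is assigned entirely to the first summand.\<close>
    have "(\<lambda>\<epsilon> p. n \<epsilon> p + u \<epsilon> p) \<in> gen_class X A \<Omega> u" unfolding gen_class_eq using n by blast
    moreover have "w \<in> gen_class X A \<Omega> w" by (rule gen_class_self[OF \<Omega>])
    moreover have "f = (\<lambda>\<epsilon> p. (n \<epsilon> p + u \<epsilon> p) + w \<epsilon> p)" by (simp add: f add.assoc)
    ultimately show "f \<in> (\<Union>a\<in>gen_class X A \<Omega> u. \<Union>b\<in>gen_class X A \<Omega> w. {\<lambda>\<epsilon> p. a \<epsilon> p + b \<epsilon> p})" by blast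
  qed
  finally show ?thesis .
qed

end

section \<open>Cutoffs on a shrinking scale\<close>

text \<open>For small \<epsilon>, \<open>\<nu> \<epsilon>\<close> is the largest n \<le>
  1/\<epsilon> with \<open>P n \<epsilon>\<close>. The bound 1/\<epsilon> keeps the set of
  candidates finite, and each fixed n is a candidate for small \<epsilon>, so \<open>\<nu>\<close>
  tends to infinity. The maximum is itself a candidate, so P holds at it however P varies with
  n.\<close>

lemma diagonal_scale:
  fixes P :: "nat \<Rightarrow> real \<Rightarrow> bool"
  assumes "\<And>n. \<forall>\<^sub>F \<epsilon> in at_right 0. P n \<epsilon>"
  obtains \<nu> :: "real \<Rightarrow> nat" where "\<And>n. \<forall>\<^sub>F \<epsilon> in at_right 0. n \<le> \<nu> \<epsilon>" "\<forall>\<^sub>F \<epsilon> in at_right 0. P (\<nu> \<epsilon>) \<epsilon>"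
proof
  define E where "E \<epsilon> = {n. real n \<le> 1 / \<epsilon> \<and> P n \<epsilon>}" for \<epsilon>
  have fin: "finite (E \<epsilon>)" for \<epsilon>
  proof (rule finite_subset)
    show "E \<epsilon> \<subseteq> {..nat \<lceil>1 / \<epsilon>\<rceil>}" by (auto simp: E_def) linarith
  qed simp
  have mem: "\<forall>\<^sub>F \<epsilon> in at_right 0. n \<in> E \<epsilon>" for n
  proof -
    have "filterlim (\<lambda>\<epsilon>::real. inverse \<epsilon>) at_top (at_right 0)" by (rule filterlim_inverse_at_top_right)
    then have "\<forall>\<^sub>F \<epsilon> in at_right 0. real n \<le> inverse \<epsilon>" by (auto simp: filterlim_at_top)
    with assms[of n] show ?thesis by eventually_elim (simp add: E_def inverse_eq_divide)
  qed
  show "\<forall>\<^sub>F \<epsilon> in at_right 0. n \<le> Max (E \<epsilon>)" for n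
    using mem[of n] by eventually_elim (simp add: fin)
  show "\<forall>\<^sub>F \<epsilon> in at_right 0. P (Max (E \<epsilon>)) \<epsilon>"
    using mem[of 0]
  proof eventually_elim
    case (elim \<epsilon>)
    then have "Max (E \<epsilon>) \<in> E \<epsilon>" using fin by (intro Max_in) auto
    then show ?case by (simp add: E_def)
  qed
qed

context hausdorff_manifold
begin

text \<open>The cutoffs \<open>\<beta> \<epsilon>\<close> vanish near \<open>Z\<^sub>1\<close> and equal 1 away from it, on a scale that shrinks with
  \<open>\<epsilon>\<close>, but so slowly that their derivatives are at most \<open>1 / \<epsilon>\<close> and that \<open>u\<close> is already small
  where \<open>\<beta> \<epsilon>\<close> does not vanish, except near \<open>Z\<^sub>2\<close>.\<close>

lemma local_cutoff:
  fixes u :: "('a, 'k::real_normed_field) net"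
  assumes chart: "(W, \<phi>) \<in> A" and \<Omega>: "openin X \<Omega>"
    and V: "openin X V" "V \<subseteq> L" and L: "compactin X L" "L \<subseteq> W \<inter> \<Omega>"
    and Z: "closedin X Z\<^sub>1" "closedin X Z\<^sub>2" and null: "\<And>p. p \<in> \<Omega> - (Z\<^sub>1 \<union> Z\<^sub>2) \<Longrightarrow> null_at p u"
    and D: "openin X D" "Z\<^sub>1 \<inter> L \<subseteq> D"
  obtains \<beta> :: "('a, 'k) net" where "\<And>p. p \<in> topspace X \<Longrightarrow> tame_at p \<beta>"
    "\<And>\<epsilon> p. norm (\<beta> \<epsilon> p) \<le> 1" "\<And>\<epsilon> p. p \<notin> D \<Longrightarrow> \<beta> \<epsilon> p = 1"
    "\<And>p. p \<in> topspace X - Z\<^sub>1 \<Longrightarrow> \<exists>G. openin X G \<and> p \<in> G \<and> (\<forall>\<^sub>F \<epsilon> in at_right 0. \<forall>q\<in>G. \<beta> \<epsilon> q = 1)"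
    "\<And>p. p \<in> V - Z\<^sub>2 \<Longrightarrow> null_at p (\<lambda>\<epsilon> q. \<beta> \<epsilon> q * u \<epsilon> q)"
proof (cases "Z\<^sub>1 \<inter> L = {}")
  \<comment> \<open>With no point of \<open>Z\<^sub>1\<close> in L there is nothing to cut off. The
    case is separate because \<open>infdist\<close> to the empty set is 0 by convention.\<close>
  case True
  show thesis
  proof (rule that[of "\<lambda>_ _. 1"])
    show "\<exists>G. openin X G \<and> p \<in> G \<and> (\<forall>\<^sub>F \<epsilon> in at_right 0. \<forall>q\<in>G. (1::'k) = 1)" if "p \<in> topspace X - Z\<^sub>1" for p
      using that by (intro exI[of _ "topspace X"]) simp
    show "null_at p (\<lambda>\<epsilon> q. 1 * u \<epsilon> q)" if "p \<in> V - Z\<^sub>2" for p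
      using null[of p] that True V(2) L(2) by auto
  qed (simp_all add: tame_at_const)
next
  case False
  note inv = chart_inv[OF chart]
  have inj: "p = q" if "p \<in> W" "q \<in> W" "\<phi> p = \<phi> q" for p q
    using inj_onD[OF inj_on_chart[OF chart] that(3,1,2)] .
  define C where "C = \<phi> ` (Z\<^sub>1 \<inter> L)"
  have compact_Int: "compact (\<phi> ` (F \<inter> L))" if "closedin X F" for F
    by (rule compact_chart_image[OF chart closed_Int_compactin[OF that L(1)]]) (use L(2) in blast)
  have C: "compact C" "C \<noteq> {}" using compact_Int[OF Z(1)] False by (auto simp: C_def)
  define S where "S = \<phi> ` (W \<inter> (\<Omega> \<inter> D))"
  have S: "open S" unfolding S_def using \<Omega> D(1) by (intro open_chart_image_Int[OF chart] openin_Int)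
  have "C \<subseteq> S" using L(2) D(2) by (auto simp: C_def S_def)
  then obtain r0 where r0: "0 < r0" "{x. infdist x C \<le> r0} \<subseteq> S"
    using compact_in_open_separated[OF C(2,1) S] by blast
  define K where "K = {x. infdist x C \<le> r0}"
  have K: "compact K" unfolding K_def by (rule compact_infdist_le[OF C(2,1) r0(1)])
  \<comment> \<open>The summand 2 gives \<open>r n \<le> r0 / 2\<close> already for n = 0. Every
    \<open>b n\<close> is thus 1 at distance at least r0/2 from C, which leaves a margin up to r0
    where both descriptions of \<open>\<beta>\<close>, by the chart and by the constant 1, are
    valid.\<close>
  define r where "r n = r0 / real (n + 2)" for n
  have r: "0 < r n" "r n \<le> r0 / 2" for n using r0(1) by (simp_all add: r_def field_simps)
  have r_mono: "r n \<le> r m" if "m \<le> n" for m n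
    using r0(1) that by (auto simp: r_def intro!: divide_left_mono)
  have r_lim: "\<exists>n. r n \<le> d" if "0 < d" for d
  proof -
    obtain n where "r0 / d < real n" using reals_Archimedean2 by blast
    then show ?thesis using that r0(1) by (intro exI[of _ n]) (simp add: r_def field_simps)
  qed
  have "\<exists>b N. smooth_on UNIV (b :: 'e \<Rightarrow> 'k) \<and> (\<forall>x. norm (b x) \<le> 1) \<and> open N \<and> C \<subseteq> N \<and>
      (\<forall>x\<in>N. b x = 0) \<and> (\<forall>x. (\<forall>c\<in>C. r n \<le> dist c x) \<longrightarrow> b x = 1)" for n
  proof -
    obtain b :: "'e \<Rightarrow> 'k" and N where "smooth_on UNIV b" "\<And>x. norm (b x) \<le> 1" "open N" "C \<subseteq> N"
      "\<And>x. x \<in> N \<Longrightarrow> b x = 0" "\<And>x. \<forall>c\<in>C. r n \<le> dist c x \<Longrightarrow> b x = 1"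
      by (rule smooth_cutoff[OF C(1) r(1)[of n]]) (rule that)
    then show ?thesis by (intro exI[of _ b] exI[of _ N]) simp
  qed
  then obtain b :: "nat \<Rightarrow> 'e \<Rightarrow> 'k" and N where
    "\<forall>n. smooth_on UNIV (b n) \<and> (\<forall>x. norm (b n x) \<le> 1) \<and> open (N n) \<and> C \<subseteq> N n \<and>
      (\<forall>x\<in>N n. b n x = 0) \<and> (\<forall>x. (\<forall>c\<in>C. r n \<le> dist c x) \<longrightarrow> b n x = 1)"
    by metis
  then have b: "\<And>n. smooth_on UNIV (b n)" "\<And>n x. norm (b n x) \<le> 1" "\<And>n. open (N n)" "\<And>n. C \<subseteq> N n"
      "\<And>n x. x \<in> N n \<Longrightarrow> b n x = 0" and b1: "\<And>n x. \<forall>c\<in>C. r n \<le> dist c x \<Longrightarrow> b n x = 1"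
    by blast+
  have b1': "b n x = 1" if "r n \<le> infdist x C" for n x
    by (rule b1) (use that infdist_le[of _ C x] in \<open>auto simp: dist_commute intro: order_trans\<close>)
  \<comment> \<open>Smallness of u is wanted where \<open>b n\<close> may be nonzero. Removing the
    open set \<open>N n\<close>, on which \<open>b n\<close> is 0, and the
    \<open>r n\<close>-neighbourhood of \<open>Z\<^sub>2\<close> leaves a compact set off both
    closed sets; the set where \<open>b n\<close> is nonzero need not be closed.\<close>
  define M where "M n = {p \<in> L. \<phi> p \<notin> N n \<and> (\<forall>z\<in>Z\<^sub>2 \<inter> L. r n \<le> dist (\<phi> z) (\<phi> p))}" for n
  have evM: "\<forall>\<^sub>F \<epsilon> in at_right 0. \<forall>q\<in>M n. norm (u \<epsilon> q) \<le> \<epsilon> ^ n" for n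
  proof (rule null_on_compact)
    let ?K = "\<phi> ` L \<inter> (- N n) \<inter> (\<Inter>z\<in>Z\<^sub>2 \<inter> L. {x. r n \<le> dist (\<phi> z) x})"
    have "compact (\<phi> ` L)" by (rule compact_chart_image[OF chart L(1)]) (use L(2) in blast)
    moreover have "closed {x. r n \<le> dist (\<phi> z) x}" for z
      by (intro closed_Collect_le continuous_intros)
    ultimately have "compact ?K"
      using b(3)[of n] by (intro compact_Int_closed closed_INT) (auto simp: closed_Compl)
    moreover have "M n = {p \<in> W. \<phi> p \<in> ?K}"
      using L(2) inj by (auto simp: M_def)
    ultimately show "compactin X (M n)"
      using compactin_chart_vimage[OF chart, of ?K] L(2) by auto
    show "null_at p u" if "p \<in> M n" for p
    proof (rule null)
      have p: "p \<in> L" "\<phi> p \<notin> N n" "\<forall>z\<in>Z\<^sub>2 \<inter> L. r n \<le> dist (\<phi> z) (\<phi> p)" using that by (auto simp: M_def)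
      have "p \<notin> Z\<^sub>1" using p b(4)[of n] by (auto simp: C_def)
      moreover have "p \<notin> Z\<^sub>2" using p(1,3) r(1)[of n] by force
      ultimately show "p \<in> \<Omega> - (Z\<^sub>1 \<union> Z\<^sub>2)" using p(1) L(2) by blast
    qed
  qed
  \<comment> \<open>For fixed n only finitely many words are involved, and each derivative is
    bounded on the compact set K; hence 1/\<epsilon> eventually dominates them all.\<close>
  have evD: "\<forall>\<^sub>F \<epsilon> in at_right 0. \<forall>vs\<in>{vs. set vs \<subseteq> onb \<and> length vs \<le> n}. \<forall>x\<in>K. norm (iter_deriv vs (b n) x) \<le> 1 / \<epsilon>" for n
  proof (rule eventually_ball_finite)
    show "finite {vs :: 'e list. set vs \<subseteq> onb \<and> length vs \<le> n}"
      by (rule finite_lists_length_le[OF finite_onb])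
    show "\<forall>vs\<in>{vs. set vs \<subseteq> onb \<and> length vs \<le> n}. \<forall>\<^sub>F \<epsilon> in at_right 0. \<forall>x\<in>K. norm (iter_deriv vs (b n) x) \<le> 1 / \<epsilon>"
    proof
      fix vs :: "'e list"
      have "continuous_on K (iter_deriv vs (b n))"
        by (rule continuous_on_subset[OF smooth_on_continuous[OF smooth_on_iter_deriv[OF b(1)]] subset_UNIV])
      then have "bounded (iter_deriv vs (b n) ` K)" using K by (intro compact_imp_bounded compact_continuous_image)
      then obtain c where c: "\<forall>x\<in>K. norm (iter_deriv vs (b n) x) \<le> c" by (auto simp: bounded_iff)
      have "filterlim (\<lambda>\<epsilon>::real. inverse \<epsilon>) at_top (at_right 0)" by (rule filterlim_inverse_at_top_right)
      then have "\<forall>\<^sub>F \<epsilon> in at_right 0. c \<le> inverse \<epsilon>" by (auto simp: filterlim_at_top)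
      then show "\<forall>\<^sub>F \<epsilon> in at_right 0. \<forall>x\<in>K. norm (iter_deriv vs (b n) x) \<le> 1 / \<epsilon>"
        by eventually_elim (use c in \<open>force simp: inverse_eq_divide\<close>)
    qed
  qed
  obtain \<nu> :: "real \<Rightarrow> nat" where \<nu>: "\<And>n. \<forall>\<^sub>F \<epsilon> in at_right 0. n \<le> \<nu> \<epsilon>"
    and \<nu>P: "\<forall>\<^sub>F \<epsilon> in at_right 0. (\<forall>q\<in>M (\<nu> \<epsilon>). norm (u \<epsilon> q) \<le> \<epsilon> ^ \<nu> \<epsilon>) \<and>
      (\<forall>vs\<in>{vs. set vs \<subseteq> onb \<and> length vs \<le> \<nu> \<epsilon>}. \<forall>x\<in>K. norm (iter_deriv vs (b (\<nu> \<epsilon>)) x) \<le> 1 / \<epsilon>)"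
    by (rule diagonal_scale[OF eventually_conj[OF evM evD]]) (rule that)
  have \<nu>r: "\<forall>\<^sub>F \<epsilon> in at_right 0. r (\<nu> \<epsilon>) \<le> d" if d: "0 < d" for d
  proof -
    obtain n where n: "r n \<le> d" using r_lim[OF d] by blast
    from \<nu>[of n] show ?thesis by eventually_elim (use n r_mono order_trans in blast)
  qed
  define T where "T = {x. infdist x C < r0}"
  have T: "open T" unfolding T_def by (intro open_Collect_less continuous_intros)
  have tameT: "tame k T (\<lambda>\<epsilon>. b (\<nu> \<epsilon>))" for k
  proof (rule tame_if_iter_deriv_onb[OF T])
    show "smooth_on T (b (\<nu> \<epsilon>))" for \<epsilon>
      by (rule smooth_on_subset[OF open_UNIV T b(1) subset_UNIV])
    \<comment> \<open>A fixed word has length at most \<open>\<nu> \<epsilon>\<close> for small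
      \<epsilon>, so the diagonal choice bounds its derivative by 1/\<epsilon>.\<close>
    show "loc_bdd (\<lambda>\<epsilon>. iter_deriv vs (b (\<nu> \<epsilon>))) x" if vs: "set vs \<subseteq> onb" and x: "x \<in> T" for vs x
    proof -
      have "\<forall>\<^sub>F \<epsilon> in at_right 0. \<forall>y\<in>T. norm (iter_deriv vs (b (\<nu> \<epsilon>)) y) \<le> 1 * (1 / \<epsilon>) ^ 1"
        using \<nu>[of "length vs"] \<nu>P
        by eventually_elim (use vs in \<open>simp add: T_def K_def\<close>)
      then show ?thesis unfolding loc_bdd_def using T x by blast
    qed
  qed
  define \<beta> where "\<beta> \<epsilon> p = (if p \<in> W then b (\<nu> \<epsilon>) (\<phi> p) else 1)" for \<epsilon> p
  \<comment> \<open>Off Q, which is closed in X, every \<open>\<beta> \<epsilon>\<close> is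
    constantly 1. At points of Q the chart formula applies on the neighbourhood T, as r0/2 < r0. The
    two descriptions together give tameness on all of X.\<close>
  define Q where "Q = {p \<in> W. \<phi> p \<in> {x. infdist x C \<le> r0 / 2}}"
  have "{x. infdist x C \<le> r0 / 2} \<subseteq> {x. infdist x C \<le> r0}" using r0(1) by (intro Collect_mono) simp
  then have QS: "{x. infdist x C \<le> r0 / 2} \<subseteq> S" using r0(2) by (rule order_trans)
  moreover have "S \<subseteq> \<phi> ` W" unfolding S_def by blast
  ultimately have "{x. infdist x C \<le> r0 / 2} \<subseteq> \<phi> ` W" by (rule order_trans)
  then have Q: "closedin X Q" unfolding Q_def
    by (intro closedin_chart_vimage[OF chart] compact_infdist_le C) (use r0(1) in simp_all)
  have oQ: "openin X (topspace X - Q)" using Q by (rule openin_diff[OF openin_topspace])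
  have Q1: "\<beta> \<epsilon> p = 1" if "p \<notin> Q" for \<epsilon> p
  proof (cases "p \<in> W")
    case True
    then have "r (\<nu> \<epsilon>) \<le> infdist (\<phi> p) C" using that r(2)[of "\<nu> \<epsilon>"] by (auto simp: Q_def)
    then show ?thesis by (simp add: \<beta>_def b1')
  qed (simp add: \<beta>_def)
  show thesis
  proof (rule that[of \<beta>])
    show "tame_at p \<beta>" if p: "p \<in> topspace X" for p
    proof (cases "p \<in> Q")
      case True
      then have pW: "p \<in> W" "\<phi> p \<in> T" using r0(1) by (auto simp: Q_def T_def)
      have o: "open (T \<inter> \<phi> ` W)" using T open_chart_image[OF chart] by (rule open_Int)
      show ?thesis
      proof (rule tame_atI[OF chart pW(1) o])
        show "tame k (T \<inter> \<phi> ` W) (\<lambda>\<epsilon> x. \<beta> \<epsilon> (inv_into W \<phi> x))" for k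
          by (rule tame_cong[OF tame_subset[OF tameT Int_lower1] o]) (auto simp: \<beta>_def inv)
      qed (use pW in blast)
    next
      case False
      show ?thesis
        by (rule tame_at_cong[OF tame_at_const[OF p, of 1] oQ]) (use p False Q1 in auto)
    qed
    show "norm (\<beta> \<epsilon> p) \<le> 1" for \<epsilon> p by (simp add: \<beta>_def b(2))
    show "\<beta> \<epsilon> p = 1" if "p \<notin> D" for \<epsilon> p
    proof (rule Q1, rule notI)
      assume "p \<in> Q"
      then have p: "p \<in> W" "\<phi> p \<in> S" using QS by (simp_all add: Q_def subset_iff)
      then obtain q where "q \<in> W" "q \<in> D" "\<phi> p = \<phi> q" by (auto simp: S_def)
      then show False using inj p(1) that by metis
    qed
    show "\<exists>G. openin X G \<and> p \<in> G \<and> (\<forall>\<^sub>F \<epsilon> in at_right 0. \<forall>q\<in>G. \<beta> \<epsilon> q = 1)"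
      if p: "p \<in> topspace X - Z\<^sub>1" for p
    proof (cases "p \<in> Q")
      case False
      then show ?thesis using oQ p Q1 by (intro exI[of _ "topspace X - Q"]) simp
    next
      case True
      then have pW: "p \<in> W" by (simp add: Q_def)
      have "\<phi> p \<notin> C"
      proof
        assume "\<phi> p \<in> C"
        then obtain q where "q \<in> Z\<^sub>1" "q \<in> L" "\<phi> p = \<phi> q" by (auto simp: C_def)
        then show False using inj[OF pW, of q] L(2) p by blast
      qed
      \<comment> \<open>Points near p keep more than half its distance from C; once the scale is
        below that half, \<open>\<beta> \<epsilon>\<close> is 1 on this whole neighbourhood.\<close>
      then have d: "0 < infdist (\<phi> p) C / 2"
        using infdist_pos_not_in_closed[OF compact_imp_closed[OF C(1)] C(2)] by simp
      let ?G = "{q \<in> W. \<phi> q \<in> {x. infdist (\<phi> p) C / 2 < infdist x C}}"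
      have "open {x. infdist (\<phi> p) C / 2 < infdist x C}" by (intro open_Collect_less continuous_intros)
      then have "openin X ?G" by (rule openin_chart_vimage[OF chart])
      moreover have "p \<in> ?G" using pW d by simp
      moreover have "\<forall>\<^sub>F \<epsilon> in at_right 0. \<forall>q\<in>?G. \<beta> \<epsilon> q = 1"
        using \<nu>r[OF d] by eventually_elim (auto simp: \<beta>_def intro: b1')
      ultimately show ?thesis by blast
    qed
    show "null_at p (\<lambda>\<epsilon> q. \<beta> \<epsilon> q * u \<epsilon> q)" if p: "p \<in> V - Z\<^sub>2" for p
    proof -
      have pL: "p \<in> L" "p \<in> W" using p V(2) L(2) by blast+
      have "\<phi> p \<notin> \<phi> ` (Z\<^sub>2 \<inter> L)" using inj[OF pL(2)] p L(2) by blast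
      moreover have "open (- \<phi> ` (Z\<^sub>2 \<inter> L))" using compact_imp_closed[OF compact_Int[OF Z(2)]] by (rule open_Compl)
      ultimately obtain d where d: "0 < d" "ball (\<phi> p) d \<subseteq> - \<phi> ` (Z\<^sub>2 \<inter> L)"
        by (meson ComplI open_contains_ball)
      \<comment> \<open>Once the scale is below d/2, a point q of V with coordinates in this ball
        satisfies the condition on \<open>Z\<^sub>2\<close> in \<open>M (\<nu> \<epsilon>)\<close>.
        So either q lies in \<open>M (\<nu> \<epsilon>)\<close>, where u is small, or
        \<open>\<phi> q\<close> lies in \<open>N (\<nu> \<epsilon>)\<close>, where the cutoff is
        0.\<close>
      have dZ: "d / 2 \<le> dist (\<phi> z) (\<phi> q)" if "z \<in> Z\<^sub>2 \<inter> L" "\<phi> q \<in> ball (\<phi> p) (d / 2)" for z q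
      proof -
        have "\<phi> z \<notin> ball (\<phi> p) d" using d(2) that(1) by blast
        then show ?thesis using that(2) dist_triangle[of "\<phi> p" "\<phi> z" "\<phi> q"] by (simp add: dist_commute)
      qed
      let ?G = "V \<inter> {q \<in> W. \<phi> q \<in> ball (\<phi> p) (d / 2)}"
      have "openin X ?G" using V(1) openin_chart_vimage[OF chart open_ball] by (rule openin_Int)
      moreover have "p \<in> ?G" using p pL d(1) by simp
      moreover have "\<forall>\<^sub>F \<epsilon> in at_right 0. \<forall>q\<in>?G. norm (\<beta> \<epsilon> q * u \<epsilon> q) \<le> \<epsilon> ^ m" for m
        using \<nu>P \<nu>[of m] \<nu>r[OF half_gt_zero[OF d(1)]] eventually_at_right_unit
      proof eventually_elim
        case (elim \<epsilon>)
        have em: "\<epsilon> ^ \<nu> \<epsilon> \<le> \<epsilon> ^ m" using elim(2,4) by (intro power_decreasing) auto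
        show ?case
        proof
          fix q assume q: "q \<in> ?G"
          show "norm (\<beta> \<epsilon> q * u \<epsilon> q) \<le> \<epsilon> ^ m"
          proof (cases "\<phi> q \<in> N (\<nu> \<epsilon>)")
            case True
            then show ?thesis using q b(5) elim(4) by (simp add: \<beta>_def)
          next
            case False
            have "r (\<nu> \<epsilon>) \<le> dist (\<phi> z) (\<phi> q)" if "z \<in> Z\<^sub>2 \<inter> L" for z
              using dZ[OF that, of q] q elim(3) by simp
            then have "q \<in> M (\<nu> \<epsilon>)" using q False V(2) by (auto simp: M_def)
            then have "norm (u \<epsilon> q) \<le> \<epsilon> ^ m" using elim(1) em order_trans by blast
            moreover have "norm (\<beta> \<epsilon> q) \<le> 1" using b(2) by (simp add: \<beta>_def)
            ultimately show ?thesis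
              using mult_mono[of "norm (\<beta> \<epsilon> q)" 1 "norm (u \<epsilon> q)" "\<epsilon> ^ m"] by (simp add: norm_mult)
          qed
        qed
      qed
      ultimately show ?thesis unfolding null_at_def by blast
    qed
  qed
qed

section \<open>Gluing the local cutoffs\<close>

lemma compact_chart_nbhd:
  assumes \<Omega>: "openin X \<Omega>" and p: "p \<in> \<Omega>"
  obtains G K W \<phi> where "openin X G" "p \<in> G" "G \<subseteq> K" "compactin X K" "(W, \<phi>) \<in> A" "K \<subseteq> W \<inter> \<Omega>"
proof -
  obtain W \<phi> where W: "(W, \<phi>) \<in> A" "p \<in> W"
    using chart_at[of p] openin_subset[OF \<Omega>] p by blast
  have "open (\<phi> ` (W \<inter> \<Omega>))" by (rule open_chart_image_Int[OF W(1) \<Omega>])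
  moreover have "\<phi> p \<in> \<phi> ` (W \<inter> \<Omega>)" using W p by blast
  ultimately obtain r where r: "0 < r" "cball (\<phi> p) r \<subseteq> \<phi> ` (W \<inter> \<Omega>)" by (meson open_contains_cball)
  show ?thesis
  proof (rule that[of "{q \<in> W. \<phi> q \<in> ball (\<phi> p) r}" "{q \<in> W. \<phi> q \<in> cball (\<phi> p) r}", OF _ _ _ _ W(1)])
    show "openin X {q \<in> W. \<phi> q \<in> ball (\<phi> p) r}" by (rule openin_chart_vimage[OF W(1) open_ball])
    show "compactin X {q \<in> W. \<phi> q \<in> cball (\<phi> p) r}"
      by (rule compactin_chart_vimage[OF W(1) compact_cball]) (use r(2) in blast)
    show "{q \<in> W. \<phi> q \<in> cball (\<phi> p) r} \<subseteq> W \<inter> \<Omega>"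
    proof
      fix q assume "q \<in> {q \<in> W. \<phi> q \<in> cball (\<phi> p) r}"
      then have q: "q \<in> W" "\<phi> q \<in> \<phi> ` (W \<inter> \<Omega>)" using r(2) by (simp_all add: subset_iff)
      then show "q \<in> W \<inter> \<Omega>"
        using inj_on_image_mem_iff[OF inj_on_chart[OF W(1)] q(1) Int_lower1] by blast
    qed
  qed (use W r in auto)
qed

lemma eventually_near_ball_finite:
  assumes "finite F" "p \<in> topspace X"
    and "\<And>V. V \<in> F \<Longrightarrow> \<exists>G. openin X G \<and> p \<in> G \<and> (\<forall>\<^sub>F \<epsilon> in at_right 0. \<forall>q\<in>G. P V \<epsilon> q)"
  shows "\<exists>G. openin X G \<and> p \<in> G \<and> (\<forall>\<^sub>F \<epsilon>::real in at_right 0. \<forall>q\<in>G. \<forall>V\<in>F. P V \<epsilon> q)"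
  using assms(1,3)
proof (induction F rule: finite_induct)
  case empty
  then show ?case using assms(2) by (intro exI[of _ "topspace X"]) simp
next
  case (insert V F)
  obtain G where G: "openin X G" "p \<in> G" "\<forall>\<^sub>F \<epsilon> in at_right 0. \<forall>q\<in>G. \<forall>V\<in>F. P V \<epsilon> q"
    using insert.IH insert.prems by blast
  obtain H where H: "openin X H" "p \<in> H" "\<forall>\<^sub>F \<epsilon> in at_right 0. \<forall>q\<in>H. P V \<epsilon> q"
    using insert.prems by blast
  have "\<forall>\<^sub>F \<epsilon> in at_right 0. \<forall>q\<in>G \<inter> H. \<forall>V\<in>insert V F. P V \<epsilon> q"
    using G(3) H(3) by eventually_elim simp
  moreover have "openin X (G \<inter> H)" using G(1) H(1) by (rule openin_Int)
  ultimately show ?case using G(2) H(2) by blast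
qed

text \<open>At a point of \<open>Z\<^sub>1\<close> off \<open>Z\<^sub>2\<close>, the factor of one
  member V containing it already makes the product with u null. Near a point off
  \<open>Z\<^sub>1\<close> only finitely many factors matter, and each is 1 for small
  \<epsilon>.\<close>

lemma global_cutoff:
  fixes u :: "('a, 'k::real_normed_field) net"
  assumes para: "paracompact_space X" and \<Omega>: "openin X \<Omega>"
    and Z: "closedin X Z\<^sub>1" "closedin X Z\<^sub>2" "Z\<^sub>1 \<subseteq> \<Omega>"
    and null: "\<And>p. p \<in> \<Omega> - (Z\<^sub>1 \<union> Z\<^sub>2) \<Longrightarrow> null_at p u"
  obtains \<kappa> :: "('a, 'k) net" where "\<And>p. p \<in> topspace X \<Longrightarrow> tame_at p \<kappa>" "\<And>\<epsilon> p. norm (\<kappa> \<epsilon> p) \<le> 1"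
    "\<And>p. p \<in> topspace X - Z\<^sub>1 \<Longrightarrow> \<exists>G. openin X G \<and> p \<in> G \<and> (\<forall>\<^sub>F \<epsilon> in at_right 0. \<forall>q\<in>G. \<kappa> \<epsilon> q = 1)"
    "\<And>p. p \<in> Z\<^sub>1 - Z\<^sub>2 \<Longrightarrow> null_at p (\<lambda>\<epsilon> q. \<kappa> \<epsilon> q * u \<epsilon> q)"
proof -
  define good where "good G \<longleftrightarrow> (\<exists>K W \<phi>. G \<subseteq> K \<and> compactin X K \<and> (W, \<phi>) \<in> A \<and> K \<subseteq> W \<inter> \<Omega>)" for G
  \<comment> \<open>The good sets cover \<open>Z\<^sub>1\<close>; the complement of
    \<open>Z\<^sub>1\<close> takes care of all remaining points, including those of X outside
    \<open>\<Omega>\<close>.\<close>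
  define \<U> where "\<U> = insert (topspace X - Z\<^sub>1) {G. openin X G \<and> good G}"
  have "\<forall>U\<in>\<U>. openin X U" using openin_diff[OF openin_topspace Z(1)] by (auto simp: \<U>_def)
  moreover have "\<Union>\<U> = topspace X"
  proof
    show "\<Union>\<U> \<subseteq> topspace X" by (auto simp: \<U>_def dest: openin_subset)
    show "topspace X \<subseteq> \<Union>\<U>"
    proof
      fix p assume p: "p \<in> topspace X"
      show "p \<in> \<Union>\<U>"
      proof (cases "p \<in> Z\<^sub>1")
        case True
        then have "p \<in> \<Omega>" using Z(3) by blast
        then obtain G K W \<phi> where "openin X G" "p \<in> G" "G \<subseteq> K" "compactin X K" "(W, \<phi>) \<in> A" "K \<subseteq> W \<inter> \<Omega>"
          by (rule compact_chart_nbhd[OF \<Omega>])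
        then show ?thesis unfolding \<U>_def good_def by blast
      qed (use p in \<open>simp add: \<U>_def\<close>)
    qed
  qed
  ultimately have "\<exists>\<V>. (\<forall>V\<in>\<V>. openin X V) \<and> \<Union>\<V> = topspace X \<and> (\<forall>V\<in>\<V>. \<exists>U\<in>\<U>. V \<subseteq> U) \<and> locally_finite_in X \<V>"
    using para[unfolded paracompact_space_def, THEN spec, of \<U>] by simp
  then obtain \<V> where \<V>: "\<forall>V\<in>\<V>. openin X V" "\<Union>\<V> = topspace X" "\<forall>V\<in>\<V>. \<exists>U\<in>\<U>. V \<subseteq> U" "locally_finite_in X \<V>"
    by blast
  define I where "I = {V \<in> \<V>. good V}"
  have good_mono: "good V" if "good U" "V \<subseteq> U" for U V
    using that unfolding good_def by (meson subset_trans)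
  \<comment> \<open>A member that is not good can only refine the complement of
    \<open>Z\<^sub>1\<close>, so the good members cover \<open>Z\<^sub>1\<close>.\<close>
  have bad: "V \<inter> Z\<^sub>1 = {}" if "V \<in> \<V>" "V \<notin> I" for V
  proof -
    obtain U where U: "U \<in> \<U>" "V \<subseteq> U" using \<V>(3) \<open>V \<in> \<V>\<close> by blast
    moreover have "\<not> good U" using that good_mono[OF _ U(2)] by (auto simp: I_def)
    ultimately show ?thesis by (auto simp: \<U>_def)
  qed
  have openI: "openin X V" if "V \<in> I" for V using that \<V>(1) by (simp add: I_def)
  \<comment> \<open>Replacing each \<open>V\<close> by its star leaves room for a cutoff around \<open>Z\<^sub>1 \<inter> closure V\<close> and preserves local finiteness.\<close>
  define E where "E V = \<Union>{V' \<in> I. V' \<inter> V \<noteq> {}}" for V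
  have finK: "finite {V \<in> \<V>. V \<inter> K \<noteq> {}}" if "compactin X K" for K
  proof (rule compactin_finite_cover_induct[OF that])
    show "\<exists>G. openin X G \<and> p \<in> G \<and> finite {V \<in> \<V>. V \<inter> G \<noteq> {}}" if "p \<in> K" for p
      using \<V>(4) that compactin_subset_topspace[OF \<open>compactin X K\<close>] unfolding locally_finite_in_def by blast
  next
    fix G H assume "finite {V \<in> \<V>. V \<inter> G \<noteq> {}}" "finite {V \<in> \<V>. V \<inter> H \<noteq> {}}"
    then have "finite ({V \<in> \<V>. V \<inter> G \<noteq> {}} \<union> {V \<in> \<V>. V \<inter> H \<noteq> {}})" by simp
    then show "finite {V \<in> \<V>. V \<inter> (G \<union> H) \<noteq> {}}" by (rule rev_finite_subset) blast
  next
    fix G H assume "finite {V \<in> \<V>. V \<inter> G \<noteq> {}}" "H \<subseteq> G"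
    then show "finite {V \<in> \<V>. V \<inter> H \<noteq> {}}" by (elim rev_finite_subset) blast
  qed simp
  have locfin: "\<exists>G. openin X G \<and> p \<in> G \<and> finite {V \<in> I. E V \<inter> G \<noteq> {}}" if "p \<in> topspace X" for p
  proof -
    have "\<exists>G. openin X G \<and> p \<in> G \<and> finite {U \<in> \<V>. U \<inter> G \<noteq> {}}"
      using \<V>(4) that unfolding locally_finite_in_def by blast
    then obtain G where G: "openin X G" "p \<in> G" "finite {U \<in> \<V>. U \<inter> G \<noteq> {}}" by blast
    \<comment> \<open>If \<open>E V\<close> meets G, then V meets some good V' that meets G. There
      are finitely many such V', and each is contained in a compact set, which meets only finitely
      many members.\<close>
    let ?J = "{V' \<in> I. V' \<inter> G \<noteq> {}}"
    have "finite ?J" using G(3) by (rule rev_finite_subset) (auto simp: I_def)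
    moreover have "finite {V \<in> \<V>. V \<inter> V' \<noteq> {}}" if "V' \<in> ?J" for V'
    proof -
      have "good V'" using that by (simp add: I_def)
      then obtain K where "V' \<subseteq> K" "compactin X K" unfolding good_def by blast
      then have "finite {V \<in> \<V>. V \<inter> K \<noteq> {}}" "{V \<in> \<V>. V \<inter> V' \<noteq> {}} \<subseteq> {V \<in> \<V>. V \<inter> K \<noteq> {}}"
        using finK by blast+
      then show ?thesis by (rule finite_subset[rotated])
    qed
    ultimately have "finite (\<Union>V'\<in>?J. {V \<in> \<V>. V \<inter> V' \<noteq> {}})" by (rule finite_UN_I)
    then have "finite {V \<in> I. E V \<inter> G \<noteq> {}}"
      by (rule rev_finite_subset) (auto simp: E_def I_def)
    with G show ?thesis by blast
  qed
  define cut where "cut V \<beta> \<longleftrightarrow> (\<forall>p\<in>topspace X. tame_at p \<beta>) \<and> (\<forall>\<epsilon> p. norm (\<beta> \<epsilon> p) \<le> 1) \<and>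
      (\<forall>\<epsilon> p. p \<notin> E V \<longrightarrow> \<beta> \<epsilon> p = 1) \<and>
      (\<forall>p\<in>topspace X - Z\<^sub>1. \<exists>G. openin X G \<and> p \<in> G \<and> (\<forall>\<^sub>F \<epsilon> in at_right 0. \<forall>q\<in>G. \<beta> \<epsilon> q = 1)) \<and>
      (\<forall>p\<in>V - Z\<^sub>2. null_at p (\<lambda>\<epsilon> q. \<beta> \<epsilon> q * u \<epsilon> q))" for V and \<beta> :: "('a, 'k) net"
  have "\<exists>\<beta>. cut V \<beta>" if V: "V \<in> I" for V
  proof -
    let ?L = "X closure_of V"
    have "good V" using V by (simp add: I_def)
    then obtain K W \<phi> where K: "V \<subseteq> K" "compactin X K" "(W, \<phi>) \<in> A" "K \<subseteq> W \<inter> \<Omega>" unfolding good_def by blast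
    have LK: "?L \<subseteq> K" using K(1) by (rule closure_of_minimal[OF _ compactin_imp_closedin[OF hausdorff K(2)]])
    have L1: "compactin X ?L" by (rule closed_compactin[OF K(2) LK closedin_closure_of])
    have L2: "?L \<subseteq> W \<inter> \<Omega>" using LK K(4) by (rule order_trans)
    have L0: "V \<subseteq> ?L" by (rule closure_of_subset[OF openin_subset[OF openI[OF V]]])
    have E1: "openin X (E V)" unfolding E_def using openI by (intro openin_Union) blast
    have E2: "Z\<^sub>1 \<inter> ?L \<subseteq> E V"
    proof
      fix z assume z: "z \<in> Z\<^sub>1 \<inter> ?L"
      then have "z \<in> \<Union>\<V>" using \<V>(2) closedin_subset[OF Z(1)] by blast
      then obtain V' where V': "V' \<in> \<V>" "z \<in> V'" by blast
      then have "V' \<in> I" using bad[of V'] z by blast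
      \<comment> \<open>V' is an open neighbourhood of a point of the closure of V, hence meets V
        and belongs to its star.\<close>
      moreover have "V' \<inter> V \<noteq> {}" using z V' openI[OF \<open>V' \<in> I\<close>] by (auto simp: in_closure_of)
      ultimately show "z \<in> E V" using V'(2) unfolding E_def by blast
    qed
    obtain \<beta> :: "('a, 'k) net" where "\<And>p. p \<in> topspace X \<Longrightarrow> tame_at p \<beta>"
      "\<And>\<epsilon> p. norm (\<beta> \<epsilon> p) \<le> 1" "\<And>\<epsilon> p. p \<notin> E V \<Longrightarrow> \<beta> \<epsilon> p = 1"
      "\<And>p. p \<in> topspace X - Z\<^sub>1 \<Longrightarrow> \<exists>G. openin X G \<and> p \<in> G \<and> (\<forall>\<^sub>F \<epsilon> in at_right 0. \<forall>q\<in>G. \<beta> \<epsilon> q = 1)"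
      "\<And>p. p \<in> V - Z\<^sub>2 \<Longrightarrow> null_at p (\<lambda>\<epsilon> q. \<beta> \<epsilon> q * u \<epsilon> q)"
      by (rule local_cutoff[OF K(3) \<Omega> openI[OF V] L0 L1 L2 Z(1,2) null E1 E2], assumption) (rule that)
    then show ?thesis unfolding cut_def by (intro exI[of _ \<beta>] conjI allI ballI impI)
  qed
  then have "\<exists>\<beta>. \<forall>V\<in>I. cut V (\<beta> V)" by (intro bchoice ballI)
  then obtain \<beta> :: "'a set \<Rightarrow> ('a, 'k) net" where "\<forall>V\<in>I. cut V (\<beta> V)" by blast
  then have \<beta>: "\<And>V p. V \<in> I \<Longrightarrow> p \<in> topspace X \<Longrightarrow> tame_at p (\<beta> V)"
    "\<And>V \<epsilon> p. V \<in> I \<Longrightarrow> norm (\<beta> V \<epsilon> p) \<le> 1" "\<And>V \<epsilon> p. V \<in> I \<Longrightarrow> p \<notin> E V \<Longrightarrow> \<beta> V \<epsilon> p = 1"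
    "\<And>V p. V \<in> I \<Longrightarrow> p \<in> topspace X - Z\<^sub>1 \<Longrightarrow> \<exists>G. openin X G \<and> p \<in> G \<and> (\<forall>\<^sub>F \<epsilon> in at_right 0. \<forall>q\<in>G. \<beta> V \<epsilon> q = 1)"
    "\<And>V p. V \<in> I \<Longrightarrow> p \<in> V - Z\<^sub>2 \<Longrightarrow> null_at p (\<lambda>\<epsilon> q. \<beta> V \<epsilon> q * u \<epsilon> q)"
    unfolding cut_def by blast+
  define \<kappa> where "\<kappa> \<epsilon> p = (\<Prod>V\<in>{V \<in> I. p \<in> E V}. \<beta> V \<epsilon> p)" for \<epsilon> p
  \<comment> \<open>The index set in the definition of \<open>\<kappa>\<close> depends on the point.
    On G it can be enlarged to a fixed finite set, because \<open>\<beta> V\<close> is 1 outside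
    \<open>E V\<close>; the rules for finite products then apply.\<close>
  have local: "\<kappa> \<epsilon> q = (\<Prod>V\<in>{V \<in> I. E V \<inter> G \<noteq> {}}. \<beta> V \<epsilon> q)"
    if "finite {V \<in> I. E V \<inter> G \<noteq> {}}" "q \<in> G" for G \<epsilon> q
    unfolding \<kappa>_def using that \<beta>(3) by (intro prod.mono_neutral_left) auto
  show thesis
  proof (rule that[of \<kappa>])
    show "tame_at p \<kappa>" if p: "p \<in> topspace X" for p
    proof -
      obtain G where G: "openin X G" "p \<in> G" "finite {V \<in> I. E V \<inter> G \<noteq> {}}" using locfin[OF p] by blast
      have "tame_at p (\<lambda>\<epsilon> q. \<Prod>V\<in>{V \<in> I. E V \<inter> G \<noteq> {}}. \<beta> V \<epsilon> q)"
        using G(3) by (rule tame_at_prod) (use \<beta>(1) p in auto)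
      then show ?thesis by (rule tame_at_cong[OF _ G(1,2)]) (simp add: local[OF G(3)])
    qed
    show "norm (\<kappa> \<epsilon> p) \<le> 1" for \<epsilon> p
      unfolding \<kappa>_def prod_norm[symmetric] by (rule prod_le_1) (simp add: \<beta>(2))
    show "\<exists>G. openin X G \<and> p \<in> G \<and> (\<forall>\<^sub>F \<epsilon> in at_right 0. \<forall>q\<in>G. \<kappa> \<epsilon> q = 1)"
      if p: "p \<in> topspace X - Z\<^sub>1" for p
    proof -
      have pX: "p \<in> topspace X" using p by blast
      obtain G where G: "openin X G" "p \<in> G" "finite {V \<in> I. E V \<inter> G \<noteq> {}}" using locfin[OF pX] by blast
      obtain H where H: "openin X H" "p \<in> H"
        and ev: "\<forall>\<^sub>F \<epsilon> in at_right 0. \<forall>q\<in>H. \<forall>V\<in>{V \<in> I. E V \<inter> G \<noteq> {}}. \<beta> V \<epsilon> q = 1"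
        using eventually_near_ball_finite[OF G(3) pX, of "\<lambda>V \<epsilon> q. \<beta> V \<epsilon> q = 1"] \<beta>(4)[OF _ p] by blast
      have "\<forall>\<^sub>F \<epsilon> in at_right 0. \<forall>q\<in>G \<inter> H. \<kappa> \<epsilon> q = 1"
        using ev by eventually_elim (simp add: local[OF G(3)])
      moreover have "openin X (G \<inter> H)" using G(1) H(1) by (rule openin_Int)
      ultimately show ?thesis using G(2) H(2) by blast
    qed
    show "null_at p (\<lambda>\<epsilon> q. \<kappa> \<epsilon> q * u \<epsilon> q)" if p: "p \<in> Z\<^sub>1 - Z\<^sub>2" for p
    proof -
      have pX: "p \<in> \<Union>\<V>" using \<V>(2) closedin_subset[OF Z(1)] p by blast
      then obtain V where V: "V \<in> \<V>" "p \<in> V" by blast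
      then have VI: "V \<in> I" using bad[of V] p by blast
      have dom: "norm (\<kappa> \<epsilon> q) \<le> norm (\<beta> V \<epsilon> q)" if q: "q \<in> V" for \<epsilon> q
      proof -
        have qX: "q \<in> topspace X" using q openin_subset[OF openI[OF VI]] by blast
        obtain G where G: "openin X G" "q \<in> G" "finite {V \<in> I. E V \<inter> G \<noteq> {}}" using locfin[OF qX] by blast
        have fin: "finite {V \<in> I. q \<in> E V}" using G(3) by (rule rev_finite_subset) (use G(2) in blast)
        have mem: "V \<in> {V \<in> I. q \<in> E V}" using VI q unfolding E_def by blast
        have "norm (\<kappa> \<epsilon> q) = norm (\<beta> V \<epsilon> q) * (\<Prod>V\<in>{V \<in> I. q \<in> E V} - {V}. norm (\<beta> V \<epsilon> q))"
          unfolding \<kappa>_def prod.remove[OF fin mem] norm_mult prod_norm[symmetric] ..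
        also have "\<dots> \<le> norm (\<beta> V \<epsilon> q) * 1"
          by (intro mult_left_mono prod_le_1) (simp_all add: \<beta>(2))
        finally show ?thesis by simp
      qed
      have "null_at p (\<lambda>\<epsilon> q. \<beta> V \<epsilon> q * u \<epsilon> q)" using \<beta>(5)[OF VI] V(2) p by blast
      then show ?thesis
        by (rule null_at_dominated[OF _ openI[OF VI] V(2)]) (simp add: norm_mult mult_right_mono dom)
    qed
  qed
qed

end

theorem theorem2p3:
  fixes X :: "'a topology" and A :: "('a, 'e::{real_inner, heine_borel}) chart set"
  assumes "smooth_manifold X A" and "Hausdorff_space X" and "paracompact_space X"
  shows "supple X (gen_fun X A :: 'a set \<Rightarrow> ('a, 'k::real_normed_field) net set ring)
           (gen_restrict X A)"
  unfolding supple_def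
proof (intro allI impI, elim conjE)
  interpret hausdorff_manifold X A using assms(1,2) by unfold_locales
  let ?supp = "sheaf_supp X (gen_fun X A :: 'a set \<Rightarrow> ('a, 'k) net set ring) (gen_restrict X A)"
  fix U Z\<^sub>1 Z\<^sub>2 and f :: "('a, 'k) net set"
  assume U: "openin X U" and f: "f \<in> carrier (gen_fun X A U)" and Z: "closedin X Z\<^sub>1" "closedin X Z\<^sub>2"
    and supp: "?supp U f = Z\<^sub>1 \<union> Z\<^sub>2"
  obtain u where u: "u \<in> moderate_nets X A U" and fu: "f = gen_class X A U u"
    using f unfolding carrier_gen_fun by blast
  have tame_u: "\<And>p. p \<in> U \<Longrightarrow> tame_at p u" using u moderate_iff_tame[OF U] by blast
  have UX: "p \<in> topspace X" if "p \<in> U" for p using openin_subset[OF U] that by blast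
  have supp_u: "{p \<in> U. \<not> null_at p u} = Z\<^sub>1 \<union> Z\<^sub>2" using supp unfolding fu sheaf_supp_gen_class[OF U u] .
  \<comment> \<open>The support is a subset of U by definition; hence every point of
    \<open>Z\<^sub>1\<close> has a compact coordinate neighbourhood inside U.\<close>
  have ZU: "Z\<^sub>1 \<subseteq> U" and null: "\<And>p. p \<in> U - (Z\<^sub>1 \<union> Z\<^sub>2) \<Longrightarrow> null_at p u" using supp_u by blast+
  obtain \<kappa> :: "('a, 'k) net" where \<kappa>: "\<And>p. p \<in> topspace X \<Longrightarrow> tame_at p \<kappa>" "\<And>\<epsilon> p. norm (\<kappa> \<epsilon> p) \<le> 1"
    "\<And>p. p \<in> topspace X - Z\<^sub>1 \<Longrightarrow> \<exists>G. openin X G \<and> p \<in> G \<and> (\<forall>\<^sub>F \<epsilon> in at_right 0. \<forall>q\<in>G. \<kappa> \<epsilon> q = 1)"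
    "\<And>p. p \<in> Z\<^sub>1 - Z\<^sub>2 \<Longrightarrow> null_at p (\<lambda>\<epsilon> q. \<kappa> \<epsilon> q * u \<epsilon> q)"
    by (rule global_cutoff[OF assms(3) U Z ZU null], assumption) (rule that)
  \<comment> \<open>The form with the factor -1 matches the rules for sums, products and constants.
    Where the cutoff is 1, this net is identically 0.\<close>
  define u\<^sub>1 where "u\<^sub>1 = (\<lambda>\<epsilon> q. (1 + - 1 * \<kappa> \<epsilon> q) * u \<epsilon> q)"
  define u\<^sub>2 where "u\<^sub>2 = (\<lambda>\<epsilon> q. \<kappa> \<epsilon> q * u \<epsilon> q)"
  have u1: "u\<^sub>1 \<in> moderate_nets X A U" unfolding u\<^sub>1_def
    by (intro moderate_if_tame[OF U] tame_at_mult tame_at_add tame_at_const \<kappa>(1) tame_u UX)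
  have u2: "u\<^sub>2 \<in> moderate_nets X A U" unfolding u\<^sub>2_def
    by (intro moderate_if_tame[OF U] tame_at_mult \<kappa>(1) tame_u UX)
  have null1: "null_at p u\<^sub>1" if p: "p \<in> U" "p \<notin> Z\<^sub>1" for p
  proof -
    obtain G where G: "openin X G" "p \<in> G" "\<forall>\<^sub>F \<epsilon> in at_right 0. \<forall>q\<in>G. \<kappa> \<epsilon> q = 1"
      using \<kappa>(3)[of p] p UX by blast
    from G(3) have "\<forall>\<^sub>F \<epsilon> in at_right 0. \<forall>q\<in>G. norm (u\<^sub>1 \<epsilon> q) \<le> norm (0 :: 'k)"
      by eventually_elim (simp add: u\<^sub>1_def)
    then show ?thesis by (rule null_at_dominated[OF null_at_zero[OF UX[OF p(1)]] G(1,2)])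
  qed
  \<comment> \<open>Two different reasons apply: on \<open>Z\<^sub>1\<close> the cutoff was built
    for this purpose, whereas off both closed sets u itself is null and a factor of norm at most 1
    keeps it so.\<close>
  have null2: "null_at p u\<^sub>2" if p: "p \<in> U" "p \<notin> Z\<^sub>2" for p
  proof (cases "p \<in> Z\<^sub>1")
    case True
    then show ?thesis unfolding u\<^sub>2_def using \<kappa>(4) p by blast
  next
    case False
    then have "null_at p u" using null p by blast
    then show ?thesis
      by (rule null_at_dominated[OF _ U p(1)]) (simp add: u\<^sub>2_def norm_mult mult_left_le_one_le \<kappa>(2))
  qed
  show "\<exists>f\<^sub>1\<in>carrier (gen_fun X A U). \<exists>f\<^sub>2\<in>carrier (gen_fun X A U).
      ?supp U f\<^sub>1 \<subseteq> Z\<^sub>1 \<and> ?supp U f\<^sub>2 \<subseteq> Z\<^sub>2 \<and> f = f\<^sub>1 \<oplus>\<^bsub>gen_fun X A U\<^esub> f\<^sub>2"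
  proof (rule bexI[of _ "gen_class X A U u\<^sub>1"], rule bexI[of _ "gen_class X A U u\<^sub>2"], intro conjI)
    show "gen_class X A U u\<^sub>1 \<in> carrier (gen_fun X A U)" "gen_class X A U u\<^sub>2 \<in> carrier (gen_fun X A U)"
      using u1 u2 by (simp_all add: carrier_gen_fun)
    show "?supp U (gen_class X A U u\<^sub>1) \<subseteq> Z\<^sub>1" "?supp U (gen_class X A U u\<^sub>2) \<subseteq> Z\<^sub>2"
      unfolding sheaf_supp_gen_class[OF U u1] sheaf_supp_gen_class[OF U u2] using null1 null2 by blast+
    have "(\<lambda>\<epsilon> p. u\<^sub>1 \<epsilon> p + u\<^sub>2 \<epsilon> p) = u" by (simp add: u\<^sub>1_def u\<^sub>2_def fun_eq_iff algebra_simps)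
    then show "f = gen_class X A U u\<^sub>1 \<oplus>\<^bsub>gen_fun X A U\<^esub> gen_class X A U u\<^sub>2"
      by (simp add: gen_class_add[OF U] fu)
  qed
qed

end
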